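(* Let $R$ be a ring and let $(P,Q,\psi)$ be an $R$-system satisfying Condition (FS) whose Cuntz–Pimsner ring $\mathcal{O}_{(P,Q,\psi)}=\bigoplus_{i\in\mathbb{Z}}\mathcal{O}_i$ is well-defined. If $\mathcal{O}_{(P,Q,\psi)}$ is epsilon-strongly $\mathbb{Z}$-graded and $\mathrm{Ann}_{\mathcal{O}_0}(\mathcal{O}_1)\cap(\mathrm{Ann}_{\mathcal{O}_0}(\mathcal{O}_1))^\perp=\{0\}$, then $\mathcal{O}_{(P,Q,\psi)}\cong_{\mathrm{gr}}\mathcal{O}_{(P',Q',\psi')}$ for some ring $R'$ and some $R'$-system $(P',Q',\psi')$ whose Cuntz–Pimsner ring is well-defined and such that: (a) $(P',Q',\psi')$ is a unital $R'$-system; (b) the Cuntz–Pimsner representation $(\iota^{CP}_{P'},\iota^{CP}_{Q'},\iota^{CP}_{R'},\mathcal{O}_{(P',Q',\psi')})$ is semi-full; (c) $(P',Q',\psi')$ satisfies Condition (FS'); (d) the ideal $I^{(k)}_{\psi',\iota^{CP}_{R'}}$ is unital for every $k\ge0$. Conversely, if $(P',Q',\psi')$ is an $R'$-system whose Cuntz–Pimsner ring is well-defined and (a)–(d) hold, then $\mathcal{O}_{(P',Q',\psi')}$ is epsilon-strongly $\mathbb{Z}$-graded.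
   Context: Rings are associative but not necessarily unital. A $\mathbb{Z}$-graded ring is $S=\bigoplus_{i\in\mathbb{Z}}S_i$ with additive subgroups $S_i$ satisfying $S_mS_n\subseteq S_{m+n}$; for additive subsets $X,Y$, $XY$ denotes the additive subgroup generated by all products $xy$. $\cong_{\mathrm{gr}}$ denotes graded ring isomorphism. For rings $A,B$, an $A$-$B$-bimodule $M$ is s-unital if for every $x\in M$ there are $a\in A$, $b\in B$ with $ax=x=xb$, and unital if there are $a\in A$, $b\in B$ with $ax=x=xb$ for all $x\in M$. An ideal is called unital if, regarded as a ring, it has a multiplicative identity. A $\mathbb{Z}$-graded ring $S$ is epsilon-strongly graded if each $S_i$ is a unital $S_iS_{-i}$-$S_{-i}S_i$-bimodule. For a $\mathbb{Z}$-graded ring $A$, $\mathrm{Ann}_{A_0}(A_1)=\{r\in A_0: ra=0\ \forall a\in A_1\}$, and for an ideal $J$ of $A_0$, $J^\perp=\{r\in A_0: rx=xr=0\ \forall x\in J\}$. An $R$-system is a triple $(P,Q,\psi)$ with $P,Q$ $R$-bimodules and $\psi:P\otimes_RQ\to R$ an $R$-bimodule homomorphism. It is unital if $R$ is a unital ring and $P,Q$ are unital $R$-$R$-bimodules. Put $P^{\otimes0}=Q^{\otimes0}=R$, $\psi_0(r\otimes r')=rr'$, $\psi_1=\psi$, and for $n>1$: $Q^{\otimes n}=Q^{\otimes(n-1)}\otimes_RQ$, $P^{\otimes n}=P\otimes_RP^{\otimes(n-1)}$, $\psi_n((p_1\otimes p_2)\otimes(q_2\otimes q_1))=\psi(p_1\psi_{n-1}(p_2\otimes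 q_2)\otimes q_1)$. A covariant representation of $(P,Q,\psi)$ is a tuple $(S,T,\sigma,B)$ with $B$ a ring, $S:P\to B$, $T:Q\to B$ additive maps, $\sigma:R\to B$ a ring homomorphism, such that $S(pr)=S(p)\sigma(r)$, $S(rp)=\sigma(r)S(p)$, $T(qr)=T(q)\sigma(r)$, $T(rq)=\sigma(r)T(q)$ and $\sigma(\psi(p\otimes q))=S(p)T(q)$. It is surjective if $B$ is generated as a ring by $\sigma(R)\cup S(P)\cup T(Q)$, and graded if it is surjective and $B$ carries a $\mathbb{Z}$-grading with $\sigma(R)\subseteq B_0$, $T(Q)\subseteq B_1$, $S(P)\subseteq B_{-1}$. For a graded covariant representation and $k\ge0$, $I^{(k)}_{\psi,\sigma}$ is the ideal of $B_0$ generated by $\{\sigma(\psi_k(p\otimes q)):p\in P^{\otimes k},q\in Q^{\otimes k}\}$; the representation is semi-full if $B_{-k}B_k=I^{(k)}_{\psi,\sigma}$ for all $k\ge0$. For $q\in Q,p\in P$ let $\theta_{q,p}:Q\to Q$, $x\mapsto q\psi(p\otimes x)$, and $\theta_{p,q}:P\to P$, $y\mapsto\psi(y\otimes q)p$. $\mathcal{F}_P(Q)$ (resp. $\mathcal{F}_Q(P)$) is the additive group generated by all $\theta_{q,p}$ (resp. $\theta_{p,q}$). Condition (FS): for all finite sets $\{q_i\}\subseteq Q$, $\{p_j\}\subseteq P$ there are $\Theta\in\mathcal{F}_P(Q)$, $\Phi\in\mathcal{F}_Q(P)$ with $\Theta(q_i)=q_i$, $\Phi(p_j)=p_j$. Condition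 (FS'): there exist $\Theta\in\mathcal{F}_P(Q)$, $\Phi\in\mathcal{F}_Q(P)$ with $\Theta(q)=q$ and $\Phi(p)=p$ for all $q\in Q,p\in P$. Let $\Delta:R\to\mathrm{End}(Q_R)$, $\Delta(r)(q)=rq$. Under (FS), for each covariant representation there is a unique ring homomorphism $\pi_{T,S}:\mathcal{F}_P(Q)\to B$ with $\pi_{T,S}(\theta_{q,p})=T(q)S(p)$. The Toeplitz representation $(\iota_P,\iota_Q,\iota_R,\mathcal{T}_{(P,Q,\psi)})$ is the universal covariant representation; it is graded with $\mathcal{T}_i$ the additive group generated by the elements $\iota_Q^m(q)\iota_P^n(p)$ and $\iota_R(r)\iota_Q^m(q)\iota_P^n(p)$ with $q\in Q^{\otimes m},p\in P^{\otimes n}$, $m-n=i$ (here $\iota_Q^m(q_1\otimes\cdots\otimes q_m)=\iota_Q(q_1)\cdots\iota_Q(q_m)$, similarly for $\iota_P^n$, and $\iota^0=\iota_R$). Assume (FS) and let $\pi=\pi_{\iota_Q,\iota_P}$. An ideal $J\subseteq R$ is $\psi$-compatible if $\Delta(J)\subseteq\mathcal{F}_P(Q)$ and faithful if $J\cap\ker\Delta=\{0\}$. For $\psi$-compatible $J$, $\mathcal{T}(J)$ is the ideal of $\mathcal{T}_{(P,Q,\psi)}$ generated by $\{\iota_R(x)-\pi(\Delta(x)):x\in J\}$, $\mathcal{O}_{(P,Q,\psi)}(J)=\mathcal{T}_{(P,Q,\psi)}/\mathcal{T}(J)$ with quotient map $\rho$ and grading $\rho(\mathcal{T}_i)$, and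 $(\rho\iota_P,\rho\iota_Q,\rho\iota_R,\mathcal{O}(J))$ is the relative Cuntz–Pimsner representation. If there is a unique maximal $\psi$-compatible faithful ideal $J$, the Cuntz–Pimsner ring is (well-defined and equal to) $\mathcal{O}_{(P,Q,\psi)}=\mathcal{O}_{(P,Q,\psi)}(J)$, with Cuntz–Pimsner representation $(\iota^{CP}_P,\iota^{CP}_Q,\iota^{CP}_R,\mathcal{O}_{(P,Q,\psi)})$ the corresponding relative representation. *)

theory Defs
  imports Main
begin

record 'a rng =
  rcarrier :: "'a set"
  radd :: "'a \<Rightarrow> 'a \<Rightarrow> 'a"
  rmul :: "'a \<Rightarrow> 'a \<Rightarrow> 'a"
  rzero :: "'a"
  rneg :: "'a \<Rightarrow> 'a"

definition nu_ring :: "'a rng \<Rightarrow> bool" where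
  "nu_ring A \<longleftrightarrow>
     rzero A \<in> rcarrier A \<and>
     (\<forall>x\<in>rcarrier A. \<forall>y\<in>rcarrier A. radd A x y \<in> rcarrier A \<and> rmul A x y \<in> rcarrier A) \<and>
     (\<forall>x\<in>rcarrier A. rneg A x \<in> rcarrier A) \<and>
     (\<forall>x\<in>rcarrier A. \<forall>y\<in>rcarrier A. \<forall>z\<in>rcarrier A.
        radd A (radd A x y) z = radd A x (radd A y z) \<and>
        rmul A (rmul A x y) z = rmul A x (rmul A y z) \<and>
        rmul A x (radd A y z) = radd A (rmul A x y) (rmul A x z) \<and>
        rmul A (radd A x y) z = radd A (rmul A x z) (rmul A y z)) \<and>
     (\<forall>x\<in>rcarrier A. \<forall>y\<in>rcarrier A. radd A x y = radd A y x) \<and>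
     (\<forall>x\<in>rcarrier A. radd A (rzero A) x = x \<and> radd A (rneg A x) x = rzero A)"

definition rsum :: "'a rng \<Rightarrow> 'a list \<Rightarrow> 'a" where
  "rsum A xs = foldr (radd A) xs (rzero A)"

fun rprod :: "'a rng \<Rightarrow> 'a list \<Rightarrow> 'a" where
  "rprod A [] = rzero A"
| "rprod A [x] = x"
| "rprod A (x # y # ys) = rmul A x (rprod A (y # ys))"

definition addsub_gen :: "'a rng \<Rightarrow> 'a set \<Rightarrow> 'a set" where
  "addsub_gen A S = \<Inter>{H. H \<subseteq> rcarrier A \<and> rzero A \<in> H \<and>
       (\<forall>x\<in>H. \<forall>y\<in>H. radd A x y \<in> H) \<and> (\<forall>x\<in>H. rneg A x \<in> H) \<and> S \<subseteq> H}"

definition prod_set :: "'a rng \<Rightarrow> 'a set \<Rightarrow> 'a set \<Rightarrow> 'a set" where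
  "prod_set A X Y = addsub_gen A {rmul A x y | x y. x \<in> X \<and> y \<in> Y}"

definition is_ideal :: "'a rng \<Rightarrow> 'a set \<Rightarrow> bool" where
  "is_ideal A I \<longleftrightarrow> I \<subseteq> rcarrier A \<and> rzero A \<in> I \<and>
     (\<forall>x\<in>I. \<forall>y\<in>I. radd A x y \<in> I) \<and> (\<forall>x\<in>I. rneg A x \<in> I) \<and>
     (\<forall>x\<in>I. \<forall>a\<in>rcarrier A. rmul A a x \<in> I \<and> rmul A x a \<in> I)"

definition ideal_gen :: "'a rng \<Rightarrow> 'a set \<Rightarrow> 'a set" where
  "ideal_gen A S = \<Inter>{I. is_ideal A I \<and> S \<subseteq> I}"

definition unital_ideal :: "'a rng \<Rightarrow> 'a set \<Rightarrow> bool" where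
  "unital_ideal A I \<longleftrightarrow> (\<exists>e\<in>I. \<forall>x\<in>I. rmul A e x = x \<and> rmul A x e = x)"

definition unital_rng :: "'a rng \<Rightarrow> bool" where
  "unital_rng A \<longleftrightarrow> (\<exists>e\<in>rcarrier A. \<forall>x\<in>rcarrier A. rmul A e x = x \<and> rmul A x e = x)"

definition coset :: "'a rng \<Rightarrow> 'a set \<Rightarrow> 'a \<Rightarrow> 'a set" where
  "coset A I a = {radd A a i | i. i \<in> I}"

definition quot_rng :: "'a rng \<Rightarrow> 'a set \<Rightarrow> 'a set rng" where
  "quot_rng A I = \<lparr> rcarrier = coset A I ` rcarrier A,
     radd = (\<lambda>X Y. coset A I (radd A (SOME x. x \<in> X) (SOME y. y \<in> Y))),
     rmul = (\<lambda>X Y. coset A I (rmul A (SOME x. x \<in> X) (SOME y. y \<in> Y))),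
     rzero = coset A I (rzero A),
     rneg = (\<lambda>X. coset A I (rneg A (SOME x. x \<in> X))) \<rparr>"

record ('r, 'm) bimod =
  mcar :: "'m set"
  madd :: "'m \<Rightarrow> 'm \<Rightarrow> 'm"
  mzero :: "'m"
  mneg :: "'m \<Rightarrow> 'm"
  lact :: "'r \<Rightarrow> 'm \<Rightarrow> 'm"
  ract :: "'m \<Rightarrow> 'r \<Rightarrow> 'm"

definition msum :: "('r, 'm) bimod \<Rightarrow> 'm list \<Rightarrow> 'm" where
  "msum M xs = foldr (madd M) xs (mzero M)"

definition bimodule :: "'r rng \<Rightarrow> ('r, 'm) bimod \<Rightarrow> bool" where
  "bimodule R M \<longleftrightarrow>
     mzero M \<in> mcar M \<and>
     (\<forall>x\<in>mcar M. \<forall>y\<in>mcar M. madd M x y \<in> mcar M) \<and>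
     (\<forall>x\<in>mcar M. mneg M x \<in> mcar M) \<and>
     (\<forall>x\<in>mcar M. \<forall>y\<in>mcar M. \<forall>z\<in>mcar M. madd M (madd M x y) z = madd M x (madd M y z)) \<and>
     (\<forall>x\<in>mcar M. \<forall>y\<in>mcar M. madd M x y = madd M y x) \<and>
     (\<forall>x\<in>mcar M. madd M (mzero M) x = x \<and> madd M (mneg M x) x = mzero M) \<and>
     (\<forall>r\<in>rcarrier R. \<forall>x\<in>mcar M. lact M r x \<in> mcar M \<and> ract M x r \<in> mcar M) \<and>
     (\<forall>r\<in>rcarrier R. \<forall>x\<in>mcar M. \<forall>y\<in>mcar M.
        lact M r (madd M x y) = madd M (lact M r x) (lact M r y) \<and>
        ract M (madd M x y) r = madd M (ract M x r) (ract M y r)) \<and>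
     (\<forall>r\<in>rcarrier R. \<forall>s\<in>rcarrier R. \<forall>x\<in>mcar M.
        lact M (radd R r s) x = madd M (lact M r x) (lact M s x) \<and>
        ract M x (radd R r s) = madd M (ract M x r) (ract M x s) \<and>
        lact M (rmul R r s) x = lact M r (lact M s x) \<and>
        ract M x (rmul R r s) = ract M (ract M x r) s \<and>
        lact M r (ract M x s) = ract M (lact M r x) s)"

text \<open>An $R$-bimodule homomorphism $\psi : P \otimes_R Q \to R$ is represented (via the universal
  property of the tensor product) by an $R$-balanced biadditive map $\psi : P \times Q \to R$
  with $\psi(rp,q) = r\psi(p,q)$ and $\psi(p,qr) = \psi(p,q)r$.\<close>

definition rsystem :: "'r rng \<Rightarrow> ('r,'p) bimod \<Rightarrow> ('r,'q) bimod \<Rightarrow> ('p \<Rightarrow> 'q \<Rightarrow> 'r) \<Rightarrow> bool" where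
  "rsystem R P Q psi \<longleftrightarrow> nu_ring R \<and> bimodule R P \<and> bimodule R Q \<and>
     (\<forall>p\<in>mcar P. \<forall>q\<in>mcar Q. psi p q \<in> rcarrier R) \<and>
     (\<forall>p\<in>mcar P. \<forall>p'\<in>mcar P. \<forall>q\<in>mcar Q. psi (madd P p p') q = radd R (psi p q) (psi p' q)) \<and>
     (\<forall>p\<in>mcar P. \<forall>q\<in>mcar Q. \<forall>q'\<in>mcar Q. psi p (madd Q q q') = radd R (psi p q) (psi p q')) \<and>
     (\<forall>r\<in>rcarrier R. \<forall>p\<in>mcar P. \<forall>q\<in>mcar Q.
        psi (ract P p r) q = psi p (lact Q r q) \<and>
        psi (lact P r p) q = rmul R r (psi p q) \<and>
        psi p (ract Q q r) = rmul R (psi p q) r)"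

definition unital_bimod :: "'r rng \<Rightarrow> ('r,'m) bimod \<Rightarrow> bool" where
  "unital_bimod R M \<longleftrightarrow> (\<exists>a\<in>rcarrier R. \<exists>b\<in>rcarrier R. \<forall>x\<in>mcar M. lact M a x = x \<and> ract M x b = x)"

definition unital_system :: "'r rng \<Rightarrow> ('r,'p) bimod \<Rightarrow> ('r,'q) bimod \<Rightarrow> bool" where
  "unital_system R P Q \<longleftrightarrow> unital_rng R \<and> unital_bimod R P \<and> unital_bimod R Q"

text \<open>$\psi_k$ on elementary tensors $p_1\otimes\cdots\otimes p_k \in P^{\otimes k}$ and
  $x_1\otimes\cdots\otimes x_k \in Q^{\otimes k}$ (lists in this order), $k \ge 1$:
  $\psi_k((p_1\otimes p')\otimes(q'\otimes x_k)) = \psi(p_1\psi_{k-1}(p'\otimes q')\otimes x_k)$.\<close>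

fun psik :: "('p \<Rightarrow> 'q \<Rightarrow> 'r) \<Rightarrow> ('p \<Rightarrow> 'r \<Rightarrow> 'p) \<Rightarrow> 'p list \<Rightarrow> 'q list \<Rightarrow> 'r" where
  "psik psi ra [] qs = undefined"
| "psik psi ra [p] qs = psi p (last qs)"
| "psik psi ra (p # p' # ps) qs = psi (ra p (psik psi ra (p' # ps) (butlast qs))) (last qs)"

text \<open>Values of $\psi_k$ on elementary tensors (these generate the same ideal as all values).\<close>
definition psi_vals :: "'r rng \<Rightarrow> ('r,'p) bimod \<Rightarrow> ('r,'q) bimod \<Rightarrow> ('p \<Rightarrow> 'q \<Rightarrow> 'r) \<Rightarrow> nat \<Rightarrow> 'r set" where
  "psi_vals R P Q psi k = (if k = 0 then {rmul R r r' | r r'. r \<in> rcarrier R \<and> r' \<in> rcarrier R}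
     else {psik psi (ract P) ps qs | ps qs. set ps \<subseteq> mcar P \<and> set qs \<subseteq> mcar Q \<and>
                                       length ps = k \<and> length qs = k})"

definition in_FPQ :: "'r rng \<Rightarrow> ('r,'p) bimod \<Rightarrow> ('r,'q) bimod \<Rightarrow> ('p \<Rightarrow> 'q \<Rightarrow> 'r) \<Rightarrow> ('q \<Rightarrow> 'q) \<Rightarrow> bool" where
  "in_FPQ R P Q psi Th \<longleftrightarrow> (\<exists>l. set l \<subseteq> mcar Q \<times> mcar P \<and>
     (\<forall>x\<in>mcar Q. Th x = msum Q (map (\<lambda>(q,p). ract Q q (psi p x)) l)))"

definition in_FQP :: "'r rng \<Rightarrow> ('r,'p) bimod \<Rightarrow> ('r,'q) bimod \<Rightarrow> ('p \<Rightarrow> 'q \<Rightarrow> 'r) \<Rightarrow> ('p \<Rightarrow> 'p) \<Rightarrow> bool" where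
  "in_FQP R P Q psi Ph \<longleftrightarrow> (\<exists>l. set l \<subseteq> mcar P \<times> mcar Q \<and>
     (\<forall>y\<in>mcar P. Ph y = msum P (map (\<lambda>(p,q). lact P (psi y q) p) l)))"

definition cond_FS :: "'r rng \<Rightarrow> ('r,'p) bimod \<Rightarrow> ('r,'q) bimod \<Rightarrow> ('p \<Rightarrow> 'q \<Rightarrow> 'r) \<Rightarrow> bool" where
  "cond_FS R P Q psi \<longleftrightarrow> (\<forall>qs ps. finite qs \<and> qs \<subseteq> mcar Q \<and> finite ps \<and> ps \<subseteq> mcar P \<longrightarrow>
     (\<exists>Th Ph. in_FPQ R P Q psi Th \<and> in_FQP R P Q psi Ph \<and>
        (\<forall>q\<in>qs. Th q = q) \<and> (\<forall>p\<in>ps. Ph p = p)))"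

definition cond_FS' :: "'r rng \<Rightarrow> ('r,'p) bimod \<Rightarrow> ('r,'q) bimod \<Rightarrow> ('p \<Rightarrow> 'q \<Rightarrow> 'r) \<Rightarrow> bool" where
  "cond_FS' R P Q psi \<longleftrightarrow> (\<exists>Th Ph. in_FPQ R P Q psi Th \<and> in_FQP R P Q psi Ph \<and>
        (\<forall>q\<in>mcar Q. Th q = q) \<and> (\<forall>p\<in>mcar P. Ph p = p))"

definition psi_compatible :: "'r rng \<Rightarrow> ('r,'p) bimod \<Rightarrow> ('r,'q) bimod \<Rightarrow> ('p \<Rightarrow> 'q \<Rightarrow> 'r) \<Rightarrow> 'r set \<Rightarrow> bool" where
  "psi_compatible R P Q psi J \<longleftrightarrow> is_ideal R J \<and> (\<forall>x\<in>J. in_FPQ R P Q psi (lact Q x))"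

definition faithful_ideal :: "'r rng \<Rightarrow> ('r,'q) bimod \<Rightarrow> 'r set \<Rightarrow> bool" where
  "faithful_ideal R Q J \<longleftrightarrow> (\<forall>x\<in>J. (\<forall>q\<in>mcar Q. lact Q x q = mzero Q) \<longrightarrow> x = rzero R)"

definition max_cf_ideal :: "'r rng \<Rightarrow> ('r,'p) bimod \<Rightarrow> ('r,'q) bimod \<Rightarrow> ('p \<Rightarrow> 'q \<Rightarrow> 'r) \<Rightarrow> 'r set \<Rightarrow> bool" where
  "max_cf_ideal R P Q psi J \<longleftrightarrow> psi_compatible R P Q psi J \<and> faithful_ideal R Q J \<and>
     (\<forall>J'. psi_compatible R P Q psi J' \<and> faithful_ideal R Q J' \<and> J \<subseteq> J' \<longrightarrow> J' = J)"

definition cp_well_defined :: "'r rng \<Rightarrow> ('r,'p) bimod \<Rightarrow> ('r,'q) bimod \<Rightarrow> ('p \<Rightarrow> 'q \<Rightarrow> 'r) \<Rightarrow> bool" where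
  "cp_well_defined R P Q psi \<longleftrightarrow> (\<exists>!J. max_cf_ideal R P Q psi J)"

definition cp_ideal :: "'r rng \<Rightarrow> ('r,'p) bimod \<Rightarrow> ('r,'q) bimod \<Rightarrow> ('p \<Rightarrow> 'q \<Rightarrow> 'r) \<Rightarrow> 'r set" where
  "cp_ideal R P Q psi = (THE J. max_cf_ideal R P Q psi J)"

definition free_rng :: "'g set \<Rightarrow> ('g list \<Rightarrow> int) rng" where
  "free_rng G = \<lparr> rcarrier = {f. finite {w. f w \<noteq> 0} \<and> (\<forall>w. f w \<noteq> 0 \<longrightarrow> w \<noteq> [] \<and> set w \<subseteq> G)},
     radd = (\<lambda>f g w. f w + g w),
     rmul = (\<lambda>f g w. \<Sum>i\<le>length w. f (take i w) * g (drop i w)),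
     rzero = (\<lambda>w. 0),
     rneg = (\<lambda>f w. - f w) \<rparr>"

definition fr_gen :: "'g \<Rightarrow> 'g list \<Rightarrow> int" where
  "fr_gen x = (\<lambda>w. if w = [x] then 1 else 0)"

type_synonym ('r,'p,'q) fgen = "'r + 'p + 'q"
type_synonym ('r,'p,'q) felt = "('r,'p,'q) fgen list \<Rightarrow> int"
type_synonym ('r,'p,'q) telt = "('r,'p,'q) felt set"
type_synonym ('r,'p,'q) cpelt = "('r,'p,'q) telt set"

definition gens :: "'r rng \<Rightarrow> ('r,'p) bimod \<Rightarrow> ('r,'q) bimod \<Rightarrow> ('r,'p,'q) fgen set" where
  "gens R P Q = Inl ` rcarrier R \<union> Inr ` Inl ` mcar P \<union> Inr ` Inr ` mcar Q"

definition FR :: "'r rng \<Rightarrow> ('r,'p) bimod \<Rightarrow> ('r,'q) bimod \<Rightarrow> ('r,'p,'q) felt rng" where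
  "FR R P Q = free_rng (gens R P Q)"

definition gR :: "'r \<Rightarrow> ('r,'p,'q) felt" where "gR r = fr_gen (Inl r)"
definition gP :: "'p \<Rightarrow> ('r,'p,'q) felt" where "gP p = fr_gen (Inr (Inl p))"
definition gQ :: "'q \<Rightarrow> ('r,'p,'q) felt" where "gQ q = fr_gen (Inr (Inr q))"

text \<open>Relations of a covariant representation: \<open>\<sigma>\<close> ring hom, \<open>S\<close>, \<open>T\<close> additive and
  bimodule-compatible, \<open>\<sigma>(\<psi>(p\<otimes>q)) = S(p)T(q)\<close>.\<close>
definition toep_rels :: "'r rng \<Rightarrow> ('r,'p) bimod \<Rightarrow> ('r,'q) bimod \<Rightarrow> ('p \<Rightarrow> 'q \<Rightarrow> 'r) \<Rightarrow> ('r,'p,'q) felt set" where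
  "toep_rels R P Q psi = (let F = FR R P Q; sub = (\<lambda>a b. radd F a (rneg F b)) in
       {sub (gR (radd R r s)) (radd F (gR r) (gR s)) | r s. r \<in> rcarrier R \<and> s \<in> rcarrier R}
     \<union> {sub (gR (rmul R r s)) (rmul F (gR r) (gR s)) | r s. r \<in> rcarrier R \<and> s \<in> rcarrier R}
     \<union> {sub (gP (madd P p p')) (radd F (gP p) (gP p')) | p p'. p \<in> mcar P \<and> p' \<in> mcar P}
     \<union> {sub (gQ (madd Q q q')) (radd F (gQ q) (gQ q')) | q q'. q \<in> mcar Q \<and> q' \<in> mcar Q}
     \<union> {sub (gP (ract P p r)) (rmul F (gP p) (gR r)) | p r. p \<in> mcar P \<and> r \<in> rcarrier R}
     \<union> {sub (gP (lact P r p)) (rmul F (gR r) (gP p)) | p r. p \<in> mcar P \<and> r \<in> rcarrier R}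
     \<union> {sub (gQ (ract Q q r)) (rmul F (gQ q) (gR r)) | q r. q \<in> mcar Q \<and> r \<in> rcarrier R}
     \<union> {sub (gQ (lact Q r q)) (rmul F (gR r) (gQ q)) | q r. q \<in> mcar Q \<and> r \<in> rcarrier R}
     \<union> {sub (gR (psi p q)) (rmul F (gP p) (gQ q)) | p q. p \<in> mcar P \<and> q \<in> mcar Q})"

definition toep_ker :: "'r rng \<Rightarrow> ('r,'p) bimod \<Rightarrow> ('r,'q) bimod \<Rightarrow> ('p \<Rightarrow> 'q \<Rightarrow> 'r) \<Rightarrow> ('r,'p,'q) felt set" where
  "toep_ker R P Q psi = ideal_gen (FR R P Q) (toep_rels R P Q psi)"

definition toeplitz :: "'r rng \<Rightarrow> ('r,'p) bimod \<Rightarrow> ('r,'q) bimod \<Rightarrow> ('p \<Rightarrow> 'q \<Rightarrow> 'r) \<Rightarrow> ('r,'p,'q) telt rng" where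
  "toeplitz R P Q psi = quot_rng (FR R P Q) (toep_ker R P Q psi)"

definition iotaR :: "'r rng \<Rightarrow> ('r,'p) bimod \<Rightarrow> ('r,'q) bimod \<Rightarrow> ('p \<Rightarrow> 'q \<Rightarrow> 'r) \<Rightarrow> 'r \<Rightarrow> ('r,'p,'q) telt" where
  "iotaR R P Q psi r = coset (FR R P Q) (toep_ker R P Q psi) (gR r)"
definition iotaP :: "'r rng \<Rightarrow> ('r,'p) bimod \<Rightarrow> ('r,'q) bimod \<Rightarrow> ('p \<Rightarrow> 'q \<Rightarrow> 'r) \<Rightarrow> 'p \<Rightarrow> ('r,'p,'q) telt" where
  "iotaP R P Q psi p = coset (FR R P Q) (toep_ker R P Q psi) (gP p)"
definition iotaQ :: "'r rng \<Rightarrow> ('r,'p) bimod \<Rightarrow> ('r,'q) bimod \<Rightarrow> ('p \<Rightarrow> 'q \<Rightarrow> 'r) \<Rightarrow> 'q \<Rightarrow> ('r,'p,'q) telt" where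
  "iotaQ R P Q psi q = coset (FR R P Q) (toep_ker R P Q psi) (gQ q)"

definition toep_monos :: "'r rng \<Rightarrow> ('r,'p) bimod \<Rightarrow> ('r,'q) bimod \<Rightarrow> ('p \<Rightarrow> 'q \<Rightarrow> 'r) \<Rightarrow> int \<Rightarrow> ('r,'p,'q) telt set" where
  "toep_monos R P Q psi i = (let T = toeplitz R P Q psi in
      {rprod T (map (iotaQ R P Q psi) qs @ map (iotaP R P Q psi) ps) | qs ps.
         set qs \<subseteq> mcar Q \<and> set ps \<subseteq> mcar P \<and> length qs + length ps > 0 \<and> int (length qs) - int (length ps) = i}
    \<union> {rprod T (iotaR R P Q psi r # map (iotaQ R P Q psi) qs @ map (iotaP R P Q psi) ps) | r qs ps.
         r \<in> rcarrier R \<and> set qs \<subseteq> mcar Q \<and> set ps \<subseteq> mcar P \<and> int (length qs) - int (length ps) = i})"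

definition toep_grading :: "'r rng \<Rightarrow> ('r,'p) bimod \<Rightarrow> ('r,'q) bimod \<Rightarrow> ('p \<Rightarrow> 'q \<Rightarrow> 'r) \<Rightarrow> int \<Rightarrow> ('r,'p,'q) telt set" where
  "toep_grading R P Q psi i = addsub_gen (toeplitz R P Q psi) (toep_monos R P Q psi i)"

text \<open>Generators \<open>\<iota>_R(x) - \<pi>(\<Delta>(x))\<close>, \<open>x \<in> J\<close>, where \<open>\<pi>(\<Sigma> \<theta>_{q_i,p_i}) = \<Sigma> \<iota>_Q(q_i)\<iota>_P(p_i)\<close>
  (all representations of \<open>\<Delta>(x)\<close> are used; under (FS) \<open>\<pi>\<close> is well-defined).\<close>
definition TJ_gens :: "'r rng \<Rightarrow> ('r,'p) bimod \<Rightarrow> ('r,'q) bimod \<Rightarrow> ('p \<Rightarrow> 'q \<Rightarrow> 'r) \<Rightarrow> 'r set \<Rightarrow> ('r,'p,'q) telt set" where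
  "TJ_gens R P Q psi J = (let T = toeplitz R P Q psi in
     {radd T (iotaR R P Q psi x)
        (rneg T (rsum T (map (\<lambda>(q,p). rmul T (iotaQ R P Q psi q) (iotaP R P Q psi p)) l))) | x l.
        x \<in> J \<and> set l \<subseteq> mcar Q \<times> mcar P \<and>
        (\<forall>y\<in>mcar Q. lact Q x y = msum Q (map (\<lambda>(q,p). ract Q q (psi p y)) l))})"

definition TJ :: "'r rng \<Rightarrow> ('r,'p) bimod \<Rightarrow> ('r,'q) bimod \<Rightarrow> ('p \<Rightarrow> 'q \<Rightarrow> 'r) \<Rightarrow> 'r set \<Rightarrow> ('r,'p,'q) telt set" where
  "TJ R P Q psi J = ideal_gen (toeplitz R P Q psi) (TJ_gens R P Q psi J)"

definition rel_cp :: "'r rng \<Rightarrow> ('r,'p) bimod \<Rightarrow> ('r,'q) bimod \<Rightarrow> ('p \<Rightarrow> 'q \<Rightarrow> 'r) \<Rightarrow> 'r set \<Rightarrow> ('r,'p,'q) cpelt rng" where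
  "rel_cp R P Q psi J = quot_rng (toeplitz R P Q psi) (TJ R P Q psi J)"

definition rel_rho :: "'r rng \<Rightarrow> ('r,'p) bimod \<Rightarrow> ('r,'q) bimod \<Rightarrow> ('p \<Rightarrow> 'q \<Rightarrow> 'r) \<Rightarrow> 'r set \<Rightarrow> ('r,'p,'q) telt \<Rightarrow> ('r,'p,'q) cpelt" where
  "rel_rho R P Q psi J = coset (toeplitz R P Q psi) (TJ R P Q psi J)"

definition rel_cp_grading :: "'r rng \<Rightarrow> ('r,'p) bimod \<Rightarrow> ('r,'q) bimod \<Rightarrow> ('p \<Rightarrow> 'q \<Rightarrow> 'r) \<Rightarrow> 'r set \<Rightarrow> int \<Rightarrow> ('r,'p,'q) cpelt set" where
  "rel_cp_grading R P Q psi J i = rel_rho R P Q psi J ` toep_grading R P Q psi i"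

definition cp_ring :: "'r rng \<Rightarrow> ('r,'p) bimod \<Rightarrow> ('r,'q) bimod \<Rightarrow> ('p \<Rightarrow> 'q \<Rightarrow> 'r) \<Rightarrow> ('r,'p,'q) cpelt rng" where
  "cp_ring R P Q psi = rel_cp R P Q psi (cp_ideal R P Q psi)"

definition cp_grading :: "'r rng \<Rightarrow> ('r,'p) bimod \<Rightarrow> ('r,'q) bimod \<Rightarrow> ('p \<Rightarrow> 'q \<Rightarrow> 'r) \<Rightarrow> int \<Rightarrow> ('r,'p,'q) cpelt set" where
  "cp_grading R P Q psi = rel_cp_grading R P Q psi (cp_ideal R P Q psi)"

definition cp_iotaR :: "'r rng \<Rightarrow> ('r,'p) bimod \<Rightarrow> ('r,'q) bimod \<Rightarrow> ('p \<Rightarrow> 'q \<Rightarrow> 'r) \<Rightarrow> 'r \<Rightarrow> ('r,'p,'q) cpelt" where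
  "cp_iotaR R P Q psi r = rel_rho R P Q psi (cp_ideal R P Q psi) (iotaR R P Q psi r)"

definition eps_strongly_graded :: "'a rng \<Rightarrow> (int \<Rightarrow> 'a set) \<Rightarrow> bool" where
  "eps_strongly_graded A g \<longleftrightarrow> (\<forall>i. \<exists>a\<in>prod_set A (g i) (g (-i)). \<exists>b\<in>prod_set A (g (-i)) (g i).
      \<forall>x\<in>g i. rmul A a x = x \<and> rmul A x b = x)"

definition ann0 :: "'a rng \<Rightarrow> (int \<Rightarrow> 'a set) \<Rightarrow> 'a set" where
  "ann0 A g = {r \<in> g 0. \<forall>a\<in>g 1. rmul A r a = rzero A}"

definition perp0 :: "'a rng \<Rightarrow> (int \<Rightarrow> 'a set) \<Rightarrow> 'a set \<Rightarrow> 'a set" where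
  "perp0 A g J = {r \<in> g 0. \<forall>x\<in>J. rmul A r x = rzero A \<and> rmul A x r = rzero A}"

definition gr_iso :: "'a rng \<Rightarrow> (int \<Rightarrow> 'a set) \<Rightarrow> 'b rng \<Rightarrow> (int \<Rightarrow> 'b set) \<Rightarrow> bool" where
  "gr_iso A gA B gB \<longleftrightarrow> (\<exists>f. bij_betw f (rcarrier A) (rcarrier B) \<and>
     (\<forall>x\<in>rcarrier A. \<forall>y\<in>rcarrier A. f (radd A x y) = radd B (f x) (f y) \<and> f (rmul A x y) = rmul B (f x) (f y)) \<and>
     (\<forall>i. f ` gA i = gB i))"

definition cp_Ik :: "'r rng \<Rightarrow> ('r,'p) bimod \<Rightarrow> ('r,'q) bimod \<Rightarrow> ('p \<Rightarrow> 'q \<Rightarrow> 'r) \<Rightarrow> nat \<Rightarrow> ('r,'p,'q) cpelt set" where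
  "cp_Ik R P Q psi k = ideal_gen ((cp_ring R P Q psi)\<lparr>rcarrier := cp_grading R P Q psi 0\<rparr>)
        (cp_iotaR R P Q psi ` psi_vals R P Q psi k)"

definition cp_semi_full :: "'r rng \<Rightarrow> ('r,'p) bimod \<Rightarrow> ('r,'q) bimod \<Rightarrow> ('p \<Rightarrow> 'q \<Rightarrow> 'r) \<Rightarrow> bool" where
  "cp_semi_full R P Q psi \<longleftrightarrow> (\<forall>k::nat.
     prod_set (cp_ring R P Q psi) (cp_grading R P Q psi (- int k)) (cp_grading R P Q psi (int k))
       = cp_Ik R P Q psi k)"

end

theory Submission
  imports Defs "HOL-Algebra.FiniteProduct"
begin

text \<open>
  Write \<open>O\<close> for the Cuntz--Pimsner ring and take \<open>R' = O\<^sub>0\<close>, \<open>P' = O\<^bsub>-1\<^esub>\<close>, \<open>Q' = O\<^sub>1\<close> with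
  \<open>\<psi>'\<close> the multiplication. Epsilon-strongness provides \<open>\<epsilon>\<^sub>i \<in> O\<^sub>iO\<^bsub>-i\<^esub>\<close> acting as a left
  identity on \<open>O\<^sub>i\<close> and as a right identity on \<open>O\<^bsub>-i\<^esub>\<close>. Writing \<open>\<epsilon>\<^sub>1\<close> as a sum of products gives
  (FS'), and multiplying by \<open>\<epsilon>\<^sub>1\<close> shows that \<open>O\<^sub>1O\<^bsub>-1\<^esub>\<close> is the largest faithful ideal of \<open>O\<^sub>0\<close>.
  Let \<open>O'\<close> be the new Cuntz--Pimsner ring. The inclusions of \<open>O\<^sub>0\<close>, \<open>O\<^bsub>-1\<^esub>\<close>, \<open>O\<^sub>1\<close> into \<open>O\<close>
  and the composite maps of \<open>R\<close>, \<open>P\<close>, \<open>Q\<close> into \<open>O'\<close> are covariant, so the universal properties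
  yield \<open>h : O' \<rightarrow> O\<close> and \<open>f : O \<rightarrow> O'\<close>, and \<open>h \<circ> f = id\<close> on generators. Since
  \<open>T(q)S(p) = \<sigma>(qp)\<close> in \<open>O'\<close>, its components of degree \<open>0\<close> and \<open>\<plusminus>1\<close> are just the images of
  \<open>O\<^sub>0\<close> and \<open>O\<^bsub>\<plusminus>1\<^esub>\<close>; hence \<open>h\<close> is injective there, and \<open>f \<circ> h = id\<close> follows. In this way the
  directness of the gradings is never needed.

  For the converse, (FS') gives a left identity \<open>\<Sum> T(q\<^sub>j)S(p\<^sub>j)\<close> of \<open>O\<^sub>1\<close>, and from a left
  identity \<open>e\<close> of \<open>O\<^sub>k\<close> one obtains the left identity \<open>\<Sum> T(q\<^sub>j) e S(p\<^sub>j)\<close> of \<open>O\<^bsub>k+1\<^esub>\<close>; right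
  identities of \<open>O\<^bsub>-k\<^esub>\<close> arise in the same way. The identity of \<open>O\<^bsub>-k\<^esub>O\<^sub>k = I\<^sup>(\<^sup>k\<^sup>)\<close> serves on
  the remaining sides.
\<close>

section \<open>Non-unital rings\<close>

notation radd (infixl "\<boxplus>\<index>" 65)
notation rmul (infixl "\<boxdot>\<index>" 70)
notation rneg ("\<boxminus>\<index> _" [81] 80)

locale nuring =
  fixes A :: "'a rng" (structure)
  assumes nu_ring: "nu_ring A"
begin

lemma zero_closed [simp, intro]: "rzero A \<in> rcarrier A"
  and add_closed [simp, intro]: "x \<in> rcarrier A \<Longrightarrow> y \<in> rcarrier A \<Longrightarrow> x \<boxplus> y \<in> rcarrier A"
  and mul_closed [simp, intro]: "x \<in> rcarrier A \<Longrightarrow> y \<in> rcarrier A \<Longrightarrow> x \<boxdot> y \<in> rcarrier A"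
  and neg_closed [simp, intro]: "x \<in> rcarrier A \<Longrightarrow> \<boxminus> x \<in> rcarrier A"
  and add_assoc: "x \<in> rcarrier A \<Longrightarrow> y \<in> rcarrier A \<Longrightarrow> z \<in> rcarrier A \<Longrightarrow> x \<boxplus> y \<boxplus> z = x \<boxplus> (y \<boxplus> z)"
  and mul_assoc: "x \<in> rcarrier A \<Longrightarrow> y \<in> rcarrier A \<Longrightarrow> z \<in> rcarrier A \<Longrightarrow> x \<boxdot> y \<boxdot> z = x \<boxdot> (y \<boxdot> z)"
  and distrib_left: "x \<in> rcarrier A \<Longrightarrow> y \<in> rcarrier A \<Longrightarrow> z \<in> rcarrier A \<Longrightarrow> x \<boxdot> (y \<boxplus> z) = x \<boxdot> y \<boxplus> x \<boxdot> z"
  and distrib_right: "x \<in> rcarrier A \<Longrightarrow> y \<in> rcarrier A \<Longrightarrow> z \<in> rcarrier A \<Longrightarrow> (x \<boxplus> y) \<boxdot> z = x \<boxdot> z \<boxplus> y \<boxdot> z"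
  and add_commute: "x \<in> rcarrier A \<Longrightarrow> y \<in> rcarrier A \<Longrightarrow> x \<boxplus> y = y \<boxplus> x"
  and zero_add [simp]: "x \<in> rcarrier A \<Longrightarrow> rzero A \<boxplus> x = x"
  and neg_add [simp]: "x \<in> rcarrier A \<Longrightarrow> \<boxminus> x \<boxplus> x = rzero A"
  using nu_ring unfolding nu_ring_def by blast+

lemma add_zero [simp]: "x \<in> rcarrier A \<Longrightarrow> x \<boxplus> rzero A = x"
  using add_commute[of x "rzero A"] by simp

lemma add_neg [simp]: "x \<in> rcarrier A \<Longrightarrow> x \<boxplus> \<boxminus> x = rzero A"
  using add_commute[of x "\<boxminus> x"] by simp

lemma add_left_commute: "x \<in> rcarrier A \<Longrightarrow> y \<in> rcarrier A \<Longrightarrow> z \<in> rcarrier A \<Longrightarrow> x \<boxplus> (y \<boxplus> z) = y \<boxplus> (x \<boxplus> z)"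
  by (metis add_assoc add_commute)

lemmas add_ac = add_assoc add_commute add_left_commute

lemma add_neg_cancel [simp]: "x \<in> rcarrier A \<Longrightarrow> y \<in> rcarrier A \<Longrightarrow> x \<boxplus> (\<boxminus> x \<boxplus> y) = y"
  and add_neg_cancel' [simp]: "x \<in> rcarrier A \<Longrightarrow> y \<in> rcarrier A \<Longrightarrow> x \<boxplus> (y \<boxplus> \<boxminus> x) = y"
  by (simp_all add: add_commute[of y] flip: add_assoc)

lemma neg_unique: "x \<in> rcarrier A \<Longrightarrow> y \<in> rcarrier A \<Longrightarrow> x \<boxplus> y = rzero A \<Longrightarrow> y = \<boxminus> x"
  by (metis add_assoc add_zero neg_add neg_closed zero_add)

lemma neg_zero [simp]: "\<boxminus> rzero A = rzero A"
  by (metis neg_unique zero_add zero_closed)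

lemma neg_add_distrib: "x \<in> rcarrier A \<Longrightarrow> y \<in> rcarrier A \<Longrightarrow> \<boxminus> (x \<boxplus> y) = \<boxminus> x \<boxplus> \<boxminus> y"
  by (rule neg_unique[symmetric]) (simp_all add: add_ac)

lemma diff_eq_iff:
  "x \<in> rcarrier A \<Longrightarrow> y \<in> rcarrier A \<Longrightarrow> z \<in> rcarrier A \<Longrightarrow> x \<boxplus> \<boxminus> y = z \<longleftrightarrow> x = y \<boxplus> z"
  by (metis add_assoc add_commute add_neg add_zero neg_closed)

lemma add_idem_eq_zero: "x \<in> rcarrier A \<Longrightarrow> x \<boxplus> x = x \<Longrightarrow> x = rzero A"
  using diff_eq_iff[of x x x] by simp

end

subsection \<open>Homomorphisms\<close>

locale addhom = A: nuring A + B: nuring B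
  for A :: "'a rng" and B :: "'b rng" +
  fixes f :: "'a \<Rightarrow> 'b"
  assumes map_closed: "x \<in> rcarrier A \<Longrightarrow> f x \<in> rcarrier B"
    and map_add: "x \<in> rcarrier A \<Longrightarrow> y \<in> rcarrier A \<Longrightarrow> f (radd A x y) = radd B (f x) (f y)"
begin

lemma map_zero: "f (rzero A) = rzero B"
  by (rule B.add_idem_eq_zero) (simp_all add: map_closed flip: map_add)

lemma map_neg: "x \<in> rcarrier A \<Longrightarrow> f (rneg A x) = rneg B (f x)"
  by (rule B.neg_unique) (simp_all add: map_closed map_zero flip: map_add)

end

locale rhom = addhom A B f
  for A :: "'a rng" and B :: "'b rng" and f :: "'a \<Rightarrow> 'b" +
  assumes map_mul: "x \<in> rcarrier A \<Longrightarrow> y \<in> rcarrier A \<Longrightarrow> f (rmul A x y) = rmul B (f x) (f y)"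

lemma rhom_imp_addhom: "rhom A B f \<Longrightarrow> addhom A B f"
  by (rule rhom.axioms)

lemma addhom_compose: "addhom A B f \<Longrightarrow> addhom B C g \<Longrightarrow> addhom A C (\<lambda>x. g (f x))"
  by (simp add: addhom_def addhom_axioms_def)

lemma rhom_compose: "rhom A B f \<Longrightarrow> rhom B C g \<Longrightarrow> rhom A C (\<lambda>x. g (f x))"
  by (auto simp: rhom_def rhom_axioms_def addhom.map_closed intro: addhom_compose)

context nuring
begin

lemma rhom_id: "rhom A A (\<lambda>x. x)"
  by unfold_locales auto

lemmas addhom_id = rhom_id[THEN rhom_imp_addhom]

lemma addhom_mul_left: "a \<in> rcarrier A \<Longrightarrow> addhom A A (\<lambda>x. a \<boxdot> x)"
  and addhom_mul_right: "a \<in> rcarrier A \<Longrightarrow> addhom A A (\<lambda>x. x \<boxdot> a)"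
  by (unfold_locales; simp add: distrib_left distrib_right)+

lemma mul_zero [simp]: "x \<in> rcarrier A \<Longrightarrow> x \<boxdot> rzero A = rzero A"
  and zero_mul [simp]: "x \<in> rcarrier A \<Longrightarrow> rzero A \<boxdot> x = rzero A"
  and neg_mul: "x \<in> rcarrier A \<Longrightarrow> y \<in> rcarrier A \<Longrightarrow> \<boxminus> x \<boxdot> y = \<boxminus> (x \<boxdot> y)"
  using addhom.map_zero[OF addhom_mul_left] addhom.map_zero[OF addhom_mul_right]
    addhom.map_neg[OF addhom_mul_right] by auto

end

subsection \<open>Additive subgroups\<close>

definition is_addsub :: "'a rng \<Rightarrow> 'a set \<Rightarrow> bool" where
  "is_addsub A H \<longleftrightarrow> H \<subseteq> rcarrier A \<and> rzero A \<in> H \<and>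
     (\<forall>x\<in>H. \<forall>y\<in>H. radd A x y \<in> H) \<and> (\<forall>x\<in>H. rneg A x \<in> H)"

lemma is_addsubD:
  assumes "is_addsub A H"
  shows "x \<in> H \<Longrightarrow> x \<in> rcarrier A" "rzero A \<in> H"
    "x \<in> H \<Longrightarrow> y \<in> H \<Longrightarrow> radd A x y \<in> H" "x \<in> H \<Longrightarrow> rneg A x \<in> H"
  using assms by (auto simp: is_addsub_def)

lemma addsub_gen_eq_Inter: "addsub_gen A S = \<Inter>{H. is_addsub A H \<and> S \<subseteq> H}"
  unfolding addsub_gen_def is_addsub_def by (rule arg_cong[of _ _ Inter]) auto

lemma addsub_gen_least: "is_addsub A H \<Longrightarrow> S \<subseteq> H \<Longrightarrow> addsub_gen A S \<subseteq> H"
  unfolding addsub_gen_eq_Inter by auto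

lemma subset_addsub_gen: "S \<subseteq> addsub_gen A S"
  unfolding addsub_gen_eq_Inter by auto

lemma (in nuring) is_addsub_carrier: "is_addsub A (rcarrier A)"
  by (auto simp: is_addsub_def)

lemma (in nuring) is_addsub_addsub_gen: "S \<subseteq> rcarrier A \<Longrightarrow> is_addsub A (addsub_gen A S)"
  using is_addsub_carrier unfolding addsub_gen_eq_Inter is_addsub_def by blast

lemma (in nuring) addsub_gen_carrier: "S \<subseteq> rcarrier A \<Longrightarrow> addsub_gen A S \<subseteq> rcarrier A"
  by (intro addsub_gen_least is_addsub_carrier)

lemma is_addsub_equalizer:
  assumes "addhom A B f" "addhom A B g"
  shows "is_addsub A {x \<in> rcarrier A. f x = g x}"
proof -
  interpret f: addhom A B f by fact
  interpret g: addhom A B g by fact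
  show ?thesis
    unfolding is_addsub_def
    by (auto simp: f.map_zero g.map_zero f.map_neg g.map_neg f.map_add g.map_add)
qed

lemma addhom_eq_on_addsub_gen:
  assumes "x \<in> addsub_gen A S" "S \<subseteq> rcarrier A" "addhom A B f" "addhom A B g" "\<And>s. s \<in> S \<Longrightarrow> f s = g s"
  shows "f x = g x"
  using addsub_gen_least[OF is_addsub_equalizer[OF assms(3,4)], of S] assms by auto

context addhom
begin

lemma is_addsub_vimage: "is_addsub B H \<Longrightarrow> is_addsub A {x \<in> rcarrier A. f x \<in> H}"
  by (simp add: is_addsub_def map_zero map_neg map_add)

lemma addsub_gen_mapI:
  assumes "x \<in> addsub_gen A S" "S \<subseteq> rcarrier A" "is_addsub B H" "\<And>s. s \<in> S \<Longrightarrow> f s \<in> H"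
  shows "f x \<in> H"
  using addsub_gen_least[OF is_addsub_vimage[OF assms(3)], of S] assms by auto

lemma is_addsub_image:
  assumes H: "is_addsub A H"
  shows "is_addsub B (f ` H)"
proof -
  note H = is_addsubD[OF H]
  have "rzero B \<in> f ` H" using H(2) map_zero by force
  moreover have "radd B (f x) (f y) \<in> f ` H" if "x \<in> H" "y \<in> H" for x y
    using that H(1,3) by (simp flip: map_add)
  moreover have "rneg B (f x) \<in> f ` H" if "x \<in> H" for x
    using that H(1,4) by (simp flip: map_neg)
  ultimately show ?thesis by (auto simp: is_addsub_def H(1) map_closed)
qed

lemma addsub_gen_image:
  assumes S: "S \<subseteq> rcarrier A"
  shows "f ` addsub_gen A S = addsub_gen B (f ` S)"
proof
  have "is_addsub B (addsub_gen B (f ` S))"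
    using S map_closed by (intro B.is_addsub_addsub_gen) auto
  then show "f ` addsub_gen A S \<subseteq> addsub_gen B (f ` S)"
    using addsub_gen_mapI[OF _ S] subset_addsub_gen[of "f ` S" B] by auto
  show "addsub_gen B (f ` S) \<subseteq> f ` addsub_gen A S"
    by (intro addsub_gen_least is_addsub_image A.is_addsub_addsub_gen S image_mono subset_addsub_gen)
qed

end

definition generates :: "'a rng \<Rightarrow> 'a set \<Rightarrow> bool" where
  "generates A X \<longleftrightarrow> X \<subseteq> rcarrier A \<and>
     (\<forall>H. is_addsub A H \<longrightarrow> (\<forall>x\<in>H. \<forall>y\<in>H. rmul A x y \<in> H) \<longrightarrow> X \<subseteq> H \<longrightarrow> rcarrier A \<subseteq> H)"

lemma generates_least:
  assumes "generates A X" "is_addsub A H" "\<And>x y. x \<in> H \<Longrightarrow> y \<in> H \<Longrightarrow> rmul A x y \<in> H" "X \<subseteq> H"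
  shows "rcarrier A \<subseteq> H"
  using assms unfolding generates_def by blast

lemma generates_image:
  assumes "rhom A B f" "f ` rcarrier A = rcarrier B" "generates A X"
  shows "generates B (f ` X)"
  unfolding generates_def
proof (intro conjI allI impI)
  interpret rhom A B f by fact
  show "f ` X \<subseteq> rcarrier B" using assms(2,3) by (auto simp: generates_def)
  fix H assume H: "is_addsub B H" "\<forall>x\<in>H. \<forall>y\<in>H. rmul B x y \<in> H" "f ` X \<subseteq> H"
  have "rcarrier A \<subseteq> {x \<in> rcarrier A. f x \<in> H}"
    by (rule generates_least[OF assms(3) is_addsub_vimage[OF H(1)]])
      (use assms(3) H(2,3) in \<open>auto simp: generates_def map_mul\<close>)
  then show "rcarrier B \<subseteq> H" by (auto simp flip: assms(2))
qed

lemma rhom_eq_on_generators: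
  assumes "generates A X" "rhom A B f" "rhom A B g" "\<And>x. x \<in> X \<Longrightarrow> f x = g x" "x \<in> rcarrier A"
  shows "f x = g x"
proof -
  interpret f: rhom A B f by fact
  interpret g: rhom A B g by fact
  have "rcarrier A \<subseteq> {x \<in> rcarrier A. f x = g x}"
    by (rule generates_least[OF assms(1) is_addsub_equalizer[OF f.addhom_axioms g.addhom_axioms]])
      (use assms(1,4) in \<open>auto simp: generates_def f.map_mul g.map_mul\<close>)
  then show ?thesis using assms(5) by auto
qed

subsection \<open>Sums and products\<close>

definition rsum_mul :: "'a rng \<Rightarrow> ('a \<times> 'a) list \<Rightarrow> 'a" where
  "rsum_mul A l = rsum A (map (\<lambda>(x, y). rmul A x y) l)"

lemma rsum_simps [simp]: "rsum A [] = rzero A" "rsum A (x # xs) = radd A x (rsum A xs)"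
  by (simp_all add: rsum_def)

lemma rsum_mul_simps [simp]:
  "rsum_mul A [] = rzero A" "rsum_mul A ((x, y) # l) = radd A (rmul A x y) (rsum_mul A l)"
  by (simp_all add: rsum_mul_def)

context nuring
begin

lemma addsub_gen_mulI:
  assumes "x \<in> addsub_gen A X" "y \<in> addsub_gen A Y" and X: "X \<subseteq> rcarrier A" and Y: "Y \<subseteq> rcarrier A"
    and H: "is_addsub A H" and mul: "\<And>x y. x \<in> X \<Longrightarrow> y \<in> Y \<Longrightarrow> x \<boxdot> y \<in> H"
  shows "x \<boxdot> y \<in> H"
proof (rule addhom.addsub_gen_mapI[OF addhom_mul_right assms(1) X H])
  show y: "y \<in> rcarrier A" using assms(2) addsub_gen_carrier[OF Y] by auto
  fix x assume x: "x \<in> X"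
  show "x \<boxdot> y \<in> H"
    by (rule addhom.addsub_gen_mapI[OF addhom_mul_left assms(2) Y H]) (use x X mul in auto)
qed

lemma rsum_mul_closed: "set l \<subseteq> rcarrier A \<times> rcarrier A \<Longrightarrow> rsum_mul A l \<in> rcarrier A"
  by (induction l) auto

lemma rsum_mul_append:
  "set l \<subseteq> rcarrier A \<times> rcarrier A \<Longrightarrow> set l' \<subseteq> rcarrier A \<times> rcarrier A \<Longrightarrow>
     rsum_mul A (l @ l') = rsum_mul A l \<boxplus> rsum_mul A l'"
  by (induction l) (auto simp: add_assoc rsum_mul_closed)

lemma is_addsub_prod_set: "X \<subseteq> rcarrier A \<Longrightarrow> Y \<subseteq> rcarrier A \<Longrightarrow> is_addsub A (prod_set A X Y)"
  unfolding prod_set_def by (intro is_addsub_addsub_gen) auto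

lemma prod_setI: "x \<in> X \<Longrightarrow> y \<in> Y \<Longrightarrow> x \<boxdot> y \<in> prod_set A X Y"
  unfolding prod_set_def by (rule subsetD[OF subset_addsub_gen]) auto

lemma prod_set_least:
  "is_addsub A H \<Longrightarrow> (\<And>x y. x \<in> X \<Longrightarrow> y \<in> Y \<Longrightarrow> x \<boxdot> y \<in> H) \<Longrightarrow> prod_set A X Y \<subseteq> H"
  unfolding prod_set_def by (intro addsub_gen_least) auto

lemma addhom_eq_on_prod_set:
  assumes "z \<in> prod_set A X Y" "X \<subseteq> rcarrier A" "Y \<subseteq> rcarrier A" "addhom A B f" "addhom A B g"
    "\<And>x y. x \<in> X \<Longrightarrow> y \<in> Y \<Longrightarrow> f (x \<boxdot> y) = g (x \<boxdot> y)"
  shows "f z = g z"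
  using assms(1) unfolding prod_set_def
  by (rule addhom_eq_on_addsub_gen[OF _ _ assms(4,5)]) (use assms(2,3,6) in auto)

lemma prod_set_mapI:
  assumes "z \<in> prod_set A X Y" "X \<subseteq> rcarrier A" "Y \<subseteq> rcarrier A" "addhom A B f" "is_addsub B H"
    "\<And>x y. x \<in> X \<Longrightarrow> y \<in> Y \<Longrightarrow> f (x \<boxdot> y) \<in> H"
  shows "f z \<in> H"
  using assms(1) unfolding prod_set_def
  by (rule addhom.addsub_gen_mapI[OF assms(4) _ _ assms(5)]) (use assms(2,3,6) in auto)

lemma left_identity_on_prod_set:
  assumes "\<And>x. x \<in> X \<Longrightarrow> e \<boxdot> x = x" "e \<in> rcarrier A" "X \<subseteq> rcarrier A" "Y \<subseteq> rcarrier A" "z \<in> prod_set A X Y"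
  shows "e \<boxdot> z = z"
  by (rule addhom_eq_on_prod_set[OF assms(5,3,4) addhom_mul_left[OF assms(2)] addhom_id])
    (use assms(1-4) in \<open>simp add: subset_iff flip: mul_assoc\<close>)

lemma right_identity_on_prod_set:
  assumes "\<And>y. y \<in> Y \<Longrightarrow> y \<boxdot> e = y" "e \<in> rcarrier A" "X \<subseteq> rcarrier A" "Y \<subseteq> rcarrier A" "z \<in> prod_set A X Y"
  shows "z \<boxdot> e = z"
  by (rule addhom_eq_on_prod_set[OF assms(5,3,4) addhom_mul_right[OF assms(2)] addhom_id])
    (use assms(1-4) in \<open>simp add: subset_iff mul_assoc\<close>)

lemma neg_rsum_mul:
  "set l \<subseteq> rcarrier A \<times> rcarrier A \<Longrightarrow> \<boxminus> (rsum_mul A l) = rsum_mul A (map (map_prod (rneg A) id) l)"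
  by (induction l) (auto simp: neg_add_distrib neg_mul rsum_mul_closed)

lemma prod_set_obtain_list:
  assumes X: "is_addsub A X" and Y: "Y \<subseteq> rcarrier A" and z: "z \<in> prod_set A X Y"
  obtains l where "set l \<subseteq> X \<times> Y" "z = rsum_mul A l"
proof -
  let ?H = "rsum_mul A ` lists (X \<times> Y)"
  note X_closed = is_addsubD[OF X]
  have carrier: "set l \<subseteq> rcarrier A \<times> rcarrier A" if "l \<in> lists (X \<times> Y)" for l
    using that X_closed(1) Y by fastforce
  have "is_addsub A ?H" unfolding is_addsub_def
  proof (intro conjI ballI)
    show "?H \<subseteq> rcarrier A" using rsum_mul_closed carrier by blast
    show "rzero A \<in> ?H" by (rule image_eqI[of _ _ "[]"]) auto
    fix x assume "x \<in> ?H"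
    then obtain l where l: "l \<in> lists (X \<times> Y)" "x = rsum_mul A l" by auto
    have "map (map_prod (rneg A) id) l \<in> lists (X \<times> Y)" using l(1) X_closed(4) by fastforce
    then show "\<boxminus> x \<in> ?H" unfolding l(2) neg_rsum_mul[OF carrier[OF l(1)]] by (rule imageI)
    fix y assume "y \<in> ?H"
    then obtain l' where l': "l' \<in> lists (X \<times> Y)" "y = rsum_mul A l'" by auto
    have "l @ l' \<in> lists (X \<times> Y)" using l l' by simp
    then show "x \<boxplus> y \<in> ?H"
      unfolding l(2) l'(2) rsum_mul_append[OF carrier[OF l(1)] carrier[OF l'(1)], symmetric]
      by (rule imageI)
  qed
  moreover have "x \<boxdot> y \<in> ?H" if "x \<in> X" "y \<in> Y" for x y
    using that X_closed(1) Y by (intro image_eqI[of _ _ "[(x, y)]"]) auto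
  ultimately have "prod_set A X Y \<subseteq> ?H" by (rule prod_set_least)
  then obtain l where "l \<in> lists (X \<times> Y)" "z = rsum_mul A l" using z by auto
  then show thesis using that[of l] by auto
qed

lemma rsum_mul_in_prod_set:
  assumes "X \<subseteq> rcarrier A" "Y \<subseteq> rcarrier A" "set l \<subseteq> X \<times> Y"
  shows "rsum_mul A l \<in> prod_set A X Y"
  using assms(3)
proof (induction l)
  case (Cons xy l)
  then show ?case
    using is_addsubD(3)[OF is_addsub_prod_set[OF assms(1,2)]] by (cases xy) (simp add: prod_setI)
qed (simp add: is_addsubD(2)[OF is_addsub_prod_set[OF assms(1,2)]])

lemma prod_set_mono:
  assumes "X \<subseteq> X'" "Y \<subseteq> Y'" "X' \<subseteq> rcarrier A" "Y' \<subseteq> rcarrier A"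
  shows "prod_set A X Y \<subseteq> prod_set A X' Y'"
  by (rule prod_set_least) (use assms in \<open>auto intro: is_addsub_prod_set prod_setI\<close>)

lemma rprod_closed: "xs \<noteq> [] \<Longrightarrow> set xs \<subseteq> rcarrier A \<Longrightarrow> rprod A xs \<in> rcarrier A"
  by (induction xs rule: induct_list012) auto

lemma rprod_Cons: "xs \<noteq> [] \<Longrightarrow> rprod A (x # xs) = x \<boxdot> rprod A xs"
  by (cases xs) auto

lemma rprod_append:
  "xs \<noteq> [] \<Longrightarrow> ys \<noteq> [] \<Longrightarrow> set xs \<subseteq> rcarrier A \<Longrightarrow> set ys \<subseteq> rcarrier A \<Longrightarrow>
     rprod A (xs @ ys) = rprod A xs \<boxdot> rprod A ys"
proof (induction xs)
  case (Cons x xs)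
  then show ?case
    by (cases "xs = []") (simp_all add: rprod_Cons mul_assoc rprod_closed)
qed simp

end

lemma (in rhom) map_rsum_mul:
  "set l \<subseteq> rcarrier A \<times> rcarrier A \<Longrightarrow> f (rsum_mul A l) = rsum_mul B (map (map_prod f f) l)"
  by (induction l) (auto simp: map_zero map_add map_mul A.rsum_mul_closed)

lemma (in rhom) prod_set_image:
  assumes "X \<subseteq> rcarrier A" "Y \<subseteq> rcarrier A"
  shows "f ` prod_set A X Y = prod_set B (f ` X) (f ` Y)"
proof -
  let ?S = "{rmul A x y | x y. x \<in> X \<and> y \<in> Y}"
  have "f ` ?S = {f (rmul A x y) | x y. x \<in> X \<and> y \<in> Y}" by auto
  also have "\<dots> = {rmul B (f x) (f y) | x y. x \<in> X \<and> y \<in> Y}"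
    using assms map_mul by (metis (no_types, lifting) subsetD)
  also have "\<dots> = {rmul B x y | x y. x \<in> f ` X \<and> y \<in> f ` Y}" by auto
  finally have "f ` ?S = {rmul B x y | x y. x \<in> f ` X \<and> y \<in> f ` Y}" .
  moreover have "?S \<subseteq> rcarrier A" using assms by auto
  ultimately show ?thesis unfolding prod_set_def by (simp add: addsub_gen_image)
qed

lemma (in rhom) unital_ideal_image:
  assumes "I \<subseteq> rcarrier A" "unital_ideal A I"
  shows "unital_ideal B (f ` I)"
proof -
  obtain e where "e \<in> I" "\<And>x. x \<in> I \<Longrightarrow> rmul A e x = x \<and> rmul A x e = x"
    using assms(2) by (auto simp: unital_ideal_def)
  moreover from this have "rmul B (f e) (f x) = f x \<and> rmul B (f x) (f e) = f x" if "x \<in> I" for x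
    using that subsetD[OF assms(1)] by (simp flip: map_mul)
  ultimately show ?thesis unfolding unital_ideal_def by auto
qed

subsection \<open>The opposite ring\<close>

definition opposite :: "'a rng \<Rightarrow> 'a rng" where
  "opposite A = A\<lparr>rmul := \<lambda>x y. rmul A y x\<rparr>"

lemma opposite_simps [simp]:
  "rcarrier (opposite A) = rcarrier A" "radd (opposite A) = radd A" "rzero (opposite A) = rzero A"
  "rneg (opposite A) = rneg A" "rmul (opposite A) x y = rmul A y x"
  by (simp_all add: opposite_def)

lemma is_addsub_opposite [simp]: "is_addsub (opposite A) = is_addsub A"
  by (simp add: fun_eq_iff is_addsub_def)

lemma prod_set_opposite [simp]: "prod_set (opposite A) X Y = prod_set A Y X"
proof -
  have "{rmul A y x | x y. x \<in> X \<and> y \<in> Y} = {rmul A y x | y x. y \<in> Y \<and> x \<in> X}" by auto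
  then show ?thesis by (simp add: prod_set_def addsub_gen_eq_Inter)
qed

lemma (in nuring) nuring_opposite: "nuring (opposite A)"
  by (simp add: nuring_def nu_ring_def add_ac mul_assoc distrib_left distrib_right)

subsection \<open>Quotients\<close>

lemma ideal_gen_least: "is_ideal A I \<Longrightarrow> S \<subseteq> I \<Longrightarrow> ideal_gen A S \<subseteq> I"
  unfolding ideal_gen_def by auto

lemma subset_ideal_gen: "S \<subseteq> ideal_gen A S"
  unfolding ideal_gen_def by auto

lemma (in nuring) is_ideal_ideal_gen:
  assumes "S \<subseteq> rcarrier A"
  shows "is_ideal A (ideal_gen A S)"
proof -
  have "is_ideal A (rcarrier A)" by (auto simp: is_ideal_def)
  then have "ideal_gen A S \<subseteq> rcarrier A" using assms by (rule ideal_gen_least)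
  then show ?thesis unfolding is_ideal_def by (auto simp: ideal_gen_def is_ideal_def)
qed

lemma (in rhom) is_ideal_kernel: "is_ideal A {x \<in> rcarrier A. f x = rzero B}"
  by (auto simp: is_ideal_def map_zero map_add map_mul map_neg map_closed)

locale ring_ideal = nuring A
  for A :: "'a rng" (structure) +
  fixes I :: "'a set"
  assumes ideal: "is_ideal A I"
begin

lemma ideal_closed:
  "i \<in> I \<Longrightarrow> i \<in> rcarrier A" "i \<in> I \<Longrightarrow> j \<in> I \<Longrightarrow> i \<boxplus> j \<in> I" "i \<in> I \<Longrightarrow> \<boxminus> i \<in> I"
  "i \<in> I \<Longrightarrow> a \<in> rcarrier A \<Longrightarrow> a \<boxdot> i \<in> I" "i \<in> I \<Longrightarrow> a \<in> rcarrier A \<Longrightarrow> i \<boxdot> a \<in> I"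
  using ideal by (auto simp: is_ideal_def)

lemma coset_self: "a \<in> rcarrier A \<Longrightarrow> a \<in> coset A I a"
  using ideal by (auto simp: coset_def is_ideal_def intro!: exI[of _ "rzero A"])

lemma coset_add_ideal:
  assumes "a \<in> rcarrier A" "i \<in> I"
  shows "coset A I (a \<boxplus> i) = coset A I a"
proof (intro equalityI subsetI)
  fix x assume "x \<in> coset A I (a \<boxplus> i)"
  then obtain j where "j \<in> I" "x = a \<boxplus> i \<boxplus> j" by (auto simp: coset_def)
  then have "i \<boxplus> j \<in> I" "x = a \<boxplus> (i \<boxplus> j)" using assms ideal_closed by (auto simp: add_assoc)
  then show "x \<in> coset A I a" by (auto simp: coset_def)
next
  fix x assume "x \<in> coset A I a"
  then obtain j where "j \<in> I" "x = a \<boxplus> j" by (auto simp: coset_def)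
  then have "\<boxminus> i \<boxplus> j \<in> I" "x = a \<boxplus> i \<boxplus> (\<boxminus> i \<boxplus> j)" using assms ideal_closed by (auto simp: add_assoc)
  then show "x \<in> coset A I (a \<boxplus> i)" by (auto simp: coset_def)
qed

lemma coset_eq_iff:
  assumes "a \<in> rcarrier A" "b \<in> rcarrier A"
  shows "coset A I a = coset A I b \<longleftrightarrow> a \<boxplus> \<boxminus> b \<in> I"
proof
  assume "coset A I a = coset A I b"
  then obtain i where "i \<in> I" "a = b \<boxplus> i" using coset_self[OF assms(1)] by (auto simp: coset_def)
  moreover from this have "a \<boxplus> \<boxminus> b = i" using assms by (simp add: diff_eq_iff ideal_closed)
  ultimately show "a \<boxplus> \<boxminus> b \<in> I" by simp
next
  assume "a \<boxplus> \<boxminus> b \<in> I"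
  then show "coset A I a = coset A I b" using coset_add_ideal[of b "a \<boxplus> \<boxminus> b"] assms by simp
qed

lemma some_in_coset:
  assumes "a \<in> rcarrier A"
  obtains i where "i \<in> I" "(SOME x. x \<in> coset A I a) = a \<boxplus> i"
  using someI[of "\<lambda>x. x \<in> coset A I a", OF coset_self[OF assms]] by (auto simp: coset_def)

lemma quot_rng_coset:
  assumes a: "a \<in> rcarrier A" and b: "b \<in> rcarrier A"
  shows "radd (quot_rng A I) (coset A I a) (coset A I b) = coset A I (a \<boxplus> b)"
    and "rmul (quot_rng A I) (coset A I a) (coset A I b) = coset A I (a \<boxdot> b)"
    and "rneg (quot_rng A I) (coset A I a) = coset A I (\<boxminus> a)"
proof -
  obtain i where i: "i \<in> I" "(SOME x. x \<in> coset A I a) = a \<boxplus> i" using some_in_coset[OF a] .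
  obtain j where j: "j \<in> I" "(SOME x. x \<in> coset A I b) = b \<boxplus> j" using some_in_coset[OF b] .
  note ij = ideal_closed(1)[OF i(1)] ideal_closed(1)[OF j(1)]
  have "a \<boxplus> i \<boxplus> (b \<boxplus> j) = a \<boxplus> b \<boxplus> (i \<boxplus> j)" using a b ij by (simp add: add_ac)
  then show "radd (quot_rng A I) (coset A I a) (coset A I b) = coset A I (a \<boxplus> b)"
    using a b i j by (simp add: quot_rng_def coset_add_ideal ideal_closed(2))
  have "\<boxminus> (a \<boxplus> i) = \<boxminus> a \<boxplus> \<boxminus> i" using a ij by (simp add: neg_add_distrib)
  then show "rneg (quot_rng A I) (coset A I a) = coset A I (\<boxminus> a)"
    using a i by (simp add: quot_rng_def coset_add_ideal ideal_closed(3))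
  have "(a \<boxplus> i) \<boxdot> (b \<boxplus> j) = a \<boxdot> b \<boxplus> (a \<boxdot> j \<boxplus> i \<boxdot> (b \<boxplus> j))"
    using a b ij by (simp add: distrib_left distrib_right add_ac)
  moreover have "a \<boxdot> j \<boxplus> i \<boxdot> (b \<boxplus> j) \<in> I" using a b i(1) j(1) ij by (simp add: ideal_closed)
  ultimately show "rmul (quot_rng A I) (coset A I a) (coset A I b) = coset A I (a \<boxdot> b)"
    using a b i(2) j(2) by (simp add: quot_rng_def coset_add_ideal)
qed

lemma quot_rng_carrier [simp]: "rcarrier (quot_rng A I) = coset A I ` rcarrier A"
  and quot_rng_zero [simp]: "rzero (quot_rng A I) = coset A I (rzero A)"
  by (simp_all add: quot_rng_def)

lemma nuring_quot_rng: "nuring (quot_rng A I)"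
  by (simp add: nuring_def nu_ring_def quot_rng_coset add_ac mul_assoc distrib_left distrib_right)

lemma rhom_coset: "rhom A (quot_rng A I) (coset A I)"
proof -
  interpret quot: nuring "quot_rng A I" by (rule nuring_quot_rng)
  show ?thesis by unfold_locales (simp_all add: quot_rng_coset)
qed

lemma quot_rng_universal:
  assumes "rhom A B f" and kernel: "\<And>i. i \<in> I \<Longrightarrow> f i = rzero B"
  obtains h where "rhom (quot_rng A I) B h" "\<And>a. a \<in> rcarrier A \<Longrightarrow> h (coset A I a) = f a"
proof -
  interpret f: rhom A B f by fact
  interpret quot: nuring "quot_rng A I" by (rule nuring_quot_rng)
  define h where "h X = f (SOME x. x \<in> X)" for X
  have h: "h (coset A I a) = f a" if a: "a \<in> rcarrier A" for a
  proof -
    obtain i where "i \<in> I" "(SOME x. x \<in> coset A I a) = a \<boxplus> i" using some_in_coset[OF a] .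
    then show ?thesis using a by (simp add: h_def f.map_add ideal_closed(1) kernel f.map_closed)
  qed
  have "rhom (quot_rng A I) B h"
    by unfold_locales (auto simp: h quot_rng_coset f.map_closed f.map_add f.map_mul)
  with h show thesis using that by blast
qed

end

lemma (in nuring) ring_ideal_ideal_gen: "S \<subseteq> rcarrier A \<Longrightarrow> ring_ideal A (ideal_gen A S)"
  by unfold_locales (rule is_ideal_ideal_gen)

lemma (in rhom) quot_ideal_gen_universal:
  assumes "S \<subseteq> rcarrier A" "\<And>s. s \<in> S \<Longrightarrow> f s = rzero B"
  obtains h where "rhom (quot_rng A (ideal_gen A S)) B h"
    "\<And>a. a \<in> rcarrier A \<Longrightarrow> h (coset A (ideal_gen A S) a) = f a"
proof -
  interpret I: ring_ideal A "ideal_gen A S" by (rule A.ring_ideal_ideal_gen[OF assms(1)])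
  have "ideal_gen A S \<subseteq> {x \<in> rcarrier A. f x = rzero B}"
    using assms by (intro ideal_gen_least is_ideal_kernel) auto
  then show thesis using I.quot_rng_universal[OF rhom_axioms] that by blast
qed

section \<open>The free ring\<close>

definition fr_word :: "'g list \<Rightarrow> 'g list \<Rightarrow> int" where
  "fr_word u = (\<lambda>w. if w = u then 1 else 0)"

lemma fr_gen_eq_fr_word: "fr_gen x = fr_word [x]"
  by (simp add: fr_gen_def fr_word_def)

lemma free_rng_simps:
  "rcarrier (free_rng G) = {f. finite {w. f w \<noteq> 0} \<and> (\<forall>w. f w \<noteq> 0 \<longrightarrow> w \<noteq> [] \<and> set w \<subseteq> G)}"
  "radd (free_rng G) = (\<lambda>f g w. f w + g w)"
  "rmul (free_rng G) = (\<lambda>f g w. \<Sum>i\<le>length w. f (take i w) * g (drop i w))"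
  "rzero (free_rng G) = (\<lambda>w. 0)"
  "rneg (free_rng G) = (\<lambda>f w. - f w)"
  by (simp_all add: free_rng_def)

lemma fr_word_closed: "w \<noteq> [] \<Longrightarrow> set w \<subseteq> G \<Longrightarrow> fr_word w \<in> rcarrier (free_rng G)"
  by (auto simp: free_rng_simps fr_word_def)

lemma fr_gen_closed: "x \<in> G \<Longrightarrow> fr_gen x \<in> rcarrier (free_rng G)"
  by (simp add: fr_gen_eq_fr_word fr_word_closed)

lemma fr_word_mul: "rmul (free_rng G) (fr_word u) (fr_word v) = fr_word (u @ v)"
proof
  fix w
  have "fr_word u (take i w) * fr_word v (drop i w) = (if i = length u \<and> w = u @ v then 1 else 0)"
    if "i \<le> length w" for i
  proof -
    have "take i w = u \<and> drop i w = v \<longleftrightarrow> i = length u \<and> w = u @ v"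
      using that by (metis append_eq_conv_conj append_take_drop_id length_take min.absorb2)
    then show ?thesis by (auto simp: fr_word_def)
  qed
  then have "rmul (free_rng G) (fr_word u) (fr_word v) w
      = (\<Sum>i\<le>length w. if i = length u \<and> w = u @ v then 1 else 0)"
    by (simp add: free_rng_simps)
  also have "\<dots> = fr_word (u @ v) w"
    by (cases "w = u @ v") (auto simp: fr_word_def)
  finally show "rmul (free_rng G) (fr_word u) (fr_word v) w = fr_word (u @ v) w" .
qed

lemma free_add_closed:
  assumes "f \<in> rcarrier (free_rng G)" "g \<in> rcarrier (free_rng G)"
  shows "radd (free_rng G) f g \<in> rcarrier (free_rng G)"
proof -
  have "finite ({w. f w \<noteq> 0} \<union> {w. g w \<noteq> 0})" using assms by (auto simp: free_rng_simps)
  then have "finite {w. f w + g w \<noteq> 0}" by (rule rev_finite_subset) auto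
  moreover have "w \<noteq> [] \<and> set w \<subseteq> G" if "f w + g w \<noteq> 0" for w
    using that assms by (cases "f w = 0") (auto simp: free_rng_simps)
  ultimately show ?thesis unfolding free_rng_simps by blast
qed

lemma free_mul_closed:
  assumes "f \<in> rcarrier (free_rng G)" "g \<in> rcarrier (free_rng G)"
  shows "rmul (free_rng G) f g \<in> rcarrier (free_rng G)"
proof -
  let ?h = "rmul (free_rng G) f g"
  have support: "\<exists>u v. w = u @ v \<and> f u \<noteq> 0 \<and> g v \<noteq> 0" if "?h w \<noteq> 0" for w
  proof -
    have "\<exists>i. f (take i w) * g (drop i w) \<noteq> 0"
      using that by (rule contrapos_np) (auto simp: free_rng_simps intro!: sum.neutral)
    then show ?thesis by (metis append_take_drop_id mult_eq_0_iff)
  qed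
  then have "{w. ?h w \<noteq> 0} \<subseteq> (\<lambda>(u, v). u @ v) ` ({u. f u \<noteq> 0} \<times> {v. g v \<noteq> 0})" by fastforce
  moreover have "finite ((\<lambda>(u, v). u @ v) ` ({u. f u \<noteq> 0} \<times> {v. g v \<noteq> 0}))"
    using assms by (auto simp: free_rng_simps)
  ultimately have "finite {w. ?h w \<noteq> 0}" by (rule finite_subset)
  moreover have "w \<noteq> [] \<and> set w \<subseteq> G" if h: "?h w \<noteq> 0" for w
  proof -
    obtain u v where "w = u @ v" "f u \<noteq> 0" "g v \<noteq> 0" using support[OF h] by auto
    then show ?thesis using assms by (auto simp: free_rng_simps)
  qed
  ultimately show ?thesis unfolding free_rng_simps(1) by blast
qed

lemma free_mul_assoc:
  "rmul (free_rng G) (rmul (free_rng G) f g) h = rmul (free_rng G) f (rmul (free_rng G) g h)"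
proof
  fix w :: "'a list"
  let ?n = "length w"
  have "rmul (free_rng G) (rmul (free_rng G) f g) h w
    = (\<Sum>i\<le>?n. \<Sum>j\<le>i. f (take j w) * g (drop j (take i w)) * h (drop i w))"
    by (auto simp: free_rng_simps sum_distrib_right min_def intro!: sum.cong)
  also have "\<dots> = (\<Sum>(i,j)\<in>(SIGMA i:{..?n}. {..i}). f (take j w) * g (drop j (take i w)) * h (drop i w))"
    by (subst sum.Sigma) auto
  also have "\<dots> = (\<Sum>(j,k)\<in>(SIGMA j:{..?n}. {..?n - j}).
      f (take j w) * (g (take k (drop j w)) * h (drop (k + j) w)))"
    by (rule sum.reindex_bij_witness[of _ "\<lambda>(j,k). (k + j, j)" "\<lambda>(i,j). (j, i - j)"])
      (auto simp: drop_take mult.assoc)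
  also have "\<dots> = rmul (free_rng G) f (rmul (free_rng G) g h) w"
    by (subst sum.Sigma[symmetric]) (auto simp: free_rng_simps sum_distrib_left intro!: sum.cong)
  finally show "rmul (free_rng G) (rmul (free_rng G) f g) h w =
      rmul (free_rng G) f (rmul (free_rng G) g h) w" .
qed

lemma nuring_free_rng: "nuring (free_rng G)"
  unfolding nuring_def nu_ring_def
proof (intro conjI ballI)
  show "rzero (free_rng G) \<in> rcarrier (free_rng G)" by (simp add: free_rng_simps)
  show "rneg (free_rng G) x \<in> rcarrier (free_rng G)" if "x \<in> rcarrier (free_rng G)" for x
    using that by (auto simp: free_rng_simps)
qed (auto simp: free_mul_closed free_add_closed free_mul_assoc,
     auto simp: free_rng_simps algebra_simps sum.distrib)

lemma free_scale_in_addsub: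
  assumes H: "is_addsub (free_rng G) H" and f: "f \<in> H"
  shows "(\<lambda>w. c * f w) \<in> H"
proof -
  note H = is_addsubD[OF H, unfolded free_rng_simps]
  have nat: "(\<lambda>w. int n * f w) \<in> H" for n
  proof (induction n)
    case (Suc n)
    then show ?case using H(3)[OF Suc f] by (simp add: algebra_simps)
  qed (use H(2) in simp)
  show ?thesis
  proof (cases c rule: int_cases2)
    case (nonneg n)
    then show ?thesis using nat by simp
  next
    case (nonpos n)
    then show ?thesis using H(4)[OF nat, of n] by simp
  qed
qed

lemma free_rng_eq_span:
  "rcarrier (free_rng G) = addsub_gen (free_rng G) {fr_word w | w. w \<noteq> [] \<and> set w \<subseteq> G}"
  (is "_ = addsub_gen ?F ?S")
proof
  interpret F: nuring ?F by (rule nuring_free_rng)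
  have S: "?S \<subseteq> rcarrier ?F" using fr_word_closed by auto
  show "addsub_gen ?F ?S \<subseteq> rcarrier ?F" by (rule F.addsub_gen_carrier[OF S])
  note span = F.is_addsub_addsub_gen[OF S]
  have "f \<in> addsub_gen ?F ?S" if "finite W" "f \<in> rcarrier ?F" "{w. f w \<noteq> 0} = W" for f W
    using that
  proof (induction W arbitrary: f rule: finite_induct)
    case empty
    then have "f = rzero ?F" by (auto simp: free_rng_simps)
    then show ?case using is_addsubD(2)[OF span] by simp
  next
    case (insert w W)
    let ?g = "f(w := 0)"
    have "{v. ?g v \<noteq> 0} = W" using insert.prems(2) insert.hyps(2) by auto
    moreover from this have "?g \<in> rcarrier ?F"
      using insert.prems(1) insert.hyps(1) by (auto simp: free_rng_simps split: if_splits)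
    ultimately have "?g \<in> addsub_gen ?F ?S" using insert.IH by blast
    moreover have "fr_word w \<in> addsub_gen ?F ?S"
      using insert.prems by (intro subsetD[OF subset_addsub_gen]) (auto simp: free_rng_simps)
    ultimately have "radd ?F ?g (\<lambda>v. f w * fr_word w v) \<in> addsub_gen ?F ?S"
      by (intro is_addsubD(3)[OF span] free_scale_in_addsub[OF span])
    moreover have "radd ?F ?g (\<lambda>v. f w * fr_word w v) = f" by (auto simp: free_rng_simps fr_word_def)
    ultimately show ?case by simp
  qed
  then show "rcarrier ?F \<subseteq> addsub_gen ?F ?S" by (auto simp: free_rng_simps(1))
qed

definition additive_group :: "'a rng \<Rightarrow> 'a monoid" where
  "additive_group A = \<lparr>carrier = rcarrier A, monoid.mult = radd A, one = rzero A\<rparr>"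

lemma (in nuring) comm_group_additive_group: "comm_group (additive_group A)"
  by (rule comm_groupI) (auto simp: additive_group_def add_ac, use add_neg neg_closed in blast)

lemma free_additive_extension:
  assumes B: "nuring B" and E: "\<And>w. w \<noteq> [] \<Longrightarrow> set w \<subseteq> G \<Longrightarrow> E w \<in> rcarrier B"
  obtains \<phi> where "addhom (free_rng G) B \<phi>" "\<And>w. w \<noteq> [] \<Longrightarrow> set w \<subseteq> G \<Longrightarrow> \<phi> (fr_word w) = E w"
proof -
  interpret F: nuring "free_rng G" by (rule nuring_free_rng)
  interpret B: nuring B by fact
  let ?M = "additive_group B"
  interpret M: comm_group ?M by (rule B.comm_group_additive_group)
  let ?term = "\<lambda>f w. E w [^]\<^bsub>?M\<^esub> (f w :: int)"
  define \<phi> where "\<phi> f = finprod ?M (?term f) {w. f w \<noteq> 0}" for f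
  have E_closed: "E w \<in> carrier ?M" if "w \<noteq> []" "set w \<subseteq> G" for w
    using E that by (simp add: additive_group_def)
  have \<phi>_eq: "\<phi> f = finprod ?M (?term f) W"
    if "finite W" "{w. f w \<noteq> 0} \<subseteq> W" "W \<subseteq> {w. w \<noteq> [] \<and> set w \<subseteq> G}" for f W
    unfolding \<phi>_def using that E_closed
    by (intro M.finprod_mono_neutral_cong_left) (auto intro!: M.int_pow_closed)
  have "addhom (free_rng G) B \<phi>"
  proof unfold_locales
    fix f assume f: "f \<in> rcarrier (free_rng G)"
    have "\<phi> f \<in> carrier ?M" unfolding \<phi>_def
      by (rule M.finprod_closed) (use f E_closed in \<open>auto simp: free_rng_simps intro!: M.int_pow_closed\<close>)
    then show "\<phi> f \<in> rcarrier B" by (simp add: additive_group_def)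
    fix g assume g: "g \<in> rcarrier (free_rng G)"
    let ?W = "{w. f w \<noteq> 0} \<union> {w. g w \<noteq> 0}"
    have W: "finite ?W" "?W \<subseteq> {w. w \<noteq> [] \<and> set w \<subseteq> G}" using f g by (auto simp: free_rng_simps)
    have "\<phi> (radd (free_rng G) f g) = finprod ?M (\<lambda>w. ?term f w \<otimes>\<^bsub>?M\<^esub> ?term g w) ?W"
      using W E_closed by (subst \<phi>_eq[of ?W])
        (auto simp: free_rng_simps subset_iff M.int_pow_mult
          intro!: M.finprod_cong' M.m_closed M.int_pow_closed)
    also have "\<dots> = \<phi> f \<otimes>\<^bsub>?M\<^esub> \<phi> g"
      using W E_closed
      by (subst (1 2) \<phi>_eq[of ?W]) (auto simp: subset_iff intro!: M.finprod_multf M.int_pow_closed)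
    finally show "\<phi> (radd (free_rng G) f g) = radd B (\<phi> f) (\<phi> g)" by (simp add: additive_group_def)
  qed
  moreover have "\<phi> (fr_word w) = E w" if "w \<noteq> []" "set w \<subseteq> G" for w
  proof -
    have "{v. fr_word w v \<noteq> 0} = {w}" by (auto simp: fr_word_def)
    then show ?thesis using E_closed[OF that] by (simp add: \<phi>_def fr_word_def)
  qed
  ultimately show thesis using that by blast
qed

lemma free_rng_universal:
  assumes B: "nuring B" and e: "\<And>x. x \<in> G \<Longrightarrow> e x \<in> rcarrier B"
  obtains \<phi> where "rhom (free_rng G) B \<phi>" "\<And>x. x \<in> G \<Longrightarrow> \<phi> (fr_gen x) = e x"
proof -
  interpret B: nuring B by fact
  let ?F = "free_rng G" and ?S = "{fr_word w | w. w \<noteq> [] \<and> set w \<subseteq> G}"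
  interpret F: nuring ?F by (rule nuring_free_rng)
  have S: "?S \<subseteq> rcarrier ?F" using fr_word_closed by auto
  have e_closed: "set (map e w) \<subseteq> rcarrier B" if "set w \<subseteq> G" for w using e that by auto
  then obtain \<phi> where \<phi>: "addhom ?F B \<phi>"
    "\<And>w. w \<noteq> [] \<Longrightarrow> set w \<subseteq> G \<Longrightarrow> \<phi> (fr_word w) = rprod B (map e w)"
    using free_additive_extension[OF B, of G "\<lambda>w. rprod B (map e w)"] B.rprod_closed
    by (metis map_is_Nil_conv)
  interpret \<phi>: addhom ?F B \<phi> by fact
  note linear = addhom_compose[OF F.addhom_mul_left \<phi>(1)] addhom_compose[OF F.addhom_mul_right \<phi>(1)]
    addhom_compose[OF \<phi>(1) B.addhom_mul_left] addhom_compose[OF \<phi>(1) B.addhom_mul_right]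
  have \<phi>_mul_word: "\<phi> (rmul ?F f g) = rmul B (\<phi> f) (\<phi> g)" if f: "f \<in> rcarrier ?F" and g: "g \<in> ?S" for f g
  proof (rule addhom_eq_on_addsub_gen[OF f[unfolded free_rng_eq_span] S])
    have "g \<in> rcarrier ?F" using g S by auto
    then show "addhom ?F B (\<lambda>f. \<phi> (rmul ?F f g))" "addhom ?F B (\<lambda>f. rmul B (\<phi> f) (\<phi> g))"
      by (auto intro: linear \<phi>.map_closed)
    fix f assume "f \<in> ?S"
    then show "\<phi> (rmul ?F f g) = rmul B (\<phi> f) (\<phi> g)"
      using g by (auto simp: fr_word_mul \<phi>(2) B.rprod_append e_closed[simplified])
  qed
  have "\<phi> (rmul ?F f g) = rmul B (\<phi> f) (\<phi> g)" if f: "f \<in> rcarrier ?F" and g: "g \<in> rcarrier ?F" for f g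
    by (rule addhom_eq_on_addsub_gen[OF g[unfolded free_rng_eq_span] S])
      (use f \<phi>_mul_word in \<open>auto intro: linear \<phi>.map_closed\<close>)
  then have "rhom ?F B \<phi>" by unfold_locales
  moreover have "\<phi> (fr_gen x) = e x" if "x \<in> G" for x
    using \<phi>(2)[of "[x]"] that by (simp add: fr_gen_eq_fr_word)
  ultimately show thesis using that by blast
qed

lemma generates_free_rng: "generates (free_rng G) (fr_gen ` G)"
  unfolding generates_def
proof (intro conjI allI impI)
  show "fr_gen ` G \<subseteq> rcarrier (free_rng G)" using fr_gen_closed by auto
  fix H assume H: "is_addsub (free_rng G) H" "\<forall>x\<in>H. \<forall>y\<in>H. rmul (free_rng G) x y \<in> H" "fr_gen ` G \<subseteq> H"
  have "fr_word w \<in> H" if "w \<noteq> []" "set w \<subseteq> G" for w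
    using that
  proof (induction w)
    case (Cons x w)
    have "fr_word [x] \<in> H" using H(3) Cons.prems by (auto simp: fr_gen_eq_fr_word)
    then show ?case
      using Cons H(2) fr_word_mul[of G "[x]" w] by (cases "w = []") (auto, metis)
  qed simp
  then show "rcarrier (free_rng G) \<subseteq> H"
    unfolding free_rng_eq_span using H(1) by (intro addsub_gen_least) auto
qed

section \<open>Graded rings\<close>

text \<open>The sum of the components is not required to be direct.\<close>

locale graded_rng = nuring A
  for A :: "'a rng" (structure) +
  fixes G :: "int \<Rightarrow> 'a set"
  assumes component_addsub: "is_addsub A (G i)"
    and component_mul: "x \<in> G i \<Longrightarrow> y \<in> G j \<Longrightarrow> x \<boxdot> y \<in> G (i + j)"

definition degree_zero :: "'a rng \<Rightarrow> (int \<Rightarrow> 'a set) \<Rightarrow> 'a rng" where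
  "degree_zero A G = A\<lparr>rcarrier := G 0\<rparr>"

lemma degree_zero_simps [simp]:
  "rcarrier (degree_zero A G) = G 0" "radd (degree_zero A G) = radd A" "rmul (degree_zero A G) = rmul A"
  "rzero (degree_zero A G) = rzero A" "rneg (degree_zero A G) = rneg A"
  by (simp_all add: degree_zero_def)

definition has_left_unit :: "'a rng \<Rightarrow> (int \<Rightarrow> 'a set) \<Rightarrow> int \<Rightarrow> bool" where
  "has_left_unit A G i \<longleftrightarrow> (\<exists>e\<in>prod_set A (G i) (G (- i)). \<forall>x\<in>G i. rmul A e x = x)"

definition has_right_unit :: "'a rng \<Rightarrow> (int \<Rightarrow> 'a set) \<Rightarrow> int \<Rightarrow> bool" where
  "has_right_unit A G i \<longleftrightarrow> (\<exists>e\<in>prod_set A (G i) (G (- i)). \<forall>x\<in>G (- i). rmul A x e = x)"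

lemma has_unit_opposite:
  "has_left_unit (opposite A) (\<lambda>i. G (- i)) i \<longleftrightarrow> has_right_unit A G i"
  "has_right_unit (opposite A) (\<lambda>i. G (- i)) i \<longleftrightarrow> has_left_unit A G i"
  by (simp_all add: has_left_unit_def has_right_unit_def)

lemma eps_strongly_graded_iff_units:
  "eps_strongly_graded A G \<longleftrightarrow> (\<forall>i. has_left_unit A G i \<and> has_right_unit A G i)"
proof -
  have "(\<forall>i. has_right_unit A G i) \<longleftrightarrow> (\<forall>i. has_right_unit A G (- i))" by (metis minus_minus)
  then show ?thesis
    unfolding eps_strongly_graded_def has_left_unit_def has_right_unit_def
    by (simp add: all_conj_distrib) blast
qed

lemma unital_ideal_opposite: "unital_ideal (opposite A) I \<longleftrightarrow> unital_ideal A I"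
  by (auto simp: unital_ideal_def)

context graded_rng
begin

lemma component_subset: "G i \<subseteq> rcarrier A"
  using component_addsub by (auto simp: is_addsub_def)

lemma component_closed: "x \<in> G i \<Longrightarrow> x \<in> rcarrier A"
  using component_subset by auto

lemma component_mulI: "x \<in> G i \<Longrightarrow> y \<in> G j \<Longrightarrow> k = i + j \<Longrightarrow> x \<boxdot> y \<in> G k"
  using component_mul by simp

lemma is_addsub_prod_set_component: "is_addsub A (prod_set A (G i) (G j))"
  by (intro is_addsub_prod_set component_subset)

lemma prod_set_closed: "x \<in> prod_set A (G i) (G j) \<Longrightarrow> x \<in> rcarrier A"
  by (rule is_addsubD(1)[OF is_addsub_prod_set_component])

lemma prod_set_component_subset: "prod_set A (G i) (G j) \<subseteq> G (i + j)"
  by (rule prod_set_least[OF component_addsub component_mul])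

lemma prod_set_degree_zero: "x \<in> prod_set A (G i) (G (- i)) \<Longrightarrow> x \<in> G 0"
  using prod_set_component_subset[of i "- i"] by auto

lemma graded_rng_opposite: "graded_rng (opposite A) (\<lambda>i. G (- i))"
proof -
  interpret op: nuring "opposite A" by (rule nuring_opposite)
  show ?thesis by unfold_locales (auto intro: component_addsub component_mulI)
qed

lemma nuring_degree_zero: "nuring (degree_zero A G)"
proof -
  note is_addsubD(2-4)[OF component_addsub[of 0]]
  moreover have "x \<boxdot> y \<in> G 0" if "x \<in> G 0" "y \<in> G 0" for x y using component_mul[OF that] by simp
  ultimately show ?thesis
    by (simp add: nuring_def nu_ring_def component_closed add_ac mul_assoc distrib_left distrib_right)
qed

lemma is_ideal_prod_set: "is_ideal (degree_zero A G) (prod_set A (G i) (G (- i)))"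
proof -
  let ?I = "prod_set A (G i) (G (- i))"
  have "a \<boxdot> z \<in> ?I" "z \<boxdot> a \<in> ?I" if z: "z \<in> ?I" and a: "a \<in> G 0" for z a
  proof -
    note linear = addhom_mul_left[OF component_closed[OF a]] addhom_mul_right[OF component_closed[OF a]]
    have "a \<boxdot> (x \<boxdot> y) \<in> ?I" "x \<boxdot> y \<boxdot> a \<in> ?I" if "x \<in> G i" "y \<in> G (- i)" for x y
      using that a prod_setI[of "a \<boxdot> x" "G i" y "G (- i)"] prod_setI[of x "G i" "y \<boxdot> a" "G (- i)"]
      by (simp_all add: component_mulI[of _ 0] component_mulI[of _ _ _ 0] component_closed mul_assoc)
    then show "a \<boxdot> z \<in> ?I" "z \<boxdot> a \<in> ?I"
      using prod_set_mapI[OF z component_subset component_subset linear(1) is_addsub_prod_set_component]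
        prod_set_mapI[OF z component_subset component_subset linear(2) is_addsub_prod_set_component]
      by auto
  qed
  then show ?thesis
    using is_addsubD[OF is_addsub_prod_set_component[of i "- i"]] prod_set_degree_zero
    by (auto simp: is_ideal_def)
qed

lemma is_addsub_left_action:
  assumes H: "is_addsub A H" and X: "X \<subseteq> rcarrier A"
  shows "is_addsub A {a \<in> rcarrier A. \<exists>c\<in>H. \<forall>x\<in>X. c \<boxdot> x = a \<boxdot> x}" (is "is_addsub A ?L")
  unfolding is_addsub_def
proof (intro conjI ballI)
  note H = is_addsubD[OF H]
  show "rzero A \<in> ?L" using H(2) by auto
  fix a assume "a \<in> ?L"
  then obtain c where c: "a \<in> rcarrier A" "c \<in> H" "\<forall>x\<in>X. c \<boxdot> x = a \<boxdot> x" by auto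
  then show "\<boxminus> a \<in> ?L"
    using H(1,4)[of c] subsetD[OF X] by (auto simp: neg_mul intro!: bexI[of _ "\<boxminus> c"])
  fix b assume "b \<in> ?L"
  then obtain d where "b \<in> rcarrier A" "d \<in> H" "\<forall>x\<in>X. d \<boxdot> x = b \<boxdot> x" by auto
  then show "a \<boxplus> b \<in> ?L"
    using c H(1) H(3)[of c d] subsetD[OF X] by (auto simp: distrib_right intro!: bexI[of _ "c \<boxplus> d"])
qed simp

text \<open>If \<open>d\<close> is a left unit in degree \<open>j\<close>, then replacing each product \<open>ab\<close> in \<open>e\<close> by \<open>adb\<close> does not
  change the action on \<open>A\<^bsub>i+j\<^esub>\<close>.\<close>

lemma has_left_unit_add:
  assumes e: "e \<in> prod_set A (G i) (G (- i))" "\<And>x. x \<in> G (i + j) \<Longrightarrow> e \<boxdot> x = x"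
    and "has_left_unit A G j"
  shows "has_left_unit A G (i + j)"
proof -
  let ?H = "prod_set A (G (i + j)) (G (- (i + j)))"
  let ?L = "{a \<in> rcarrier A. \<exists>c\<in>?H. \<forall>x\<in>G (i + j). c \<boxdot> x = a \<boxdot> x}"
  obtain d where d: "d \<in> prod_set A (G j) (G (- j))" "\<And>x. x \<in> G j \<Longrightarrow> d \<boxdot> x = x"
    using assms(3) by (auto simp: has_left_unit_def)
  have "is_addsub A ?L"
    by (rule is_addsub_left_action[OF is_addsub_prod_set_component component_subset])
  moreover have "a \<boxdot> b \<in> ?L" if a: "a \<in> G i" and b: "b \<in> G (- i)" for a b
  proof -
    have ab: "a \<in> rcarrier A" "b \<in> rcarrier A" "d \<in> rcarrier A"
      using a b d(1) component_closed prod_set_closed by auto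
    have "addhom A A (\<lambda>d. a \<boxdot> d \<boxdot> b)"
      by (rule addhom_compose[OF addhom_mul_left addhom_mul_right]) (use ab in auto)
    then have "a \<boxdot> d \<boxdot> b \<in> ?H"
    proof (rule prod_set_mapI[OF d(1) component_subset component_subset _ is_addsub_prod_set_component])
      fix x y assume "x \<in> G j" "y \<in> G (- j)"
      then show "a \<boxdot> (x \<boxdot> y) \<boxdot> b \<in> ?H"
        using a b prod_setI[of "a \<boxdot> x" "G (i + j)" "y \<boxdot> b" "G (- (i + j))"]
        by (simp add: component_mulI component_closed mul_assoc)
    qed
    moreover have "a \<boxdot> d \<boxdot> b \<boxdot> x = a \<boxdot> b \<boxdot> x" if x: "x \<in> G (i + j)" for x
      using d(2)[of "b \<boxdot> x"] component_mulI[OF b x] ab component_closed[OF x] by (simp add: mul_assoc)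
    ultimately show ?thesis using ab by auto
  qed
  ultimately have "e \<in> ?L" using e(1) prod_set_least by blast
  then obtain c where "c \<in> ?H" "\<forall>x\<in>G (i + j). c \<boxdot> x = e \<boxdot> x" by auto
  then show ?thesis using e(2) by (auto simp: has_left_unit_def)
qed

lemma has_left_unit_nat:
  assumes "has_left_unit A G 0" "has_left_unit A G 1"
    and span: "\<And>k. G (1 + int k) \<subseteq> prod_set A (G 1) (G (int k))"
  shows "has_left_unit A G (int k)"
proof (induction k)
  case (Suc k)
  obtain e where e: "e \<in> prod_set A (G 1) (G (- 1))" "\<And>x. x \<in> G 1 \<Longrightarrow> e \<boxdot> x = x"
    using assms(2) by (auto simp: has_left_unit_def)
  have "e \<boxdot> x = x" if "x \<in> G (1 + int k)" for x
    using left_identity_on_prod_set[OF e(2) prod_set_closed[OF e(1)] component_subset component_subset]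
      span that
    by blast
  then show ?case using has_left_unit_add[OF e(1), of "int k"] Suc by simp
qed (use assms(1) in simp)

lemma has_left_unit_uminus:
  assumes "has_right_unit A G i" "unital_ideal A (prod_set A (G (- i)) (G i))"
  shows "has_left_unit A G (- i)"
proof -
  obtain b where b: "b \<in> prod_set A (G i) (G (- i))" "\<And>y. y \<in> G (- i) \<Longrightarrow> y \<boxdot> b = y"
    using assms(1) by (auto simp: has_right_unit_def)
  obtain e where e: "e \<in> prod_set A (G (- i)) (G i)" "\<And>z. z \<in> prod_set A (G (- i)) (G i) \<Longrightarrow> e \<boxdot> z = z"
    using assms(2) by (auto simp: unital_ideal_def)
  note e_closed = prod_set_closed[OF e(1)]
  have "e \<boxdot> y = y" if y: "y \<in> G (- i)" for y
  proof -
    note y_closed = component_closed[OF y]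
    have "e \<boxdot> (y \<boxdot> b) = y \<boxdot> b"
    proof (rule addhom_eq_on_prod_set[OF b(1) component_subset component_subset])
      show "addhom A A (\<lambda>b. e \<boxdot> (y \<boxdot> b))" "addhom A A (\<lambda>b. y \<boxdot> b)"
        using y_closed e_closed
        by (auto intro: addhom_mul_left addhom_compose[OF addhom_mul_left addhom_mul_left])
      fix s t assume "s \<in> G i" "t \<in> G (- i)"
      then show "e \<boxdot> (y \<boxdot> (s \<boxdot> t)) = y \<boxdot> (s \<boxdot> t)"
        using e(2)[OF prod_setI[OF y]]
        by (simp add: e_closed y_closed component_closed flip: mul_assoc)
    qed
    then show ?thesis using b(2)[OF y] by simp
  qed
  then show ?thesis using e(1) by (auto simp: has_left_unit_def)
qed

text \<open>The opposite ring with reversed grading exchanges left and right units.\<close>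

lemma has_right_unit_nat:
  assumes "has_right_unit A G 0" "has_right_unit A G 1"
    and span: "\<And>k. G (- 1 - int k) \<subseteq> prod_set A (G (- int k)) (G (- 1))"
  shows "has_right_unit A G (int k)"
  using graded_rng.has_left_unit_nat[OF graded_rng_opposite] assms by (simp add: has_unit_opposite)

lemma has_right_unit_uminus:
  assumes "has_left_unit A G i" "unital_ideal A (prod_set A (G (- i)) (G i))"
  shows "has_right_unit A G (- i)"
  using graded_rng.has_left_unit_uminus[OF graded_rng_opposite, of i] assms
    has_unit_opposite(1)[of A G "- i"]
  by (simp add: has_unit_opposite unital_ideal_opposite)

lemma eps_strongly_gradedI:
  assumes "\<And>k. has_left_unit A G (int k)" "\<And>k. has_right_unit A G (int k)"
    and "\<And>k. unital_ideal A (prod_set A (G (- int k)) (G (int k)))"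
  shows "eps_strongly_graded A G"
proof -
  have "has_left_unit A G i \<and> has_right_unit A G i" for i
  proof (cases i rule: int_cases2)
    case (nonneg k)
    then show ?thesis using assms by simp
  next
    case (nonpos k)
    then show ?thesis using has_left_unit_uminus has_right_unit_uminus assms by simp
  qed
  then show ?thesis by (simp add: eps_strongly_graded_iff_units)
qed

end

locale eps_graded_rng = graded_rng A G
  for A :: "'a rng" (structure) and G :: "int \<Rightarrow> 'a set" +
  fixes \<epsilon> :: "int \<Rightarrow> 'a"
  assumes eps_in: "\<epsilon> i \<in> prod_set A (G i) (G (- i))"
    and eps_mul: "x \<in> G i \<Longrightarrow> \<epsilon> i \<boxdot> x = x"
    and mul_eps: "x \<in> G (- i) \<Longrightarrow> x \<boxdot> \<epsilon> i = x"
begin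

lemma eps_graded_rng_opposite: "eps_graded_rng (opposite A) (\<lambda>i. G (- i)) \<epsilon>"
proof -
  interpret op: graded_rng "opposite A" "\<lambda>i. G (- i)" by (rule graded_rng_opposite)
  show ?thesis by unfold_locales (simp_all add: eps_in eps_mul mul_eps)
qed

lemma eps_degree_zero: "\<epsilon> i \<in> G 0"
  using prod_set_degree_zero[OF eps_in] .

lemma eps_mul_prod_set:
  assumes "z \<in> prod_set A (G i) (G (- i))"
  shows "\<epsilon> i \<boxdot> z = z"
  using left_identity_on_prod_set[OF eps_mul _ component_subset component_subset assms]
    component_closed[OF eps_degree_zero] by simp

lemma prod_set_mul_eps:
  assumes "z \<in> prod_set A (G i) (G (- i))"
  shows "z \<boxdot> \<epsilon> i = z"
  using eps_graded_rng.eps_mul_prod_set[OF eps_graded_rng_opposite] assms by simp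

lemma unital_ideal_prod_set: "unital_ideal A (prod_set A (G i) (G (- i)))"
  unfolding unital_ideal_def using eps_in eps_mul_prod_set prod_set_mul_eps by blast

lemma eps_zero_mul:
  assumes x: "x \<in> G i"
  shows "\<epsilon> 0 \<boxdot> x = x"
proof -
  have "\<epsilon> 0 \<boxdot> x = \<epsilon> 0 \<boxdot> \<epsilon> i \<boxdot> x"
    using x
    by (simp add: mul_assoc component_closed[OF eps_degree_zero] component_closed[OF x] eps_mul)
  then show ?thesis using x by (simp add: eps_mul eps_degree_zero)
qed

lemma mul_eps_zero:
  assumes "x \<in> G i"
  shows "x \<boxdot> \<epsilon> 0 = x"
  using eps_graded_rng.eps_zero_mul[OF eps_graded_rng_opposite, of x "- i"] assms by simp

end

lemma (in graded_rng) eps_strongly_graded_obtain_units: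
  assumes "eps_strongly_graded A G"
  obtains \<epsilon> where "eps_graded_rng A G \<epsilon>"
proof -
  have "\<exists>e\<in>prod_set A (G i) (G (- i)). (\<forall>x\<in>G i. e \<boxdot> x = x) \<and> (\<forall>x\<in>G (- i). x \<boxdot> e = x)" for i
  proof -
    obtain a where a: "a \<in> prod_set A (G i) (G (- i))" "\<And>x. x \<in> G i \<Longrightarrow> a \<boxdot> x = x"
      using assms unfolding eps_strongly_graded_iff_units has_left_unit_def by metis
    obtain b where b: "b \<in> prod_set A (G i) (G (- i))" "\<And>x. x \<in> G (- i) \<Longrightarrow> x \<boxdot> b = x"
      using assms unfolding eps_strongly_graded_iff_units has_right_unit_def by metis
    have "a \<boxdot> b = b"
      by (rule left_identity_on_prod_set[OF a(2) prod_set_closed[OF a(1)]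
            component_subset component_subset b(1)])
    moreover have "a \<boxdot> b = a"
      by (rule right_identity_on_prod_set[OF b(2) prod_set_closed[OF b(1)]
            component_subset component_subset a(1)])
    ultimately show ?thesis using a b by (intro bexI[of _ a]) auto
  qed
  then obtain \<epsilon> where "\<And>i. \<epsilon> i \<in> prod_set A (G i) (G (- i))"
    "\<And>i x. x \<in> G i \<Longrightarrow> \<epsilon> i \<boxdot> x = x" "\<And>i x. x \<in> G (- i) \<Longrightarrow> x \<boxdot> \<epsilon> i = x" by metis
  then have "eps_graded_rng A G \<epsilon>" by unfold_locales
  then show thesis by (rule that)
qed

section \<open>Covariant representations\<close>

text \<open>A bimodule is regarded as a ring with zero multiplication, so that the results on additive maps
  apply to its additive group.\<close>

definition null_rng :: "('r, 'm) bimod \<Rightarrow> 'm rng" where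
  "null_rng M = \<lparr>rcarrier = mcar M, radd = madd M, rmul = \<lambda>x y. mzero M, rzero = mzero M, rneg = mneg M\<rparr>"

lemma null_rng_simps [simp]:
  "rcarrier (null_rng M) = mcar M" "radd (null_rng M) = madd M" "rmul (null_rng M) x y = mzero M"
  "rzero (null_rng M) = mzero M" "rneg (null_rng M) = mneg M"
  by (simp_all add: null_rng_def)

lemma nuring_null_rng: "bimodule R M \<Longrightarrow> nuring (null_rng M)"
  unfolding nuring_def nu_ring_def bimodule_def null_rng_simps by (intro conjI ballI) metis+

text \<open>\<open>theta_Q\<close> and \<open>theta_P\<close> are the sums of the operators \<open>\<theta>\<^bsub>q,p\<^esub>\<close> and \<open>\<theta>\<^bsub>p,q\<^esub>\<close> over a list of pairs.\<close>

definition theta_Q :: "('r, 'q) bimod \<Rightarrow> ('p \<Rightarrow> 'q \<Rightarrow> 'r) \<Rightarrow> ('q \<times> 'p) list \<Rightarrow> 'q \<Rightarrow> 'q" where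
  "theta_Q Q psi l x = msum Q (map (\<lambda>(q, p). ract Q q (psi p x)) l)"

definition theta_P :: "('r, 'p) bimod \<Rightarrow> ('p \<Rightarrow> 'q \<Rightarrow> 'r) \<Rightarrow> ('p \<times> 'q) list \<Rightarrow> 'p \<Rightarrow> 'p" where
  "theta_P P psi l y = msum P (map (\<lambda>(p, q). lact P (psi y q) p) l)"

lemma theta_simps [simp]:
  "theta_Q Q psi [] x = mzero Q"
  "theta_Q Q psi ((q, p) # l) x = madd Q (ract Q q (psi p x)) (theta_Q Q psi l x)"
  "theta_P P psi [] y = mzero P"
  "theta_P P psi ((p, q) # m) y = madd P (lact P (psi y q) p) (theta_P P psi m y)"
  by (simp_all add: theta_Q_def theta_P_def msum_def)

lemma in_FPQ_iff:
  "in_FPQ R P Q psi Th \<longleftrightarrow>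
     (\<exists>l. set l \<subseteq> mcar Q \<times> mcar P \<and> (\<forall>x\<in>mcar Q. Th x = theta_Q Q psi l x))"
  by (simp add: in_FPQ_def theta_Q_def)

lemma in_FQP_iff:
  "in_FQP R P Q psi Ph \<longleftrightarrow>
     (\<exists>l. set l \<subseteq> mcar P \<times> mcar Q \<and> (\<forall>y\<in>mcar P. Ph y = theta_P P psi l y))"
  by (simp add: in_FQP_def theta_P_def)

locale R_system =
  fixes R :: "'r rng" and P :: "('r, 'p) bimod" and Q :: "('r, 'q) bimod" and psi :: "'p \<Rightarrow> 'q \<Rightarrow> 'r"
  assumes rsystem: "rsystem R P Q psi"
begin

sublocale R: nuring R
  using rsystem by unfold_locales (simp add: rsystem_def)

sublocale P: nuring "null_rng P"
  using rsystem nuring_null_rng by (auto simp: rsystem_def)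

sublocale Q: nuring "null_rng Q"
  using rsystem nuring_null_rng by (auto simp: rsystem_def)

lemma bimod_closed [simp]:
  "p \<in> mcar P \<Longrightarrow> r \<in> rcarrier R \<Longrightarrow> ract P p r \<in> mcar P"
  "p \<in> mcar P \<Longrightarrow> r \<in> rcarrier R \<Longrightarrow> lact P r p \<in> mcar P"
  "q \<in> mcar Q \<Longrightarrow> r \<in> rcarrier R \<Longrightarrow> ract Q q r \<in> mcar Q"
  "q \<in> mcar Q \<Longrightarrow> r \<in> rcarrier R \<Longrightarrow> lact Q r q \<in> mcar Q"
  "p \<in> mcar P \<Longrightarrow> q \<in> mcar Q \<Longrightarrow> psi p q \<in> rcarrier R"
  using rsystem by (simp_all add: rsystem_def bimodule_def)

lemma bimod_add_closed [simp]:
  "p \<in> mcar P \<Longrightarrow> p' \<in> mcar P \<Longrightarrow> madd P p p' \<in> mcar P" "mzero P \<in> mcar P"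
  "q \<in> mcar Q \<Longrightarrow> q' \<in> mcar Q \<Longrightarrow> madd Q q q' \<in> mcar Q" "mzero Q \<in> mcar Q"
  using P.add_closed P.zero_closed Q.add_closed Q.zero_closed by simp_all

lemma theta_Q_closed: "set l \<subseteq> mcar Q \<times> mcar P \<Longrightarrow> x \<in> mcar Q \<Longrightarrow> theta_Q Q psi l x \<in> mcar Q"
  by (induction l) auto

lemma theta_P_closed: "set l \<subseteq> mcar P \<times> mcar Q \<Longrightarrow> y \<in> mcar P \<Longrightarrow> theta_P P psi l y \<in> mcar P"
  by (induction l) auto

end

locale covariant_rep = R_system R P Q psi + nuring B + sigma: rhom R B \<sigma>
  for R :: "'r rng" and P :: "('r, 'p) bimod" and Q :: "('r, 'q) bimod" and psi :: "'p \<Rightarrow> 'q \<Rightarrow> 'r"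
    and B :: "'b rng" (structure) and \<sigma> :: "'r \<Rightarrow> 'b" +
  fixes S :: "'p \<Rightarrow> 'b" and T :: "'q \<Rightarrow> 'b"
  assumes S_closed [simp]: "p \<in> mcar P \<Longrightarrow> S p \<in> rcarrier B"
    and T_closed [simp]: "q \<in> mcar Q \<Longrightarrow> T q \<in> rcarrier B"
    and S_add: "p \<in> mcar P \<Longrightarrow> p' \<in> mcar P \<Longrightarrow> S (madd P p p') = S p \<boxplus> S p'"
    and T_add: "q \<in> mcar Q \<Longrightarrow> q' \<in> mcar Q \<Longrightarrow> T (madd Q q q') = T q \<boxplus> T q'"
    and S_ract: "p \<in> mcar P \<Longrightarrow> r \<in> rcarrier R \<Longrightarrow> S (ract P p r) = S p \<boxdot> \<sigma> r"
    and S_lact: "p \<in> mcar P \<Longrightarrow> r \<in> rcarrier R \<Longrightarrow> S (lact P r p) = \<sigma> r \<boxdot> S p"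
    and T_ract: "q \<in> mcar Q \<Longrightarrow> r \<in> rcarrier R \<Longrightarrow> T (ract Q q r) = T q \<boxdot> \<sigma> r"
    and T_lact: "q \<in> mcar Q \<Longrightarrow> r \<in> rcarrier R \<Longrightarrow> T (lact Q r q) = \<sigma> r \<boxdot> T q"
    and sigma_psi: "p \<in> mcar P \<Longrightarrow> q \<in> mcar Q \<Longrightarrow> \<sigma> (psi p q) = S p \<boxdot> T q"
begin

lemmas sigma_closed [simp] = sigma.map_closed

lemma addhom_S: "addhom (null_rng P) B S"
  by unfold_locales (simp_all add: S_add)

lemma addhom_T: "addhom (null_rng Q) B T"
  by unfold_locales (simp_all add: T_add)

lemma sum_TS_mul_T:
  assumes "set l \<subseteq> mcar Q \<times> mcar P" and q: "q \<in> mcar Q"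
  shows "rsum_mul B (map (map_prod T S) l) \<boxdot> T q = T (theta_Q Q psi l q)"
  using assms(1)
proof (induction l)
  case Nil
  then show ?case using addhom.map_zero[OF addhom_T] q by simp
next
  case (Cons qp l)
  obtain q' p' where qp: "qp = (q', p')" by (cases qp)
  have "set (map (map_prod T S) l) \<subseteq> rcarrier B \<times> rcarrier B" using Cons.prems by auto
  moreover have "T q' \<boxdot> S p' \<boxdot> T q = T (ract Q q' (psi p' q))"
    using Cons.prems qp q by (simp add: T_ract sigma_psi mul_assoc)
  ultimately show ?case
    using Cons qp q by (simp add: T_add theta_Q_closed distrib_right rsum_mul_closed)
qed

lemma S_mul_sum_TS:
  assumes "set l \<subseteq> mcar P \<times> mcar Q" and p: "p \<in> mcar P"
  shows "S p \<boxdot> rsum_mul B (map (\<lambda>(p, q). (T q, S p)) l) = S (theta_P P psi l p)"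
  using assms(1)
proof (induction l)
  case Nil
  then show ?case using addhom.map_zero[OF addhom_S] p by simp
next
  case (Cons pq l)
  obtain p' q' where pq: "pq = (p', q')" by (cases pq)
  have "set (map (\<lambda>(p, q). (T q, S p)) l) \<subseteq> rcarrier B \<times> rcarrier B" using Cons.prems by auto
  moreover have "S p \<boxdot> (T q' \<boxdot> S p') = S (lact P (psi p q') p')"
    using Cons.prems pq p by (simp add: S_lact sigma_psi mul_assoc)
  ultimately show ?case
    using Cons pq p by (simp add: S_add theta_P_closed distrib_left rsum_mul_closed)
qed

subsection \<open>Monomials and the grading they span\<close>

inductive monomial :: "int \<Rightarrow> 'b \<Rightarrow> bool" where
  sigma: "r \<in> rcarrier R \<Longrightarrow> monomial 0 (\<sigma> r)"
| S: "p \<in> mcar P \<Longrightarrow> monomial (- 1) (S p)"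
| T: "q \<in> mcar Q \<Longrightarrow> monomial 1 (T q)"
| T_mul: "q \<in> mcar Q \<Longrightarrow> monomial i x \<Longrightarrow> monomial (1 + i) (T q \<boxdot> x)"
| mul_S: "p \<in> mcar P \<Longrightarrow> monomial i x \<Longrightarrow> monomial (i - 1) (x \<boxdot> S p)"

lemma monomial_closed: "monomial i x \<Longrightarrow> x \<in> rcarrier B"
  by (induction rule: monomial.induct) auto

lemma sigma_mul_monomial: "monomial i x \<Longrightarrow> r \<in> rcarrier R \<Longrightarrow> monomial i (\<sigma> r \<boxdot> x)"
proof (induction rule: monomial.induct)
  case (sigma s)
  then show ?case using monomial.sigma[of "rmul R r s"] by (simp add: sigma.map_mul)
next
  case (S p)
  then show ?case using monomial.S[of "lact P r p"] by (simp add: S_lact)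
next
  case (T q)
  then show ?case using monomial.T[of "lact Q r q"] by (simp add: T_lact)
next
  case (T_mul q i x)
  then show ?case
    using monomial.T_mul[of "lact Q r q" i x] by (simp add: T_lact mul_assoc monomial_closed)
next
  case (mul_S p i x)
  then show ?case using monomial.mul_S[of p i "\<sigma> r \<boxdot> x"] by (simp add: mul_assoc monomial_closed)
qed

lemma S_mul_monomial: "monomial i x \<Longrightarrow> p \<in> mcar P \<Longrightarrow> monomial (i - 1) (S p \<boxdot> x)"
proof (induction rule: monomial.induct)
  case (sigma r)
  then show ?case using monomial.S[of "ract P p r"] by (simp add: S_ract)
next
  case (S p')
  then show ?case using monomial.mul_S[OF _ monomial.S] by simp
next
  case (T q)
  then show ?case using monomial.sigma[of "psi p q"] by (simp add: sigma_psi)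
next
  case (T_mul q i x)
  then show ?case
    using sigma_mul_monomial[of i x "psi p q"] by (simp add: sigma_psi mul_assoc monomial_closed)
next
  case (mul_S p' i x)
  then show ?case using monomial.mul_S[of p' "i - 1" "S p \<boxdot> x"]
    by (simp add: mul_assoc monomial_closed)
qed

lemma monomial_mul: "monomial i x \<Longrightarrow> monomial j y \<Longrightarrow> monomial (i + j) (x \<boxdot> y)"
proof (induction arbitrary: j y rule: monomial.induct)
  case (sigma r)
  then show ?case using sigma_mul_monomial by simp
next
  case (S p)
  then show ?case using S_mul_monomial[of j y p] by simp
next
  case (T q)
  then show ?case by (rule monomial.T_mul)
next
  case (T_mul q i x)
  then show ?case using monomial.T_mul[of q "i + j" "x \<boxdot> y"]
    by (simp add: mul_assoc monomial_closed add.assoc)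
next
  case (mul_S p i x)
  then show ?case
    using mul_S.IH[OF S_mul_monomial[of j y p]] by (simp add: mul_assoc monomial_closed algebra_simps)
qed

definition component :: "int \<Rightarrow> 'b set" where
  "component i = addsub_gen B (Collect (monomial i))"

lemma monomials_subset: "Collect (monomial i) \<subseteq> rcarrier B"
  using monomial_closed by auto

lemma monomial_in_component: "monomial i x \<Longrightarrow> x \<in> component i"
  unfolding component_def by (rule subsetD[OF subset_addsub_gen]) simp

lemma component_least: "is_addsub B H \<Longrightarrow> (\<And>x. monomial i x \<Longrightarrow> x \<in> H) \<Longrightarrow> component i \<subseteq> H"
  unfolding component_def by (rule addsub_gen_least) auto

lemma component_mul_mapI:
  assumes "x \<in> component i" "y \<in> component j" "is_addsub B H"
    and "\<And>x y. monomial i x \<Longrightarrow> monomial j y \<Longrightarrow> x \<boxdot> y \<in> H"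
  shows "x \<boxdot> y \<in> H"
  using assms(1,2) unfolding component_def
  by (rule addsub_gen_mulI[OF _ _ monomials_subset monomials_subset assms(3)]) (use assms(4) in auto)

sublocale graded_rng B component
proof unfold_locales
  show addsub: "is_addsub B (component i)" for i
    unfolding component_def by (rule is_addsub_addsub_gen[OF monomials_subset])
  show "x \<boxdot> y \<in> component (i + j)" if "x \<in> component i" "y \<in> component j" for x y i j
    using that addsub by (rule component_mul_mapI) (intro monomial_in_component monomial_mul)
qed

lemma generators_in_component:
  "r \<in> rcarrier R \<Longrightarrow> \<sigma> r \<in> component 0"
  "p \<in> mcar P \<Longrightarrow> S p \<in> component (- 1)"
  "q \<in> mcar Q \<Longrightarrow> T q \<in> component 1"
  by (blast intro: monomial_in_component monomial.intros)+

lemma rhom_component_subset: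
  assumes "rhom B C f" "graded_rng C G"
    and "\<And>r. r \<in> rcarrier R \<Longrightarrow> f (\<sigma> r) \<in> G 0" "\<And>p. p \<in> mcar P \<Longrightarrow> f (S p) \<in> G (- 1)"
    and "\<And>q. q \<in> mcar Q \<Longrightarrow> f (T q) \<in> G 1"
  shows "f ` component i \<subseteq> G i"
proof -
  interpret f: rhom B C f by fact
  interpret C: graded_rng C G by fact
  have "f x \<in> G i" if "monomial i x" for i x
    using that
  proof (induction rule: monomial.induct)
    case (T_mul q i x)
    then show ?case using assms(5) by (simp add: f.map_mul monomial_closed C.component_mul)
  next
    case (mul_S p i x)
    then show ?case
      using assms(4) C.component_mul[of "f x" i "f (S p)" "- 1"]
      by (simp add: f.map_mul monomial_closed)
  qed (use assms in auto)
  then show ?thesis using f.addsub_gen_mapI[OF _ monomials_subset C.component_addsub]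
    unfolding component_def by auto
qed

lemma covariant_rep_compose:
  assumes "rhom B C f"
  shows "covariant_rep R P Q psi C (\<lambda>r. f (\<sigma> r)) (\<lambda>p. f (S p)) (\<lambda>q. f (T q))"
proof -
  interpret f: rhom B C f by fact
  show ?thesis
    by unfold_locales (simp_all add: f.map_closed f.map_add f.map_mul sigma.map_add sigma.map_mul
        S_add T_add S_ract S_lact T_ract T_lact sigma_psi)
qed

lemma component_image:
  assumes "rhom B C f"
  shows "f ` component i =
      covariant_rep.component R P Q C (\<lambda>r. f (\<sigma> r)) (\<lambda>p. f (S p)) (\<lambda>q. f (T q)) i"
proof -
  interpret f: rhom B C f by fact
  interpret C: covariant_rep R P Q psi C "\<lambda>r. f (\<sigma> r)" "\<lambda>p. f (S p)" "\<lambda>q. f (T q)"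
    by (rule covariant_rep_compose) fact
  have "C.monomial i (f x)" if "monomial i x" for i x
    using that
    by (induction rule: monomial.induct) (auto simp: f.map_mul monomial_closed intro: C.monomial.intros)
  moreover have "\<exists>x. monomial i x \<and> y = f x" if "C.monomial i y" for i y
    using that
  proof (induction rule: C.monomial.induct)
    case (T_mul q i y)
    then obtain x where "monomial i x" "y = f x" by blast
    then show ?case
      using T_mul.hyps(1)
      by (intro exI[of _ "T q \<boxdot> x"]) (simp add: f.map_mul monomial_closed monomial.T_mul)
  next
    case (mul_S p i y)
    then obtain x where "monomial i x" "y = f x" by blast
    then show ?case
      using mul_S.hyps(1)
      by (intro exI[of _ "x \<boxdot> S p"]) (simp add: f.map_mul monomial_closed monomial.mul_S)
  qed (blast intro: monomial.intros)+
  ultimately have "f ` Collect (monomial i) = Collect (C.monomial i)" by blast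
  then show ?thesis
    unfolding component_def C.component_def f.addsub_gen_image[OF monomials_subset] by simp
qed

lemma monomial_rprod:
  assumes "set qs \<subseteq> mcar Q" "set ps \<subseteq> mcar P" "0 < length qs + length ps"
  shows "monomial (int (length qs) - int (length ps)) (rprod B (map T qs @ map S ps))"
proof -
  have S_word: "monomial (- int (length ps)) (rprod B (map S ps))" if "set ps \<subseteq> mcar P" "ps \<noteq> []" for ps
    using that
  proof (induction ps)
    case (Cons p ps)
    show ?case
    proof (cases "ps = []")
      case False
      then show ?thesis
        using Cons S_mul_monomial[of "- int (length ps)" "rprod B (map S ps)" p]
        by (simp add: rprod_Cons minus_diff_commute)
    qed (use Cons.prems monomial.S in simp)
  qed simp
  show ?thesis using assms(1,3)
  proof (induction qs)
    case Nil
    then show ?case using S_word assms(2) by simp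
  next
    case (Cons q qs)
    show ?case
    proof (cases "qs = [] \<and> ps = []")
      case False
      then show ?thesis
        using Cons monomial.T_mul[of q "int (length qs) - int (length ps)"]
        by (auto simp: rprod_Cons algebra_simps)
    qed (use Cons.prems monomial.T in simp)
  qed
qed

lemma monomial_sigma_rprod:
  assumes "r \<in> rcarrier R" "set qs \<subseteq> mcar Q" "set ps \<subseteq> mcar P"
  shows "monomial (int (length qs) - int (length ps)) (rprod B (\<sigma> r # map T qs @ map S ps))"
proof (cases "qs = [] \<and> ps = []")
  case False
  then show ?thesis
    using assms sigma_mul_monomial[OF monomial_rprod, of qs ps r] by (auto simp: rprod_Cons)
qed (use assms monomial.sigma in auto)

lemma T_mul_sigma_rprod:
  assumes "q \<in> mcar Q" "r \<in> rcarrier R" "set qs \<subseteq> mcar Q" "set ps \<subseteq> mcar P"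
  shows "T q \<boxdot> rprod B (\<sigma> r # map T qs @ map S ps) = rprod B (T (ract Q q r) # map T qs @ map S ps)"
proof (cases "map T qs @ map S ps = []")
  case False
  moreover from this have "rprod B (map T qs @ map S ps) \<in> rcarrier B"
    using assms by (intro rprod_closed) auto
  ultimately show ?thesis using assms by (simp add: rprod_Cons T_ract mul_assoc)
qed (use assms in \<open>simp add: T_ract\<close>)

lemma monomial_imp_rprod:
  assumes "monomial i x"
  shows "\<exists>rs qs ps. set rs \<subseteq> rcarrier R \<and> set qs \<subseteq> mcar Q \<and> set ps \<subseteq> mcar P \<and> length rs \<le> 1 \<and>
    0 < length rs + length qs + length ps \<and> int (length qs) - int (length ps) = i \<and>
    x = rprod B (map \<sigma> rs @ map T qs @ map S ps)"
  (is "\<exists>rs qs ps. ?word i x rs qs ps")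
  using assms
proof (induction rule: monomial.induct)
  case (sigma r)
  then have "?word 0 (\<sigma> r) [r] [] []" by simp
  then show ?case by blast
next
  case (S p)
  then have "?word (- 1) (S p) [] [] [p]" by simp
  then show ?case by blast
next
  case (T q)
  then have "?word 1 (T q) [] [q] []" by simp
  then show ?case by blast
next
  case (T_mul q i x)
  then obtain rs qs ps where word: "?word i x rs qs ps" by blast
  show ?case
  proof (cases rs)
    case Nil
    then have "?word (1 + i) (T q \<boxdot> x) [] (q # qs) ps" using word T_mul.hyps(1)
      by (auto simp: rprod_Cons)
    then show ?thesis by blast
  next
    case (Cons r rs')
    then have rs: "rs = [r]" using word by simp
    then have "?word (1 + i) (T q \<boxdot> x) [] (ract Q q r # qs) ps"
      using word T_mul.hyps(1) by (simp add: T_mul_sigma_rprod)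
    then show ?thesis by blast
  qed
next
  case (mul_S p i x)
  then obtain rs qs ps where word: "?word i x rs qs ps" by blast
  have "x \<boxdot> S p = rprod B ((map \<sigma> rs @ map T qs @ map S ps) @ [S p])"
    using word mul_S.hyps(1) by (subst rprod_append) auto
  then have "?word (i - 1) (x \<boxdot> S p) rs qs (ps @ [p])" using word mul_S.hyps(1) by auto
  then show ?case by blast
qed

lemma monomials_eq_rprods:
  "Collect (monomial i) =
     {rprod B (map T qs @ map S ps) | qs ps. set qs \<subseteq> mcar Q \<and> set ps \<subseteq> mcar P \<and>
        length qs + length ps > 0 \<and> int (length qs) - int (length ps) = i} \<union>
     {rprod B (\<sigma> r # map T qs @ map S ps) | r qs ps. r \<in> rcarrier R \<and> set qs \<subseteq> mcar Q \<and>
        set ps \<subseteq> mcar P \<and> int (length qs) - int (length ps) = i}"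
  (is "_ = ?X \<union> ?Y")
proof (intro equalityI subsetI)
  fix x assume "x \<in> Collect (monomial i)"
  then obtain rs qs ps where word: "set rs \<subseteq> rcarrier R" "length rs \<le> 1"
    "0 < length rs + length qs + length ps"
    "set qs \<subseteq> mcar Q" "set ps \<subseteq> mcar P" "int (length qs) - int (length ps) = i"
    "x = rprod B (map \<sigma> rs @ map T qs @ map S ps)"
    using monomial_imp_rprod[of i x] by blast
  show "x \<in> ?X \<union> ?Y"
  proof (cases rs)
    case Nil
    then have "x \<in> ?X" using word by auto
    then show ?thesis ..
  next
    case (Cons r rs')
    then have "rs = [r]" using word(2) by simp
    then have "x \<in> ?Y" using word by auto
    then show ?thesis ..
  qed
next
  show "x \<in> Collect (monomial i)" if "x \<in> ?X \<union> ?Y" for x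
    using that by (auto intro: monomial_rprod monomial_sigma_rprod)
qed

end

section \<open>Representations of unital systems\<close>

locale unital_covariant_rep = covariant_rep R P Q psi B \<sigma> S T
  for R :: "'r rng" and P :: "('r, 'p) bimod" and Q :: "('r, 'q) bimod" and psi :: "'p \<Rightarrow> 'q \<Rightarrow> 'r"
    and B :: "'b rng" (structure) and \<sigma> :: "'r \<Rightarrow> 'b" and S :: "'p \<Rightarrow> 'b" and T :: "'q \<Rightarrow> 'b" +
  fixes u :: 'r
  assumes u_closed [simp]: "u \<in> rcarrier R"
    and u_mul [simp]: "r \<in> rcarrier R \<Longrightarrow> rmul R u r = r"
    and mul_u [simp]: "r \<in> rcarrier R \<Longrightarrow> rmul R r u = r"
    and u_lact_P [simp]: "p \<in> mcar P \<Longrightarrow> lact P u p = p"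
    and u_ract_P [simp]: "p \<in> mcar P \<Longrightarrow> ract P p u = p"
    and u_lact_Q [simp]: "q \<in> mcar Q \<Longrightarrow> lact Q u q = q"
    and u_ract_Q [simp]: "q \<in> mcar Q \<Longrightarrow> ract Q q u = q"

lemma unital_bimod_unit:
  assumes "bimodule R M" "unital_bimod R M"
    and u: "u \<in> rcarrier R" "\<And>r. r \<in> rcarrier R \<Longrightarrow> rmul R u r = r \<and> rmul R r u = r"
    and x: "x \<in> mcar M"
  shows "lact M u x = x" "ract M x u = x"
proof -
  obtain a b where ab: "a \<in> rcarrier R" "b \<in> rcarrier R" "lact M a x = x" "ract M x b = x"
    using assms(2) x by (auto simp: unital_bimod_def)
  have "lact M (rmul R u a) x = lact M u (lact M a x)" "ract M x (rmul R b u) = ract M (ract M x b) u"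
    using assms(1) x ab(1,2) u(1) by (simp_all add: bimodule_def)
  then show "lact M u x = x" "ract M x u = x" using ab u by auto
qed

lemma (in covariant_rep) unital_system_obtain_unit:
  assumes "unital_system R P Q"
  obtains u where "unital_covariant_rep R P Q psi B \<sigma> S T u"
proof -
  obtain u where u: "u \<in> rcarrier R" "\<And>r. r \<in> rcarrier R \<Longrightarrow> rmul R u r = r \<and> rmul R r u = r"
    using assms by (auto simp: unital_system_def unital_rng_def)
  have "bimodule R P" "unital_bimod R P" "bimodule R Q" "unital_bimod R Q"
    using assms rsystem by (auto simp: unital_system_def rsystem_def)
  then have "unital_covariant_rep R P Q psi B \<sigma> S T u"
    using u unital_bimod_unit[of R P u] unital_bimod_unit[of R Q u] by unfold_locales auto
  then show thesis by (rule that)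
qed

context unital_covariant_rep
begin

lemma one_mul_generators:
  "r \<in> rcarrier R \<Longrightarrow> \<sigma> u \<boxdot> \<sigma> r = \<sigma> r" "p \<in> mcar P \<Longrightarrow> \<sigma> u \<boxdot> S p = S p"
  "q \<in> mcar Q \<Longrightarrow> \<sigma> u \<boxdot> T q = T q"
  by (simp_all flip: sigma.map_mul S_lact T_lact)

lemma generators_mul_one:
  "r \<in> rcarrier R \<Longrightarrow> \<sigma> r \<boxdot> \<sigma> u = \<sigma> r" "p \<in> mcar P \<Longrightarrow> S p \<boxdot> \<sigma> u = S p"
  "q \<in> mcar Q \<Longrightarrow> T q \<boxdot> \<sigma> u = T q"
  by (simp_all flip: sigma.map_mul S_ract T_ract)

lemma monomial_one: "monomial i x \<Longrightarrow> \<sigma> u \<boxdot> x = x \<and> x \<boxdot> \<sigma> u = x"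
proof (induction rule: monomial.induct)
  case (T_mul q i x)
  then show ?case
    by (metis T_closed mul_assoc monomial_closed one_mul_generators(3) sigma_closed u_closed)
next
  case (mul_S p i x)
  then show ?case
    by (metis S_closed mul_assoc monomial_closed generators_mul_one(2) sigma_closed u_closed)
qed (simp_all add: one_mul_generators generators_mul_one)

lemma one_mul: "x \<in> component i \<Longrightarrow> \<sigma> u \<boxdot> x = x"
  unfolding component_def
  by (erule addhom_eq_on_addsub_gen[OF _ monomials_subset addhom_mul_left addhom_id])
    (simp_all add: monomial_one[THEN conjunct1])

lemma mul_one: "x \<in> component i \<Longrightarrow> x \<boxdot> \<sigma> u = x"
  unfolding component_def
  by (erule addhom_eq_on_addsub_gen[OF _ monomials_subset addhom_mul_right addhom_id])
    (simp_all add: monomial_one[THEN conjunct2])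

text \<open>\<open>\<sigma>(u)\<close> plays the role of the empty product.\<close>

definition T_word :: "'q list \<Rightarrow> 'b" where
  "T_word qs = foldr (\<lambda>q x. T q \<boxdot> x) qs (\<sigma> u)"

definition S_word :: "'p list \<Rightarrow> 'b" where
  "S_word ps = foldr (\<lambda>p x. S p \<boxdot> x) ps (\<sigma> u)"

lemma word_simps [simp]:
  "T_word [] = \<sigma> u" "T_word (q # qs) = T q \<boxdot> T_word qs"
  "S_word [] = \<sigma> u" "S_word (p # ps) = S p \<boxdot> S_word ps"
  by (simp_all add: T_word_def S_word_def)

lemma T_word_component: "set qs \<subseteq> mcar Q \<Longrightarrow> T_word qs \<in> component (int (length qs))"
  by (induction qs) (auto intro: generators_in_component component_mulI)

lemma S_word_component: "set ps \<subseteq> mcar P \<Longrightarrow> S_word ps \<in> component (- int (length ps))"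
  by (induction ps) (auto intro: generators_in_component component_mulI)

lemma word_closed [simp]:
  "set qs \<subseteq> mcar Q \<Longrightarrow> T_word qs \<in> rcarrier B" "set ps \<subseteq> mcar P \<Longrightarrow> S_word ps \<in> rcarrier B"
  using T_word_component S_word_component component_closed by blast+

lemma T_word_append:
  "set qs \<subseteq> mcar Q \<Longrightarrow> set qs' \<subseteq> mcar Q \<Longrightarrow> T_word (qs @ qs') = T_word qs \<boxdot> T_word qs'"
  by (induction qs) (simp_all add: one_mul[OF T_word_component] mul_assoc)

lemma S_word_append:
  "set ps \<subseteq> mcar P \<Longrightarrow> set ps' \<subseteq> mcar P \<Longrightarrow> S_word (ps @ ps') = S_word ps \<boxdot> S_word ps'"
  by (induction ps) (simp_all add: one_mul[OF S_word_component] mul_assoc)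

lemma word_component:
  assumes "set qs \<subseteq> mcar Q" "r \<in> rcarrier R" "set ps \<subseteq> mcar P" "int (length qs) - int (length ps) = i"
  shows "T_word qs \<boxdot> \<sigma> r \<boxdot> S_word ps \<in> component i"
  using component_mul[OF component_mul[OF T_word_component generators_in_component(1)] S_word_component]
    assms by auto

lemma monomial_eq_word:
  assumes "monomial i x"
  obtains qs r ps where "set qs \<subseteq> mcar Q" "r \<in> rcarrier R" "set ps \<subseteq> mcar P"
    "int (length qs) - int (length ps) = i" "x = T_word qs \<boxdot> \<sigma> r \<boxdot> S_word ps"
proof -
  have "\<exists>qs r ps. set qs \<subseteq> mcar Q \<and> r \<in> rcarrier R \<and> set ps \<subseteq> mcar P \<and>
      int (length qs) - int (length ps) = i \<and> x = T_word qs \<boxdot> \<sigma> r \<boxdot> S_word ps"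
    using assms
  proof (induction rule: monomial.induct)
    case (sigma r)
    then show ?case
      by (intro exI[of _ "[]"] exI[of _ r]) (simp add: one_mul_generators generators_mul_one)
  next
    case (S p)
    then show ?case
      by (intro exI[of _ "[]"] exI[of _ u] exI[of _ "[p]"])
        (simp add: one_mul_generators generators_mul_one)
  next
    case (T q)
    then show ?case
      by (intro exI[of _ "[q]"] exI[of _ u] exI[of _ "[]"]) (simp add: generators_mul_one)
  next
    case (T_mul q i x)
    then obtain qs r ps where "set qs \<subseteq> mcar Q" "r \<in> rcarrier R" "set ps \<subseteq> mcar P"
      "int (length qs) - int (length ps) = i" "x = T_word qs \<boxdot> \<sigma> r \<boxdot> S_word ps" by blast
    then show ?case
      using T_mul.hyps(1) by (intro exI[of _ "q # qs"] exI[of _ r] exI[of _ ps]) (simp add: mul_assoc)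
  next
    case (mul_S p i x)
    then obtain qs r ps where "set qs \<subseteq> mcar Q" "r \<in> rcarrier R" "set ps \<subseteq> mcar P"
      "int (length qs) - int (length ps) = i" "x = T_word qs \<boxdot> \<sigma> r \<boxdot> S_word ps" by blast
    then show ?case
      using mul_S.hyps(1) by (intro exI[of _ qs] exI[of _ r] exI[of _ "ps @ [p]"])
        (simp add: mul_assoc S_word_append generators_mul_one)
  qed
  then show thesis using that by blast
qed

lemma monomial_nonneg:
  assumes "monomial (int k) x"
  obtains qs y where "set qs \<subseteq> mcar Q" "length qs = k" "y \<in> component 0" "x = T_word qs \<boxdot> y"
proof -
  obtain qs r ps where word: "set qs \<subseteq> mcar Q" "r \<in> rcarrier R" "set ps \<subseteq> mcar P"
    "int (length qs) - int (length ps) = int k" "x = T_word qs \<boxdot> \<sigma> r \<boxdot> S_word ps"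
    by (rule monomial_eq_word[OF assms])
  let ?y = "T_word (drop k qs) \<boxdot> \<sigma> r \<boxdot> S_word ps"
  have sub: "set (take k qs) \<subseteq> mcar Q" "set (drop k qs) \<subseteq> mcar Q"
    using word(1) set_take_subset[of k qs] set_drop_subset[of k qs] by auto
  have "x = T_word (take k qs) \<boxdot> ?y"
    using word sub T_word_append[OF sub] by (simp add: mul_assoc)
  moreover have "?y \<in> component 0"
    by (rule word_component) (use sub(2) word in auto)
  ultimately show thesis using word(4) sub(1) that[of "take k qs" ?y] by simp
qed

lemma monomial_nonpos:
  assumes "monomial (- int k) x"
  obtains y ps where "set ps \<subseteq> mcar P" "length ps = k" "y \<in> component 0" "x = y \<boxdot> S_word ps"
proof -
  obtain qs r ps where word: "set qs \<subseteq> mcar Q" "r \<in> rcarrier R" "set ps \<subseteq> mcar P"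
    "int (length qs) - int (length ps) = - int k" "x = T_word qs \<boxdot> \<sigma> r \<boxdot> S_word ps"
    by (rule monomial_eq_word[OF assms])
  let ?n = "length qs"
  let ?y = "T_word qs \<boxdot> \<sigma> r \<boxdot> S_word (take ?n ps)"
  have sub: "set (take ?n ps) \<subseteq> mcar P" "set (drop ?n ps) \<subseteq> mcar P"
    using word(3) set_take_subset[of ?n ps] set_drop_subset[of ?n ps] by auto
  have "x = ?y \<boxdot> S_word (drop ?n ps)"
    using word sub S_word_append[OF sub] by (simp add: mul_assoc)
  moreover have "?y \<in> component 0"
    by (rule word_component) (use sub(1) word in auto)
  ultimately show thesis using word(4) sub(2) that[of "drop ?n ps" ?y] by simp
qed

lemma component_pos_subset: "component (1 + int k) \<subseteq> prod_set B (T ` mcar Q) (component (int k))"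
proof (rule component_least)
  show "is_addsub B (prod_set B (T ` mcar Q) (component (int k)))"
    by (rule is_addsub_prod_set[OF _ component_subset]) auto
  fix x assume "monomial (1 + int k) x"
  then have "monomial (int (Suc k)) x" by simp
  then obtain qs y where word: "set qs \<subseteq> mcar Q" "length qs = Suc k" "y \<in> component 0"
    "x = T_word qs \<boxdot> y"
    by (rule monomial_nonneg)
  then obtain q qs' where qs: "qs = q # qs'" by (cases qs) auto
  have "T_word qs' \<boxdot> y \<in> component (int k)"
    using component_mul[OF T_word_component word(3), of qs'] word qs by simp
  moreover have "x = T q \<boxdot> (T_word qs' \<boxdot> y)" using word qs by (simp add: mul_assoc component_closed)
  ultimately show "x \<in> prod_set B (T ` mcar Q) (component (int k))" using word(1) qs
    by (simp add: prod_setI)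
qed

lemma component_neg_subset: "component (- 1 - int k) \<subseteq> prod_set B (component (- int k)) (S ` mcar P)"
proof (rule component_least)
  show "is_addsub B (prod_set B (component (- int k)) (S ` mcar P))"
    by (rule is_addsub_prod_set[OF component_subset]) auto
  fix x assume "monomial (- 1 - int k) x"
  then have "monomial (- int (Suc k)) x" by simp
  then obtain y ps where word: "set ps \<subseteq> mcar P" "length ps = Suc k" "y \<in> component 0"
    "x = y \<boxdot> S_word ps"
    by (rule monomial_nonpos)
  then obtain p ps' where ps: "ps = ps' @ [p]" by (cases ps rule: rev_cases) auto
  have "y \<boxdot> S_word ps' \<in> component (- int k)"
    using component_mul[OF word(3) S_word_component, of ps'] word ps by simp
  moreover have "x = y \<boxdot> S_word ps' \<boxdot> S p"
    using word ps by (simp add: mul_assoc component_closed S_word_append generators_mul_one)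
  ultimately show "x \<in> prod_set B (component (- int k)) (S ` mcar P)" using word(1) ps
    by (simp add: prod_setI)
qed

subsection \<open>Semi-fullness\<close>

lemma sigma_psik:
  assumes "set ps \<subseteq> mcar P" "set qs \<subseteq> mcar Q" "length ps = length qs" "ps \<noteq> []"
  shows "psik psi (ract P) ps qs \<in> rcarrier R \<and> \<sigma> (psik psi (ract P) ps qs) = S_word ps \<boxdot> T_word qs"
  using assms
proof (induction ps arbitrary: qs rule: induct_list012)
  case (2 p)
  then obtain q where "qs = [q]" by (cases qs) auto
  then show ?case using 2 by (simp add: sigma_psi generators_mul_one)
next
  case (3 p p' ps)
  then obtain qs' q where qs: "qs = qs' @ [q]" by (cases qs rule: rev_cases) auto
  let ?r = "psik psi (ract P) (p' # ps) qs'"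
  have IH: "?r \<in> rcarrier R" "\<sigma> ?r = S_word (p' # ps) \<boxdot> T_word qs'" using 3 qs by auto
  have "\<sigma> (psi (ract P p ?r) q) = S p \<boxdot> \<sigma> ?r \<boxdot> T q"
    using 3 qs IH(1) by (simp add: sigma_psi S_ract)
  also have "\<dots> = S_word (p # p' # ps) \<boxdot> T_word qs"
    using 3 qs by (simp add: IH(2) T_word_append generators_mul_one mul_assoc)
  finally show ?case using 3 qs IH(1) by simp
qed auto

lemma word_product_in_sigma_psi_vals:
  assumes "set ps \<subseteq> mcar P" "set qs \<subseteq> mcar Q" "length ps = k" "length qs = k"
  shows "S_word ps \<boxdot> T_word qs \<in> \<sigma> ` psi_vals R P Q psi k"
proof (cases "k = 0")
  case True
  have "\<sigma> u \<in> \<sigma> ` psi_vals R P Q psi 0"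
    by (auto simp: psi_vals_def intro!: imageI exI[of _ u])
  then show ?thesis using assms True by (simp add: generators_mul_one)
next
  case False
  then have "psik psi (ract P) ps qs \<in> psi_vals R P Q psi k" using assms by (auto simp: psi_vals_def)
  moreover have "\<sigma> (psik psi (ract P) ps qs) = S_word ps \<boxdot> T_word qs"
    using sigma_psik[of ps qs] assms False by auto
  ultimately show ?thesis by (metis imageI)
qed

lemma sigma_psi_vals_subset:
  "\<sigma> ` psi_vals R P Q psi k \<subseteq> prod_set B (component (- int k)) (component (int k))"
proof (cases "k = 0")
  case True
  then show ?thesis
    by (auto simp: psi_vals_def sigma.map_mul intro!: prod_setI generators_in_component)
next
  case False
  have "\<sigma> (psik psi (ract P) ps qs) \<in> prod_set B (component (- int k)) (component (int k))"
    if "set ps \<subseteq> mcar P" "set qs \<subseteq> mcar Q" "length ps = k" "length qs = k" for ps qs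
    using that False sigma_psik[of ps qs] prod_setI[OF S_word_component T_word_component, of ps qs]
    by auto
  then show ?thesis using False by (auto simp: psi_vals_def)
qed

theorem semi_full:
  "prod_set B (component (- int k)) (component (int k)) =
     ideal_gen (degree_zero B component) (\<sigma> ` psi_vals R P Q psi k)"
  (is "?I = ?H")
proof
  show "?H \<subseteq> ?I"
    using ideal_gen_least[OF is_ideal_prod_set[of "- int k"]] sigma_psi_vals_subset by simp
  interpret B0: nuring "degree_zero B component" by (rule nuring_degree_zero)
  have "\<sigma> ` psi_vals R P Q psi k \<subseteq> component 0"
    using sigma_psi_vals_subset[of k] prod_set_component_subset[of "- int k" "int k"] by auto
  then have H: "is_ideal (degree_zero B component) ?H" by (intro B0.is_ideal_ideal_gen) simp
  then have H_addsub: "is_addsub B ?H"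
    using component_subset[of 0] by (auto simp: is_ideal_def is_addsub_def)
  show "?I \<subseteq> ?H"
  proof (rule prod_set_least[OF H_addsub], rule component_mul_mapI[OF _ _ H_addsub])
    fix x y assume "monomial (- int k) x" "monomial (int k) y"
    obtain a ps where ps: "set ps \<subseteq> mcar P" "length ps = k" and a: "a \<in> component 0" "x = a \<boxdot> S_word ps"
      by (rule monomial_nonpos[OF \<open>monomial (- int k) x\<close>])
    obtain qs b where qs: "set qs \<subseteq> mcar Q" "length qs = k" and b: "b \<in> component 0" "y = T_word qs \<boxdot> b"
      by (rule monomial_nonneg[OF \<open>monomial (int k) y\<close>])
    have "S_word ps \<boxdot> T_word qs \<in> ?H"
      by (rule subsetD[OF subset_ideal_gen word_product_in_sigma_psi_vals[OF ps(1) qs(1) ps(2) qs(2)]])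
    then have "a \<boxdot> (S_word ps \<boxdot> T_word qs) \<boxdot> b \<in> ?H" using H a b by (simp add: is_ideal_def)
    then show "x \<boxdot> y \<in> ?H" using ps qs a b by (simp add: mul_assoc component_closed)
  qed
qed

subsection \<open>Condition (FS')\<close>

lemma FS'_has_left_unit:
  assumes "cond_FS' R P Q psi"
  shows "has_left_unit B component 1"
proof -
  obtain l where l: "set l \<subseteq> mcar Q \<times> mcar P" "\<And>q. q \<in> mcar Q \<Longrightarrow> theta_Q Q psi l q = q"
    using assms unfolding cond_FS'_def in_FPQ_iff by metis
  let ?e = "rsum_mul B (map (map_prod T S) l)"
  have e: "?e \<in> prod_set B (component 1) (component (- 1))"
    by (rule rsum_mul_in_prod_set[OF component_subset component_subset])
      (use l(1) generators_in_component in auto)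
  have "?e \<boxdot> x = x" if "x \<in> component 1" for x
  proof (rule left_identity_on_prod_set[OF _ prod_set_closed[OF e] _ component_subset])
    show "x \<in> prod_set B (T ` mcar Q) (component 0)" using component_pos_subset[of 0] that by auto
  qed (use sum_TS_mul_T[OF l(1)] l(2) in auto)
  then show ?thesis using e by (auto simp: has_left_unit_def)
qed

lemma FS'_has_right_unit:
  assumes "cond_FS' R P Q psi"
  shows "has_right_unit B component 1"
proof -
  obtain l where l: "set l \<subseteq> mcar P \<times> mcar Q" "\<And>p. p \<in> mcar P \<Longrightarrow> theta_P P psi l p = p"
    using assms unfolding cond_FS'_def in_FQP_iff by metis
  let ?e = "rsum_mul B (map (\<lambda>(p, q). (T q, S p)) l)"
  have e: "?e \<in> prod_set B (component 1) (component (- 1))"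
    by (rule rsum_mul_in_prod_set[OF component_subset component_subset])
      (use l(1) generators_in_component in auto)
  have "x \<boxdot> ?e = x" if "x \<in> component (- 1)" for x
  proof (rule right_identity_on_prod_set[OF _ prod_set_closed[OF e] component_subset])
    show "x \<in> prod_set B (component 0) (S ` mcar P)" using component_neg_subset[of 0] that by auto
  qed (use S_mul_sum_TS[OF l(1)] l(2) in auto)
  then show ?thesis using e by (auto simp: has_right_unit_def)
qed

theorem FS'_eps_strongly_graded:
  assumes FS': "cond_FS' R P Q psi"
    and unital: "\<And>k. unital_ideal B (prod_set B (component (- int k)) (component (int k)))"
  shows "eps_strongly_graded B component"
proof (rule eps_strongly_gradedI[OF _ _ unital])
  have "\<sigma> u \<in> prod_set B (component 0) (component 0)"
    using prod_setI[OF generators_in_component(1) generators_in_component(1), of u u]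
    by (simp add: generators_mul_one)
  then have zero: "has_left_unit B component 0" "has_right_unit B component 0"
    unfolding has_left_unit_def has_right_unit_def using one_mul mul_one
    by (auto intro!: bexI[of _ "\<sigma> u"])
  have "prod_set B (T ` mcar Q) (component (int k)) \<subseteq> prod_set B (component 1) (component (int k))" for k
    by (rule prod_set_mono) (use generators_in_component component_subset in auto)
  then show "has_left_unit B component (int k)" for k
    using component_pos_subset
    by (intro has_left_unit_nat[OF zero(1) FS'_has_left_unit[OF FS']]) blast
  have "prod_set B (component (- int k)) (S ` mcar P) \<subseteq>
      prod_set B (component (- int k)) (component (- 1))" for k
    by (rule prod_set_mono) (use generators_in_component component_subset in auto)
  then show "has_right_unit B component (int k)" for k
    using component_neg_subset
    by (intro has_right_unit_nat[OF zero(2) FS'_has_right_unit[OF FS']]) blast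
qed

end

section \<open>Relative Cuntz--Pimsner rings\<close>

locale J_covariant_rep = covariant_rep R P Q psi B \<sigma> S T
  for R :: "'r rng" and P :: "('r, 'p) bimod" and Q :: "('r, 'q) bimod" and psi :: "'p \<Rightarrow> 'q \<Rightarrow> 'r"
    and B :: "'b rng" (structure) and \<sigma> :: "'r \<Rightarrow> 'b" and S :: "'p \<Rightarrow> 'b" and T :: "'q \<Rightarrow> 'b" +
  fixes J :: "'r set"
  assumes J_subset: "J \<subseteq> rcarrier R"
    and sigma_J: "x \<in> J \<Longrightarrow> set l \<subseteq> mcar Q \<times> mcar P \<Longrightarrow> (\<And>y. y \<in> mcar Q \<Longrightarrow> lact Q x y = theta_Q Q psi l y) \<Longrightarrow>
      \<sigma> x = rsum_mul B (map (map_prod T S) l)"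

context R_system
begin

abbreviation "F \<equiv> FR R P Q"
abbreviation "TT \<equiv> toeplitz R P Q psi"
abbreviation "tR \<equiv> iotaR R P Q psi"
abbreviation "tP \<equiv> iotaP R P Q psi"
abbreviation "tQ \<equiv> iotaQ R P Q psi"

sublocale F: nuring F
  unfolding FR_def by (rule nuring_free_rng)

lemma free_gen_closed [simp]:
  "r \<in> rcarrier R \<Longrightarrow> gR r \<in> rcarrier F" "p \<in> mcar P \<Longrightarrow> gP p \<in> rcarrier F" "q \<in> mcar Q \<Longrightarrow> gQ q \<in> rcarrier F"
  unfolding FR_def gR_def gP_def gQ_def by (auto intro!: fr_gen_closed simp: gens_def)

lemma generates_FR: "generates F (gR ` rcarrier R \<union> gP ` mcar P \<union> gQ ` mcar Q)"
  using generates_free_rng[of "gens R P Q"]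
  unfolding FR_def gens_def gR_def gP_def gQ_def by (simp add: image_Un image_image Un_assoc)

lemma toep_rels_subset: "toep_rels R P Q psi \<subseteq> rcarrier F"
  unfolding toep_rels_def Let_def by (auto intro!: F.add_closed F.mul_closed F.neg_closed)

sublocale K: ring_ideal F "toep_ker R P Q psi"
  unfolding toep_ker_def by (rule F.ring_ideal_ideal_gen[OF toep_rels_subset])

sublocale TT: nuring TT
  unfolding toeplitz_def by (rule K.nuring_quot_rng)

lemma rhom_toep_coset: "rhom F TT (coset F (toep_ker R P Q psi))"
  unfolding toeplitz_def by (rule K.rhom_coset)

lemma toep_coset_eqI:
  "a \<in> rcarrier F \<Longrightarrow> b \<in> rcarrier F \<Longrightarrow> radd F a (rneg F b) \<in> toep_rels R P Q psi \<Longrightarrow>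
     coset F (toep_ker R P Q psi) a = coset F (toep_ker R P Q psi) b"
  by (subst K.coset_eq_iff) (auto simp: toep_ker_def intro: subsetD[OF subset_ideal_gen])

lemma covariant_rep_toeplitz: "covariant_rep R P Q psi TT tR tP tQ"
proof -
  interpret proj: rhom F TT "coset F (toep_ker R P Q psi)" by (rule rhom_toep_coset)
  show ?thesis
    unfolding iotaR_def iotaP_def iotaQ_def
    by unfold_locales
      (simp_all add: proj.map_closed flip: proj.map_add proj.map_mul,
       (rule toep_coset_eqI; (unfold toep_rels_def Let_def, blast | simp))+)
qed

lemma toeplitz_universal:
  assumes "covariant_rep R P Q psi C \<sigma> S T"
  obtains h where "rhom TT C h" "\<And>r. r \<in> rcarrier R \<Longrightarrow> h (tR r) = \<sigma> r"
    "\<And>p. p \<in> mcar P \<Longrightarrow> h (tP p) = S p" "\<And>q. q \<in> mcar Q \<Longrightarrow> h (tQ q) = T q"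
proof -
  interpret C: covariant_rep R P Q psi C \<sigma> S T by fact
  have "case_sum \<sigma> (case_sum S T) x \<in> rcarrier C" if "x \<in> gens R P Q" for x
    using that by (auto simp: gens_def)
  then obtain \<phi> where \<phi>: "rhom F C \<phi>" "\<And>x. x \<in> gens R P Q \<Longrightarrow> \<phi> (fr_gen x) = case_sum \<sigma> (case_sum S T) x"
    using free_rng_universal[OF C.nuring_axioms] unfolding FR_def by blast
  interpret \<phi>: rhom F C \<phi> by fact
  have \<phi>_gen: "r \<in> rcarrier R \<Longrightarrow> \<phi> (gR r) = \<sigma> r" "p \<in> mcar P \<Longrightarrow> \<phi> (gP p) = S p"
    "q \<in> mcar Q \<Longrightarrow> \<phi> (gQ q) = T q" for r p q
    using \<phi>(2)[of "Inl r"] \<phi>(2)[of "Inr (Inl p)"] \<phi>(2)[of "Inr (Inr q)"]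
    by (auto simp: gens_def gR_def gP_def gQ_def)
  have "\<phi> x = rzero C" if "x \<in> toep_rels R P Q psi" for x
    using that unfolding toep_rels_def Let_def
    by (auto simp: \<phi>_gen \<phi>.map_add \<phi>.map_neg \<phi>.map_mul C.sigma.map_add C.sigma.map_mul C.S_add C.T_add
        C.S_ract C.S_lact C.T_ract C.T_lact C.sigma_psi)
  then obtain h where "rhom TT C h" "\<And>a. a \<in> rcarrier F \<Longrightarrow> h (coset F (toep_ker R P Q psi) a) = \<phi> a"
    using \<phi>.quot_ideal_gen_universal[OF toep_rels_subset] unfolding toeplitz_def toep_ker_def by blast
  then show thesis
    using that \<phi>_gen by (simp add: iotaR_def iotaP_def iotaQ_def)
qed

lemma generates_toeplitz: "generates TT (tR ` rcarrier R \<union> tP ` mcar P \<union> tQ ` mcar Q)"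
proof -
  have "rcarrier TT = coset F (toep_ker R P Q psi) ` rcarrier F" by (simp add: toeplitz_def)
  then show ?thesis
    using generates_image[OF rhom_toep_coset _ generates_FR]
    by (simp add: image_Un image_image iotaR_def iotaP_def iotaQ_def)
qed

end

locale relative_cp = R_system R P Q psi
  for R :: "'r rng" and P :: "('r, 'p) bimod" and Q :: "('r, 'q) bimod" and psi :: "'p \<Rightarrow> 'q \<Rightarrow> 'r" +
  fixes J :: "'r set"
  assumes J: "J \<subseteq> rcarrier R"
begin

abbreviation "B \<equiv> rel_cp R P Q psi J"
abbreviation "\<rho> \<equiv> rel_rho R P Q psi J"
abbreviation "\<sigma> r \<equiv> \<rho> (tR r)"
abbreviation "S p \<equiv> \<rho> (tP p)"
abbreviation "T q \<equiv> \<rho> (tQ q)"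

interpretation toep: covariant_rep R P Q psi TT tR tP tQ
  by (rule covariant_rep_toeplitz)

lemma TJ_gens_eq:
  "TJ_gens R P Q psi J = {radd TT (tR x) (rneg TT (rsum_mul TT (map (map_prod tQ tP) l))) | x l.
     x \<in> J \<and> set l \<subseteq> mcar Q \<times> mcar P \<and> (\<forall>y\<in>mcar Q. lact Q x y = theta_Q Q psi l y)}"
  by (simp add: TJ_gens_def Let_def rsum_mul_def theta_Q_def comp_def case_prod_unfold)

lemma toep_sum_closed: "set l \<subseteq> mcar Q \<times> mcar P \<Longrightarrow> rsum_mul TT (map (map_prod tQ tP) l) \<in> rcarrier TT"
  by (rule TT.rsum_mul_closed) auto

lemma TJ_gens_subset: "TJ_gens R P Q psi J \<subseteq> rcarrier TT"
  unfolding TJ_gens_eq using J by (auto intro!: TT.add_closed TT.neg_closed toep_sum_closed)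

interpretation TJ: ring_ideal TT "TJ R P Q psi J"
  unfolding TJ_def by (rule TT.ring_ideal_ideal_gen[OF TJ_gens_subset])

lemma rhom_rho: "rhom TT B \<rho>"
  unfolding rel_cp_def rel_rho_def by (rule TJ.rhom_coset)

sublocale J_covariant_rep R P Q psi B \<sigma> S T J
proof -
  interpret covariant_rep R P Q psi B \<sigma> S T by (rule toep.covariant_rep_compose[OF rhom_rho])
  interpret \<rho>: rhom TT B \<rho> by (rule rhom_rho)
  show "J_covariant_rep R P Q psi B \<sigma> S T J"
  proof unfold_locales
    fix x l assume x: "x \<in> J" and l: "set l \<subseteq> mcar Q \<times> mcar P"
      and theta: "\<And>y. y \<in> mcar Q \<Longrightarrow> lact Q x y = theta_Q Q psi l y"
    let ?l = "map (map_prod tQ tP) l"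
    have "radd TT (tR x) (rneg TT (rsum_mul TT ?l)) \<in> TJ R P Q psi J"
      unfolding TJ_def
      by (rule subsetD[OF subset_ideal_gen]) (use x l theta in \<open>auto simp: TJ_gens_eq\<close>)
    then have "\<rho> (tR x) = \<rho> (rsum_mul TT ?l)"
      unfolding rel_rho_def using x J toep_sum_closed[OF l] by (subst TJ.coset_eq_iff) auto
    also have "\<dots> = rsum_mul B (map (map_prod \<rho> \<rho>) ?l)"
      by (rule \<rho>.map_rsum_mul) (use l in auto)
    finally show "\<sigma> x = rsum_mul B (map (map_prod T S) l)"
      by (simp add: prod.map_comp comp_def)
  qed (rule J)
qed

lemma rel_cp_universal:
  assumes "J_covariant_rep R P Q psi C \<sigma>' S' T' J"
  obtains h where "rhom B C h" "\<And>r. r \<in> rcarrier R \<Longrightarrow> h (\<sigma> r) = \<sigma>' r"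
    "\<And>p. p \<in> mcar P \<Longrightarrow> h (S p) = S' p" "\<And>q. q \<in> mcar Q \<Longrightarrow> h (T q) = T' q"
proof -
  interpret C: J_covariant_rep R P Q psi C \<sigma>' S' T' J by fact
  obtain k where k: "rhom TT C k" and k_gen: "\<And>r. r \<in> rcarrier R \<Longrightarrow> k (tR r) = \<sigma>' r"
    "\<And>p. p \<in> mcar P \<Longrightarrow> k (tP p) = S' p" "\<And>q. q \<in> mcar Q \<Longrightarrow> k (tQ q) = T' q"
    using toeplitz_universal[OF C.covariant_rep_axioms] by blast
  interpret k: rhom TT C k by fact
  have "k (radd TT (tR x) (rneg TT (rsum_mul TT (map (map_prod tQ tP) l)))) = rzero C"
    if x: "x \<in> J" and l: "set l \<subseteq> mcar Q \<times> mcar P"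
      and theta: "\<forall>y\<in>mcar Q. lact Q x y = theta_Q Q psi l y" for x l
  proof -
    have "k (rsum_mul TT (map (map_prod tQ tP) l)) =
        rsum_mul C (map (map_prod k k) (map (map_prod tQ tP) l))"
      by (rule k.map_rsum_mul) (use l in auto)
    also have "map (map_prod k k) (map (map_prod tQ tP) l) = map (map_prod T' S') l"
      using l k_gen by auto
    also have "rsum_mul C \<dots> = \<sigma>' x" using C.sigma_J[OF x l] theta by simp
    finally have "k (rsum_mul TT (map (map_prod tQ tP) l)) = \<sigma>' x" .
    then show ?thesis
      using x J toep_sum_closed[OF l] by (auto simp: k.map_add k.map_neg k_gen subset_iff)
  qed
  then have "k z = rzero C" if "z \<in> TJ_gens R P Q psi J" for z using that unfolding TJ_gens_eq
    by blast
  then obtain h where "rhom B C h" "\<And>a. a \<in> rcarrier TT \<Longrightarrow> h (\<rho> a) = k a"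
    using k.quot_ideal_gen_universal[OF TJ_gens_subset] unfolding rel_cp_def rel_rho_def TJ_def
    by blast
  then show thesis using that k_gen by simp
qed

lemma generates_rel_cp: "generates B (\<sigma> ` rcarrier R \<union> S ` mcar P \<union> T ` mcar Q)"
proof -
  have "rcarrier B = \<rho> ` rcarrier TT" by (simp add: rel_cp_def rel_rho_def)
  then show ?thesis
    using generates_image[OF rhom_rho _ generates_toeplitz] by (simp add: image_Un image_image)
qed

lemma rel_cp_grading_eq_component: "rel_cp_grading R P Q psi J i = component i"
proof -
  have "toep_monos R P Q psi i = Collect (toep.monomial i)"
    unfolding toep_monos_def Let_def toep.monomials_eq_rprods by simp
  then have "toep_grading R P Q psi i = toep.component i"
    by (simp add: toep_grading_def toep.component_def)
  then show ?thesis
    by (simp add: rel_cp_grading_def toep.component_image[OF rhom_rho])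
qed

end

lemma relative_cp_cp_ideal:
  assumes "rsystem R P Q psi" "cp_well_defined R P Q psi"
  shows "relative_cp R P Q psi (cp_ideal R P Q psi)"
proof -
  have "max_cf_ideal R P Q psi (cp_ideal R P Q psi)"
    using theI'[OF assms(2)[unfolded cp_well_defined_def]] unfolding cp_ideal_def .
  then show ?thesis
    using assms(1) by unfold_locales (auto simp: max_cf_ideal_def psi_compatible_def is_ideal_def)
qed

lemma (in relative_cp)
  assumes "cp_ideal R P Q psi = J"
  shows cp_ring_eq: "cp_ring R P Q psi = B"
    and cp_grading_eq: "cp_grading R P Q psi = component"
    and cp_Ik_eq: "cp_Ik R P Q psi k = ideal_gen (degree_zero B component) (\<sigma> ` psi_vals R P Q psi k)"
  using assms rel_cp_grading_eq_component
  by (auto simp: cp_ring_def cp_grading_def cp_Ik_def degree_zero_def cp_iotaR_def)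

theorem unital_FS'_eps_strongly_graded:
  assumes "rsystem R P Q psi" "cp_well_defined R P Q psi" "unital_system R P Q" "cond_FS' R P Q psi"
    and unital: "\<And>k. unital_ideal (cp_ring R P Q psi) (cp_Ik R P Q psi k)"
  shows "eps_strongly_graded (cp_ring R P Q psi) (cp_grading R P Q psi)"
proof -
  interpret relative_cp R P Q psi "cp_ideal R P Q psi" by (rule relative_cp_cp_ideal) fact+
  obtain u where "unital_covariant_rep R P Q psi B \<sigma> S T u"
    using unital_system_obtain_unit[OF assms(3)] by blast
  then interpret unital_covariant_rep R P Q psi B \<sigma> S T u .
  have "eps_strongly_graded B component"
    by (rule FS'_eps_strongly_graded[OF assms(4)])
      (use unital in \<open>simp add: semi_full cp_ring_eq cp_Ik_eq\<close>)
  then show ?thesis by (simp add: cp_ring_eq cp_grading_eq)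
qed

section \<open>Epsilon-strongly graded rings as Cuntz--Pimsner rings\<close>

definition component_bimod :: "'a rng \<Rightarrow> (int \<Rightarrow> 'a set) \<Rightarrow> int \<Rightarrow> ('a, 'a) bimod" where
  "component_bimod A G i =
     \<lparr>mcar = G i, madd = radd A, mzero = rzero A, mneg = rneg A, lact = rmul A, ract = rmul A\<rparr>"

lemma component_bimod_simps [simp]:
  "mcar (component_bimod A G i) = G i" "madd (component_bimod A G i) = radd A"
  "mzero (component_bimod A G i) = rzero A" "mneg (component_bimod A G i) = rneg A"
  "lact (component_bimod A G i) = rmul A" "ract (component_bimod A G i) = rmul A"
  by (simp_all add: component_bimod_def)

context graded_rng
begin

abbreviation "A\<^sub>0 \<equiv> degree_zero A G"
abbreviation "M \<equiv> component_bimod A G"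

lemma bimodule_component: "bimodule A\<^sub>0 (M i)"
proof -
  have "x \<boxdot> y \<in> G i" "y \<boxdot> x \<in> G i" if "x \<in> G 0" "y \<in> G i" for x y
    using component_mul[OF that] component_mul[OF that(2,1)] by simp_all
  with is_addsubD[OF component_addsub] show ?thesis
    unfolding bimodule_def
    by (simp add: component_closed add_ac distrib_left distrib_right mul_assoc)
qed

lemma rsystem_components: "rsystem A\<^sub>0 (M (- 1)) (M 1) (rmul A)"
proof -
  have "nu_ring A\<^sub>0" using nuring_degree_zero by (rule nuring.nu_ring)
  then show ?thesis
    unfolding rsystem_def
    by (simp add: bimodule_component component_closed component_mulI distrib_left distrib_right mul_assoc)
qed

lemma theta_components:
  assumes "set l \<subseteq> G 1 \<times> G (- 1)"
  shows "x \<in> G 1 \<Longrightarrow> theta_Q (M 1) (rmul A) l x = rsum_mul A l \<boxdot> x"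
    and "y \<in> G (- 1) \<Longrightarrow> theta_P (M (- 1)) (rmul A) (map prod.swap l) y = y \<boxdot> rsum_mul A l"
proof -
  have closed: "set l \<subseteq> rcarrier A \<times> rcarrier A" using assms component_closed by blast
  show "x \<in> G 1 \<Longrightarrow> theta_Q (M 1) (rmul A) l x = rsum_mul A l \<boxdot> x"
    using closed
    by (induction l) (auto simp: component_closed rsum_mul_closed distrib_right mul_assoc)
  show "y \<in> G (- 1) \<Longrightarrow> theta_P (M (- 1)) (rmul A) (map prod.swap l) y = y \<boxdot> rsum_mul A l"
    using closed by (induction l) (auto simp: component_closed rsum_mul_closed distrib_left mul_assoc)
qed

end

context eps_graded_rng
begin

abbreviation "I \<equiv> prod_set A (G 1) (G (- 1))"

lemma eps_one_in: "\<epsilon> 1 \<in> I"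
  using eps_in[of 1] by simp

lemma prod_set_obtain_sum:
  assumes "z \<in> I"
  obtains l where "set l \<subseteq> G 1 \<times> G (- 1)" "z = rsum_mul A l"
  using prod_set_obtain_list[OF component_addsub component_subset assms] .

lemma unital_system_components: "unital_system A\<^sub>0 (M (- 1)) (M 1)"
  unfolding unital_system_def unital_rng_def unital_bimod_def
  using eps_degree_zero[of 0] eps_zero_mul mul_eps_zero by (auto intro!: bexI[of _ "\<epsilon> 0"])

lemma cond_FS'_components: "cond_FS' A\<^sub>0 (M (- 1)) (M 1) (rmul A)"
proof -
  obtain l where l: "set l \<subseteq> G 1 \<times> G (- 1)" "\<epsilon> 1 = rsum_mul A l"
    using prod_set_obtain_sum[OF eps_one_in] .
  have "in_FPQ A\<^sub>0 (M (- 1)) (M 1) (rmul A) (rmul A (\<epsilon> 1))"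
    unfolding in_FPQ_iff using l theta_components(1)[OF l(1)] by (intro exI[of _ l]) auto
  moreover have "in_FQP A\<^sub>0 (M (- 1)) (M 1) (rmul A) (\<lambda>y. y \<boxdot> \<epsilon> 1)"
    unfolding in_FQP_iff using l theta_components(2)[OF l(1)]
    by (intro exI[of _ "map prod.swap l"]) auto
  ultimately show ?thesis
    unfolding cond_FS'_def using eps_mul[of _ 1] mul_eps[of _ 1] by fastforce
qed

lemma psi_compatible_I: "psi_compatible A\<^sub>0 (M (- 1)) (M 1) (rmul A) I"
  unfolding psi_compatible_def
proof (intro conjI ballI)
  show "is_ideal A\<^sub>0 I" using is_ideal_prod_set[of 1] by simp
  fix x assume "x \<in> I"
  then obtain l where l: "set l \<subseteq> G 1 \<times> G (- 1)" "x = rsum_mul A l" by (rule prod_set_obtain_sum)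
  then show "in_FPQ A\<^sub>0 (M (- 1)) (M 1) (rmul A) (lact (M 1) x)"
    unfolding in_FPQ_iff using theta_components(1)[OF l(1)] by (intro exI[of _ l]) auto
qed

lemma I_eqI:
  assumes x: "x \<in> I" and y: "y \<in> I" and eq: "\<And>q. q \<in> G 1 \<Longrightarrow> x \<boxdot> q = y \<boxdot> q"
  shows "x = y"
proof -
  have "x \<boxdot> \<epsilon> 1 = y \<boxdot> \<epsilon> 1"
    by (rule addhom_eq_on_prod_set[OF eps_one_in component_subset component_subset
          addhom_mul_left[OF prod_set_closed[OF x]] addhom_mul_left[OF prod_set_closed[OF y]]])
      (simp add: eq prod_set_closed[OF x] prod_set_closed[OF y] component_closed flip: mul_assoc)
  then show ?thesis using prod_set_mul_eps[of _ 1] x y by simp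
qed

lemma faithful_ideal_I: "faithful_ideal A\<^sub>0 (M 1) I"
  unfolding faithful_ideal_def
  using I_eqI is_addsubD(2)[OF is_addsub_prod_set_component] by (auto simp: component_closed)

text \<open>For \<open>x\<close> in a faithful ideal, \<open>x - x\<epsilon>\<^sub>1\<close> lies in that ideal and annihilates \<open>A\<^sub>1\<close>.\<close>

lemma faithful_ideal_subset_I:
  assumes L: "is_ideal A\<^sub>0 L" "faithful_ideal A\<^sub>0 (M 1) L"
  shows "L \<subseteq> I"
proof
  fix x assume x: "x \<in> L"
  note L_closed = L(1)[unfolded is_ideal_def, simplified]
  have x_degree_zero: "x \<in> G 0" using L_closed x by auto
  note closed = component_closed[OF x_degree_zero] component_closed[OF eps_degree_zero]
  have "x \<boxplus> \<boxminus> (x \<boxdot> \<epsilon> 1) \<in> L" using L_closed x eps_degree_zero by simp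
  moreover have "(x \<boxplus> \<boxminus> (x \<boxdot> \<epsilon> 1)) \<boxdot> q = rzero A" if "q \<in> G 1" for q
    using that closed by (simp add: distrib_right neg_mul mul_assoc component_closed eps_mul)
  ultimately have "x \<boxplus> \<boxminus> (x \<boxdot> \<epsilon> 1) = rzero A" using L(2) by (simp add: faithful_ideal_def)
  then have "x = x \<boxdot> \<epsilon> 1" using closed by (simp add: diff_eq_iff)
  moreover have "x \<boxdot> \<epsilon> 1 \<in> I"
    using is_ideal_prod_set[of 1] eps_one_in x_degree_zero by (simp add: is_ideal_def)
  ultimately show "x \<in> I" by simp
qed

lemma max_cf_ideal_iff: "max_cf_ideal A\<^sub>0 (M (- 1)) (M 1) (rmul A) L \<longleftrightarrow> L = I"
proof
  assume L: "max_cf_ideal A\<^sub>0 (M (- 1)) (M 1) (rmul A) L"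
  then have "L \<subseteq> I" using faithful_ideal_subset_I by (auto simp: max_cf_ideal_def psi_compatible_def)
  then show "L = I" using L psi_compatible_I faithful_ideal_I by (auto simp: max_cf_ideal_def)
next
  assume "L = I"
  then show "max_cf_ideal A\<^sub>0 (M (- 1)) (M 1) (rmul A) L"
    using psi_compatible_I faithful_ideal_I faithful_ideal_subset_I
    by (auto simp: max_cf_ideal_def psi_compatible_def)
qed

lemma cp_well_defined_components: "cp_well_defined A\<^sub>0 (M (- 1)) (M 1) (rmul A)"
  and cp_ideal_components: "cp_ideal A\<^sub>0 (M (- 1)) (M 1) (rmul A) = I"
  by (simp_all add: cp_well_defined_def cp_ideal_def max_cf_ideal_iff)

sublocale CP: relative_cp A\<^sub>0 "M (- 1)" "M 1" "rmul A" I
  using rsystem_components prod_set_degree_zero[of _ 1] by unfold_locales auto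

sublocale CP: unital_covariant_rep A\<^sub>0 "M (- 1)" "M 1" "rmul A" CP.B CP.\<sigma> CP.S CP.T "\<epsilon> 0"
  by unfold_locales (simp_all add: eps_degree_zero eps_zero_mul mul_eps_zero)

lemmas cp_components_eq =
  CP.cp_ring_eq[OF cp_ideal_components] CP.cp_grading_eq[OF cp_ideal_components]
  CP.cp_Ik_eq[OF cp_ideal_components]

lemma semi_full_components: "cp_semi_full A\<^sub>0 (M (- 1)) (M 1) (rmul A)"
  unfolding cp_semi_full_def cp_components_eq using CP.semi_full by blast

lemma CP_sigma_sum:
  assumes l: "set l \<subseteq> G 1 \<times> G (- 1)"
  shows "CP.\<sigma> (rsum_mul A l) = rsum_mul CP.B (map (map_prod CP.T CP.S) l)"
  by (rule CP.sigma_J[OF rsum_mul_in_prod_set[OF component_subset component_subset l]])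
    (use l theta_components(1)[OF l] in simp_all)

lemma CP_T_mul_S: "q \<in> G 1 \<Longrightarrow> p \<in> G (- 1) \<Longrightarrow> rmul CP.B (CP.T q) (CP.S p) = CP.\<sigma> (q \<boxdot> p)"
  using CP_sigma_sum[of "[(q, p)]"] by (simp add: component_closed)

lemma CP_balanced_word_in_sigma:
  assumes "set qs \<subseteq> G 1" "r \<in> G 0" "set ps \<subseteq> G (- 1)" "length qs = length ps"
  shows "rmul CP.B (rmul CP.B (CP.T_word qs) (CP.\<sigma> r)) (CP.S_word ps) \<in> CP.\<sigma> ` G 0"
  using assms
proof (induction qs arbitrary: ps)
  case Nil
  then show ?case by (simp add: CP.one_mul_generators CP.generators_mul_one)
next
  case (Cons q qs)
  then obtain p ps' where ps: "ps = ps' @ [p]" by (cases ps rule: rev_cases) auto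
  let ?inner = "rmul CP.B (rmul CP.B (CP.T_word qs) (CP.\<sigma> r)) (CP.S_word ps')"
  obtain s where s: "s \<in> G 0" "?inner = CP.\<sigma> s" using Cons.IH[of ps'] Cons.prems ps by auto
  have "rmul CP.B (rmul CP.B (CP.T_word (q # qs)) (CP.\<sigma> r)) (CP.S_word ps)
      = rmul CP.B (CP.T q) (rmul CP.B ?inner (CP.S p))"
    using Cons.prems ps by (simp add: CP.S_word_append CP.generators_mul_one CP.mul_assoc)
  also have "\<dots> = CP.\<sigma> (q \<boxdot> (s \<boxdot> p))"
    using Cons.prems ps s component_mul[of s 0 p "- 1"] CP.S_lact[of p s, symmetric]
    by (simp add: CP_T_mul_S)
  finally show ?case
    using Cons.prems ps s(1) component_mul[of s 0 p "- 1"] by (auto intro!: component_mulI)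
qed

lemma CP_component_zero_subset: "CP.component 0 \<subseteq> CP.\<sigma> ` G 0"
proof (rule CP.component_least)
  show "is_addsub CP.B (CP.\<sigma> ` G 0)" using CP.sigma.is_addsub_image[OF CP.R.is_addsub_carrier] by simp
  fix x assume "CP.monomial 0 x"
  then show "x \<in> CP.\<sigma> ` G 0" by (rule CP.monomial_eq_word) (auto intro: CP_balanced_word_in_sigma)
qed

lemma CP_component_one_subset: "CP.component 1 \<subseteq> CP.T ` G 1"
proof (rule CP.component_least)
  show "is_addsub CP.B (CP.T ` G 1)"
    using addhom.is_addsub_image[OF CP.addhom_T CP.Q.is_addsub_carrier] by simp
  fix x assume "CP.monomial 1 x"
  then obtain qs r ps where word: "set qs \<subseteq> G 1" "r \<in> G 0" "set ps \<subseteq> G (- 1)"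
    "length qs = Suc (length ps)" "x = rmul CP.B (rmul CP.B (CP.T_word qs) (CP.\<sigma> r)) (CP.S_word ps)"
    by (rule CP.monomial_eq_word) auto
  then obtain q qs' where qs: "qs = q # qs'" by (cases qs) auto
  then obtain s where s: "s \<in> G 0"
    "rmul CP.B (rmul CP.B (CP.T_word qs') (CP.\<sigma> r)) (CP.S_word ps) = CP.\<sigma> s"
    using word CP_balanced_word_in_sigma[of qs' r ps] by auto
  have "x = rmul CP.B (CP.T q) (CP.\<sigma> s)" using word qs s(2) by (simp add: CP.mul_assoc)
  then show "x \<in> CP.T ` G 1" using word qs s(1) CP.T_ract[of q s] component_mul[of q 1 s 0] by auto
qed

lemma CP_component_minus_one_subset: "CP.component (- 1) \<subseteq> CP.S ` G (- 1)"
proof (rule CP.component_least)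
  show "is_addsub CP.B (CP.S ` G (- 1))"
    using addhom.is_addsub_image[OF CP.addhom_S CP.P.is_addsub_carrier] by simp
  fix x assume "CP.monomial (- 1) x"
  then obtain qs r ps where word: "set qs \<subseteq> G 1" "r \<in> G 0" "set ps \<subseteq> G (- 1)"
    "length ps = Suc (length qs)" "x = rmul CP.B (rmul CP.B (CP.T_word qs) (CP.\<sigma> r)) (CP.S_word ps)"
    by (rule CP.monomial_eq_word) auto
  then obtain p ps' where ps: "ps = ps' @ [p]" by (cases ps rule: rev_cases) auto
  then obtain s where s: "s \<in> G 0"
    "rmul CP.B (rmul CP.B (CP.T_word qs) (CP.\<sigma> r)) (CP.S_word ps') = CP.\<sigma> s"
    using word CP_balanced_word_in_sigma[of qs r ps'] by auto
  have "x = rmul CP.B (rmul CP.B (rmul CP.B (CP.T_word qs) (CP.\<sigma> r)) (CP.S_word ps')) (CP.S p)"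
    using word ps by (simp add: CP.S_word_append CP.generators_mul_one CP.mul_assoc)
  then show "x \<in> CP.S ` G (- 1)" using word ps s CP.S_lact[of p s] component_mul[of s 0 p "- 1"]
    by auto
qed

lemma CP_inclusion_hom:
  obtains h where "rhom CP.B A h" "\<And>r. r \<in> G 0 \<Longrightarrow> h (CP.\<sigma> r) = r"
    "\<And>p. p \<in> G (- 1) \<Longrightarrow> h (CP.S p) = p" "\<And>q. q \<in> G 1 \<Longrightarrow> h (CP.T q) = q"
proof -
  have "J_covariant_rep A\<^sub>0 (M (- 1)) (M 1) (rmul A) A (\<lambda>r. r) (\<lambda>p. p) (\<lambda>q. q) I"
  proof unfold_locales
    fix x l assume x: "x \<in> I" and "set l \<subseteq> mcar (M 1) \<times> mcar (M (- 1))"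
      and theta: "\<And>y. y \<in> mcar (M 1) \<Longrightarrow> lact (M 1) x y = theta_Q (M 1) (rmul A) l y"
    then have l: "set l \<subseteq> G 1 \<times> G (- 1)" by simp
    have "x = rsum_mul A l"
      by (rule I_eqI[OF x rsum_mul_in_prod_set[OF component_subset component_subset l]])
        (use theta theta_components(1)[OF l] in simp)
    then show "x = rsum_mul A (map (map_prod (\<lambda>q. q) (\<lambda>p. p)) l)" by (simp add: map_prod.identity)
  qed (simp_all add: component_closed prod_set_degree_zero[of _ 1] subsetI)
  then obtain h where "rhom CP.B A h" "\<And>r. r \<in> rcarrier A\<^sub>0 \<Longrightarrow> h (CP.\<sigma> r) = r"
    "\<And>p. p \<in> mcar (M (- 1)) \<Longrightarrow> h (CP.S p) = p" "\<And>q. q \<in> mcar (M 1) \<Longrightarrow> h (CP.T q) = q"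
    using CP.rel_cp_universal by blast
  then show thesis using that[of h] by simp
qed

lemma gr_iso_CP:
  assumes gens: "X \<subseteq> G 0" "Y \<subseteq> G (- 1)" "Z \<subseteq> G 1" "generates A (X \<union> Y \<union> Z)"
    and f: "rhom A CP.B f" "\<And>i. f ` G i \<subseteq> CP.component i"
    and f_gen: "\<And>r. r \<in> X \<Longrightarrow> f r = CP.\<sigma> r" "\<And>p. p \<in> Y \<Longrightarrow> f p = CP.S p" "\<And>q. q \<in> Z \<Longrightarrow> f q = CP.T q"
  shows "gr_iso A G CP.B CP.component"
proof -
  interpret f: rhom A CP.B f by fact
  obtain h where h: "rhom CP.B A h" and h_gen: "\<And>r. r \<in> G 0 \<Longrightarrow> h (CP.\<sigma> r) = r"
    "\<And>p. p \<in> G (- 1) \<Longrightarrow> h (CP.S p) = p" "\<And>q. q \<in> G 1 \<Longrightarrow> h (CP.T q) = q"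
    using CP_inclusion_hom by blast
  interpret h: rhom CP.B A h by fact
  have hf: "h (f x) = x" if "x \<in> rcarrier A" for x
    by (rule rhom_eq_on_generators[OF gens(4) rhom_compose[OF f(1) h] rhom_id _ that])
      (use gens(1-3) f_gen h_gen in auto)
  have f_eq: "f x = k x"
    if x: "x \<in> G i" and k: "CP.component i \<subseteq> k ` G i" "\<And>y. y \<in> G i \<Longrightarrow> h (k y) = y" for x i k
  proof -
    obtain y where "y \<in> G i" "f x = k y" using f(2)[of i] x k(1) by blast
    then show ?thesis using hf[OF component_closed[OF x]] k(2)[of y] by simp
  qed
  note f_components = f_eq[OF _ CP_component_zero_subset h_gen(1)]
    f_eq[OF _ CP_component_one_subset h_gen(3)] f_eq[OF _ CP_component_minus_one_subset h_gen(2)]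
  have fh: "f (h x) = x" if "x \<in> rcarrier CP.B" for x
    by (rule rhom_eq_on_generators[OF CP.generates_rel_cp rhom_compose[OF h f(1)] CP.rhom_id _ that])
      (auto simp: h_gen f_components)
  have "CP.component i \<subseteq> f ` G i" for i
  proof
    fix x assume x: "x \<in> CP.component i"
    have "h ` CP.component i \<subseteq> G i"
      by (rule CP.rhom_component_subset[OF h graded_rng_axioms]) (simp_all add: h_gen)
    then show "x \<in> f ` G i" using x fh[OF CP.component_closed[OF x]]
      by (intro image_eqI[of _ f "h x"]) auto
  qed
  then have "f ` G i = CP.component i" for i by (intro equalityI f(2))
  moreover have "bij_betw f (rcarrier A) (rcarrier CP.B)"
    by (rule bij_betw_byWitness[of _ h]) (use hf fh f.map_closed h.map_closed in auto)
  ultimately show ?thesis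
    unfolding gr_iso_def by (intro exI[of _ f]) (simp add: f.map_add f.map_mul)
qed

end

lemma gr_iso_unital_prod_set:
  assumes "nuring A" "nuring B" "gr_iso A G B H" "\<And>i. G i \<subseteq> rcarrier A"
    and "unital_ideal A (prod_set A (G i) (G j))"
  shows "unital_ideal B (prod_set B (H i) (H j))"
proof -
  interpret A: nuring A by fact
  interpret B: nuring B by fact
  obtain f where f: "bij_betw f (rcarrier A) (rcarrier B)" "\<And>i. f ` G i = H i"
    "\<And>x y. x \<in> rcarrier A \<Longrightarrow> y \<in> rcarrier A \<Longrightarrow>
      f (radd A x y) = radd B (f x) (f y) \<and> f (rmul A x y) = rmul B (f x) (f y)"
    using assms(3) unfolding gr_iso_def by metis
  interpret f: rhom A B f
    using f(1,3) by unfold_locales (auto simp: bij_betw_def)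
  have "prod_set A (G i) (G j) \<subseteq> rcarrier A"
    using A.is_addsub_prod_set[OF assms(4,4)] by (auto simp: is_addsub_def)
  then show ?thesis
    using f.unital_ideal_image[OF _ assms(5)] f.prod_set_image[OF assms(4,4)] by (simp add: f(2))
qed

context relative_cp
begin

context
  fixes \<epsilon> assumes eps: "eps_graded_rng B component \<epsilon>"
begin

interpretation eps_graded_rng B component \<epsilon> by (rule eps)

lemma J_covariant_rep_CP:
  "J_covariant_rep R P Q psi CP.B (\<lambda>r. CP.\<sigma> (\<sigma> r)) (\<lambda>p. CP.S (S p)) (\<lambda>q. CP.T (T q)) J"
proof -
  note rep_rules = CP.sigma.map_add CP.sigma.map_mul CP.S_add CP.T_add CP.S_ract CP.S_lact CP.T_ract
    CP.T_lact CP.sigma_psi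
  show ?thesis
  proof unfold_locales
    fix x l assume x: "x \<in> J" and l: "set l \<subseteq> mcar Q \<times> mcar P"
      and theta: "\<And>y. y \<in> mcar Q \<Longrightarrow> lact Q x y = theta_Q Q psi l y"
    have "CP.\<sigma> (\<sigma> x) = CP.\<sigma> (rsum_mul B (map (map_prod T S) l))"
      using sigma_J[OF x l theta] by simp
    also have "\<dots> = rsum_mul CP.B (map (map_prod CP.T CP.S) (map (map_prod T S) l))"
      by (rule CP_sigma_sum) (use l generators_in_component in auto)
    finally show "CP.\<sigma> (\<sigma> x) = rsum_mul CP.B (map (map_prod (\<lambda>q. CP.T (T q)) (\<lambda>p. CP.S (S p))) l)"
      by (simp add: prod.map_comp comp_def)
  qed (simp_all add: generators_in_component sigma.map_add sigma.map_mul S_add T_add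
      S_ract S_lact T_ract T_lact sigma_psi rep_rules[simplified] J_subset)
qed

theorem eps_strongly_graded_gr_iso:
  "gr_iso B component (cp_ring A\<^sub>0 (M (- 1)) (M 1) (rmul B)) (cp_grading A\<^sub>0 (M (- 1)) (M 1) (rmul B))"
proof -
  obtain f where f: "rhom B CP.B f" "\<And>r. r \<in> rcarrier R \<Longrightarrow> f (\<sigma> r) = CP.\<sigma> (\<sigma> r)"
    "\<And>p. p \<in> mcar P \<Longrightarrow> f (S p) = CP.S (S p)" "\<And>q. q \<in> mcar Q \<Longrightarrow> f (T q) = CP.T (T q)"
    using rel_cp_universal[OF J_covariant_rep_CP] by blast
  have f_graded: "f ` component i \<subseteq> CP.component i" for i
    by (rule rhom_component_subset[OF f(1) CP.graded_rng_axioms])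
      (use f(2-4) generators_in_component CP.generators_in_component in simp_all)
  have "gr_iso B component CP.B CP.component"
    by (rule gr_iso_CP[OF _ _ _ generates_rel_cp f(1) f_graded])
      (use f(2-4) generators_in_component in auto)
  then show ?thesis unfolding cp_components_eq .
qed

lemma unital_Ik_components:
  "unital_ideal (cp_ring A\<^sub>0 (M (- 1)) (M 1) (rmul B)) (cp_Ik A\<^sub>0 (M (- 1)) (M 1) (rmul B) k)"
  using gr_iso_unital_prod_set[OF nuring_axioms CP.nuring_axioms
      eps_strongly_graded_gr_iso[unfolded cp_components_eq] component_subset
      unital_ideal_prod_set[of "- int k"]]
  by (simp add: cp_components_eq CP.semi_full)

end

end

theorem mainTheorem2:
  fixes R :: "'r rng" and P :: "('r,'p) bimod" and Q :: "('r,'q) bimod" and psi :: "'p \<Rightarrow> 'q \<Rightarrow> 'r"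
    and R2 :: "'s rng" and P2 :: "('s,'u) bimod" and Q2 :: "('s,'v) bimod" and psi2 :: "'u \<Rightarrow> 'v \<Rightarrow> 's"
  shows
   "(rsystem R P Q psi \<and> cond_FS R P Q psi \<and> cp_well_defined R P Q psi \<and>
     eps_strongly_graded (cp_ring R P Q psi) (cp_grading R P Q psi) \<and>
     ann0 (cp_ring R P Q psi) (cp_grading R P Q psi) \<inter>
       perp0 (cp_ring R P Q psi) (cp_grading R P Q psi) (ann0 (cp_ring R P Q psi) (cp_grading R P Q psi))
       = {rzero (cp_ring R P Q psi)}
    \<longrightarrow> (\<exists>(R' :: ('r,'p,'q) cpelt rng) (P' :: (('r,'p,'q) cpelt, ('r,'p,'q) cpelt) bimod)
          (Q' :: (('r,'p,'q) cpelt, ('r,'p,'q) cpelt) bimod) psi'.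
          rsystem R' P' Q' psi' \<and> cp_well_defined R' P' Q' psi' \<and>
          unital_system R' P' Q' \<and>
          cp_semi_full R' P' Q' psi' \<and>
          cond_FS' R' P' Q' psi' \<and>
          (\<forall>k. unital_ideal (cp_ring R' P' Q' psi') (cp_Ik R' P' Q' psi' k)) \<and>
          gr_iso (cp_ring R P Q psi) (cp_grading R P Q psi) (cp_ring R' P' Q' psi') (cp_grading R' P' Q' psi')))
  \<and>
   (rsystem R2 P2 Q2 psi2 \<and> cp_well_defined R2 P2 Q2 psi2 \<and>
     unital_system R2 P2 Q2 \<and> cp_semi_full R2 P2 Q2 psi2 \<and> cond_FS' R2 P2 Q2 psi2 \<and>
     (\<forall>k. unital_ideal (cp_ring R2 P2 Q2 psi2) (cp_Ik R2 P2 Q2 psi2 k))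
    \<longrightarrow> eps_strongly_graded (cp_ring R2 P2 Q2 psi2) (cp_grading R2 P2 Q2 psi2))"
proof ((intro conjI impI; elim conjE), goal_cases realization converse)
  case realization
  interpret relative_cp R P Q psi "cp_ideal R P Q psi" by (rule relative_cp_cp_ideal) fact+
  note cp_eq = cp_ring_eq[OF refl] cp_grading_eq[OF refl]
  obtain \<epsilon> where \<epsilon>: "eps_graded_rng B component \<epsilon>"
    using eps_strongly_graded_obtain_units realization(4) unfolding cp_eq by blast
  interpret eps_graded_rng B component \<epsilon> by (rule \<epsilon>)
  show ?case
    unfolding cp_eq
    by (intro exI conjI allI, rule rsystem_components, rule cp_well_defined_components,
        rule unital_system_components, rule semi_full_components, rule cond_FS'_components,
        rule unital_Ik_components[OF \<epsilon>], rule eps_strongly_graded_gr_iso[OF \<epsilon>])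
next
  case converse
  then show ?case by (intro unital_FS'_eps_strongly_graded) auto
qed

end
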